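(* Suppose that $$AT>1,\qquad \rho>\xi(1-\sigma),\qquad \frac{\rho-\xi(1-\sigma)}{\sigma}<A.$$ Let $\bar\iota\in L^2(-T,0;\mathbb R)$ with $\bar\iota(s)\ge0$ for a.e. $s\in[-T,0)$, let $k_0=\int_{-T}^0\bar\iota(s)\,ds$ with $k_0>0$, and let $x=(k_0,F(\bar\iota))$. Then the closed-loop system $$y'(t)=\mathcal A^*y(t)+B^*\Phi(y(t)),\qquad y(0)=x,$$ driven by the feedback map $$\Phi(x)=Ax^0-\nu^{-1/\sigma}\left(\frac A\xi\right)^{1/\sigma}\Gamma_0(x),\qquad\nu=\left(\frac{\rho-\xi(1-\sigma)}{\sigma}\right)^{-\sigma}\left(\frac A\xi\right)^{1-\sigma},$$ has a unique solution $y(\cdot)$; this solution remains in $\mathcal O$ for all $t\ge0$, and moreover $y^0(t)$ and $\Phi(y(t))$ remain positive. Consequently, the control $i^*(t)=\Phi(y(t))$ is optimal for the original delay problem with initial datum $\bar\iota$ (with positivity constraints on capital, investment and consumption), and the value of that problem is $$V(x)=v(x):=\nu\,\frac{[\Gamma_0(x)]^{1-\sigma}}{1-\sigma}.$$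
   Context: $A>0$, $T>0$, $\rho>0$, $\sigma>0$ with $\sigma\ne1$ are real constants. When $AT>1$, $\xi$ denotes the unique strictly positive root of $z=A(1-e^{-zT})$. Original delay problem. Given $\bar\iota\in L^2(-T,0;\mathbb R^+)$, a control $i(\cdot)$ (investment) determines the capital $k(\cdot)$ by $k'(t)=i(t)-i(t-T)$ for $t\ge0$, $i(s)=\bar\iota(s)$ for $s\in[-T,0)$, $k(0)=\int_{-T}^0\bar\iota(s)\,ds$. Admissible controls: $i(\cdot)\in L^2_{\rm loc}([0,\infty);\mathbb R^+)$ with $i(t)\in[0,Ak(t)]$ for all $t\ge0$ (a.e.). Objective to be maximized: $J(\bar\iota;i)=\int_0^\infty e^{-\rho t}\frac{(Ak(t)-i(t))^{1-\sigma}}{1-\sigma}\,dt$ (possibly $-\infty$ when $\sigma>1$); the value $V(x)$, with $x=(k_0,F(\bar\iota))$, is its supremum over admissible controls. Consumption is $c(t)=Ak(t)-i(t)$. Hilbert space formulation. $X=\mathbb R\times L^2(-T,0;\mathbb R)$ with elements $x=(x^0,x^1)$; $F(z)(s)=-z(-T-s)$ for $z\in L^2(-T,0;\mathbb R)$. $D(\mathcal A)=\{(\psi^0,\psi^1)\in X:\psi^1\in W^{1,2}(-T,0;\mathbb R),\ \psi^0=\psi^1(0)\}$, $\mathcal A(\psi^0,\psi^1)=(0,\frac{d}{ds}\psi^1)$; $B:D(\mathcal A)\to\mathbb R$, $B(\psi^0,\psi^1)=\psi^1(0)-\psi^1(-T)$. Their adjoints are viewed as $\mathcal A^*:X\to D(\mathcal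 A)'$ and $B^*:\mathbb R\to D(\mathcal A)'$. Solutions of $y'=\mathcal A^*y+B^*i$ (and of the closed-loop system) are understood in the class of functions which, for every $\tau>0$, belong to $C([0,\tau];X)$ with derivative in $L^2(0,\tau;D(\mathcal A)')$. For $x=(k_0,F(\bar\iota))$ with $k_0=\int_{-T}^0\bar\iota$, the unique such solution of $y'=\mathcal A^*y+B^*i$, $y(0)=x$, is $y(t)=(k(t),F(i(t+\cdot)|_{[-T,0]}))$, where $i=\bar\iota$ on $[-T,0)$. $\Gamma_0(x)=x^0+\int_{-T}^0e^{\xi s}x^1(s)\,ds$ and $$\mathcal O=\left\{x\in X:\ \Gamma_0(x)>0\ \text{ and }\ Ax^0>\nu^{-1/\sigma}\left(\tfrac A\xi\right)^{1/\sigma}\Gamma_0(x)\right\}.$$ *)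

theory Defs
  imports "HOL-Analysis.Analysis"
begin

section \<open>Square-integrable functions and the space X\<close>

text \<open>
  Elements of \<open>L\<^sup>2(S)\<close> are handled through representatives \<open>real \<Rightarrow> real\<close>, whose values outside
  \<open>S\<close> are irrelevant; equality in \<open>L\<^sup>2(S)\<close> is equality almost everywhere on \<open>S\<close>. Accordingly an
  element of \<open>X = \<real> \<times> L\<^sup>2(-T,0)\<close> is represented by a pair, and \<open>eqX\<close> is equality in \<open>X\<close>.
\<close>

definition square_integrable_on :: "(real \<Rightarrow> real) \<Rightarrow> real set \<Rightarrow> bool" where
  "square_integrable_on f S \<longleftrightarrow>
     f \<in> borel_measurable (lebesgue_on S) \<and> integrable (lebesgue_on S) (\<lambda>s. (f s)\<^sup>2)"

type_synonym state = "real \<times> (real \<Rightarrow> real)"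

definition spaceX :: "real \<Rightarrow> state set" where
  "spaceX T = {x. square_integrable_on (snd x) {-T..0}}"

definition eqX :: "real \<Rightarrow> state \<Rightarrow> state \<Rightarrow> bool" where
  "eqX T x y \<longleftrightarrow> fst x = fst y \<and> (AE s in lebesgue_on {-T..0}. snd x s = snd y s)"

definition addX :: "state \<Rightarrow> state \<Rightarrow> state" where
  "addX x y = (fst x + fst y, \<lambda>s. snd x s + snd y s)"

definition scaleX :: "real \<Rightarrow> state \<Rightarrow> state" where
  "scaleX c x = (c * fst x, \<lambda>s. c * snd x s)"

definition innerX :: "real \<Rightarrow> state \<Rightarrow> state \<Rightarrow> real" where
  "innerX T x y = fst x * fst y + (LINT s|lebesgue_on {-T..0}. snd x s * snd y s)"

definition normX :: "real \<Rightarrow> state \<Rightarrow> real" where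
  "normX T x = sqrt (innerX T x x)"

definition distX :: "real \<Rightarrow> state \<Rightarrow> state \<Rightarrow> real" where
  "distX T x y = normX T (addX x (scaleX (-1) y))"

definition continuousX :: "real \<Rightarrow> real \<Rightarrow> (real \<Rightarrow> state) \<Rightarrow> bool" where
  "continuousX T \<tau> y \<longleftrightarrow>
     (\<forall>t\<in>{0..\<tau>}. y t \<in> spaceX T \<and> ((\<lambda>s. distX T (y s) (y t)) \<longlongrightarrow> 0) (at t within {0..\<tau>}))"

definition F :: "real \<Rightarrow> (real \<Rightarrow> real) \<Rightarrow> real \<Rightarrow> real" where
  "F T z = (\<lambda>s. - z (-T - s))"


section \<open>The operators A and B, and the dual of D(A)\<close>

text \<open>
  \<open>W\<^sup>1\<^sup>,\<^sup>2(-T,0)\<close>: \<open>f\<close> is the absolutely continuous representative on \<open>[-T,0]\<close> and \<open>g\<close> its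
  derivative in \<open>L\<^sup>2(-T,0)\<close>; \<open>g\<close> is determined by \<open>f\<close> up to a null set. Using the continuous
  representative makes the point values \<open>f 0\<close> and \<open>f (-T)\<close> meaningful.
\<close>

definition has_L2_derivative :: "real \<Rightarrow> (real \<Rightarrow> real) \<Rightarrow> (real \<Rightarrow> real) \<Rightarrow> bool" where
  "has_L2_derivative T f g \<longleftrightarrow> square_integrable_on g {-T..0} \<and>
     (\<forall>s\<in>{-T..0}. f s = f (-T) + (LINT r|lebesgue_on {-T..s}. g r))"

definition W12 :: "real \<Rightarrow> (real \<Rightarrow> real) set" where
  "W12 T = {f. \<exists>g. has_L2_derivative T f g}"

definition L2_deriv :: "real \<Rightarrow> (real \<Rightarrow> real) \<Rightarrow> real \<Rightarrow> real" where
  "L2_deriv T f = (SOME g. has_L2_derivative T f g)"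

definition domA :: "real \<Rightarrow> state set" where
  "domA T = {\<psi>. snd \<psi> \<in> W12 T \<and> fst \<psi> = snd \<psi> 0}"

definition opA :: "real \<Rightarrow> state \<Rightarrow> state" where
  "opA T \<psi> = (0, L2_deriv T (snd \<psi>))"

definition opB :: "real \<Rightarrow> state \<Rightarrow> real" where
  "opB T \<psi> = snd \<psi> 0 - snd \<psi> (-T)"

definition graph_norm :: "real \<Rightarrow> state \<Rightarrow> real" where
  "graph_norm T \<psi> = sqrt ((normX T \<psi>)\<^sup>2 + (normX T (opA T \<psi>))\<^sup>2)"

text \<open>
  \<open>D(A)'\<close> consists of the bounded linear functionals on \<open>D(A)\<close> with the graph norm; two functionals
  are identified if they agree on \<open>D(A)\<close>.
\<close>

type_synonym functional = "state \<Rightarrow> real"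

definition dualA :: "real \<Rightarrow> functional set" where
  "dualA T = {l.
     (\<forall>\<psi>\<in>domA T. \<forall>\<phi>\<in>domA T. l (addX \<psi> \<phi>) = l \<psi> + l \<phi>) \<and>
     (\<forall>c. \<forall>\<psi>\<in>domA T. l (scaleX c \<psi>) = c * l \<psi>) \<and>
     (\<exists>C. \<forall>\<psi>\<in>domA T. \<bar>l \<psi>\<bar> \<le> C * graph_norm T \<psi>)}"

definition dual_norm :: "real \<Rightarrow> functional \<Rightarrow> real" where
  "dual_norm T l = (SUP \<psi>\<in>{\<psi>\<in>domA T. graph_norm T \<psi> \<le> 1}. \<bar>l \<psi>\<bar>)"

definition embedX :: "real \<Rightarrow> state \<Rightarrow> functional" where
  "embedX T x = (\<lambda>\<psi>. innerX T x \<psi>)"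

definition adjA :: "real \<Rightarrow> state \<Rightarrow> functional" where
  "adjA T x = (\<lambda>\<psi>. innerX T x (opA T \<psi>))"

definition adjB :: "real \<Rightarrow> real \<Rightarrow> functional" where
  "adjB T u = (\<lambda>\<psi>. u * opB T \<psi>)"


section \<open>Solutions of the state equation\<close>

text \<open>Strong (Bochner) measurability: almost everywhere limit, in the norm of \<open>D(A)'\<close>, of simple
  functions.\<close>

definition strongly_measurable_dualA :: "real \<Rightarrow> real \<Rightarrow> (real \<Rightarrow> functional) \<Rightarrow> bool" where
  "strongly_measurable_dualA T \<tau> z \<longleftrightarrow>
     (\<exists>S :: nat \<Rightarrow> real \<Rightarrow> functional.
        (\<forall>n. simple_function (lebesgue_on {0..\<tau>}) (S n) \<and> (\<forall>t\<in>{0..\<tau>}. S n t \<in> dualA T)) \<and>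
        (AE t in lebesgue_on {0..\<tau>}.
           (\<lambda>n. dual_norm T (\<lambda>\<psi>. S n t \<psi> - z t \<psi>)) \<longlonglongrightarrow> 0))"

definition L2_dualA :: "real \<Rightarrow> real \<Rightarrow> (real \<Rightarrow> functional) set" where
  "L2_dualA T \<tau> = {z.
     (AE t in lebesgue_on {0..\<tau>}. z t \<in> dualA T) \<and>
     strongly_measurable_dualA T \<tau> z \<and>
     integrable (lebesgue_on {0..\<tau>}) (\<lambda>t. (dual_norm T (z t))\<^sup>2)}"

text \<open>
  The derivative of \<open>y\<close>, seen as a function into \<open>D(A)'\<close>, is \<open>z \<in> L\<^sup>2(0,\<tau>;D(A)')\<close>:
  \<open>y(t) = y(0) + \<integral>\<^sub>0\<^sup>t z(s) ds\<close> with a Bochner integral in \<open>D(A)'\<close>. Both sides are functionals, so the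
  equality is tested on each \<open>\<psi> \<in> D(A)\<close>, and evaluation at \<open>\<psi>\<close> commutes with the Bochner integral.
\<close>

definition has_derivative_dualA ::
  "real \<Rightarrow> real \<Rightarrow> (real \<Rightarrow> state) \<Rightarrow> (real \<Rightarrow> functional) \<Rightarrow> bool" where
  "has_derivative_dualA T \<tau> y z \<longleftrightarrow> z \<in> L2_dualA T \<tau> \<and>
     (\<forall>t\<in>{0..\<tau>}. \<forall>\<psi>\<in>domA T.
        embedX T (y t) \<psi> = embedX T (y 0) \<psi> + (LINT s|lebesgue_on {0..t}. z s \<psi>))"

text \<open>\<open>y' = A\<^sup>* y + B\<^sup>* u\<close>, \<open>y(0) = x\<close>, with the equation holding in \<open>D(A)'\<close> for almost every \<open>t\<close>.\<close>

definition state_solution ::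
  "real \<Rightarrow> (real \<Rightarrow> real) \<Rightarrow> state \<Rightarrow> (real \<Rightarrow> state) \<Rightarrow> bool" where
  "state_solution T u x y \<longleftrightarrow> eqX T (y 0) x \<and>
     (\<forall>\<tau>>0. continuousX T \<tau> y \<and>
        (\<exists>z. has_derivative_dualA T \<tau> y z \<and>
          (AE t in lebesgue_on {0..\<tau>}. \<forall>\<psi>\<in>domA T. z t \<psi> = adjA T (y t) \<psi> + adjB T (u t) \<psi>)))"

definition closed_loop_solution ::
  "real \<Rightarrow> (state \<Rightarrow> real) \<Rightarrow> state \<Rightarrow> (real \<Rightarrow> state) \<Rightarrow> bool" where
  "closed_loop_solution T \<Phi> x y \<longleftrightarrow> state_solution T (\<lambda>t. \<Phi> (y t)) x y"


section \<open>The explicit value function and feedback\<close>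

definition xi :: "real \<Rightarrow> real \<Rightarrow> real" where
  "xi A T = (THE z. z > 0 \<and> z = A * (1 - exp (- z * T)))"

definition nu :: "real \<Rightarrow> real \<Rightarrow> real \<Rightarrow> real \<Rightarrow> real" where
  "nu A T \<rho> \<sigma> = ((\<rho> - xi A T * (1 - \<sigma>)) / \<sigma>) powr (- \<sigma>) * (A / xi A T) powr (1 - \<sigma>)"

definition Gamma0 :: "real \<Rightarrow> real \<Rightarrow> state \<Rightarrow> real" where
  "Gamma0 A T x = fst x + (LINT s|lebesgue_on {-T..0}. exp (xi A T * s) * snd x s)"

definition region :: "real \<Rightarrow> real \<Rightarrow> real \<Rightarrow> real \<Rightarrow> state set" where
  "region A T \<rho> \<sigma> = {x \<in> spaceX T. Gamma0 A T x > 0 \<and>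
     A * fst x > nu A T \<rho> \<sigma> powr (- 1 / \<sigma>) * (A / xi A T) powr (1 / \<sigma>) * Gamma0 A T x}"

definition feedback :: "real \<Rightarrow> real \<Rightarrow> real \<Rightarrow> real \<Rightarrow> state \<Rightarrow> real" where
  "feedback A T \<rho> \<sigma> x =
     A * fst x - nu A T \<rho> \<sigma> powr (- 1 / \<sigma>) * (A / xi A T) powr (1 / \<sigma>) * Gamma0 A T x"

definition v :: "real \<Rightarrow> real \<Rightarrow> real \<Rightarrow> real \<Rightarrow> state \<Rightarrow> real" where
  "v A T \<rho> \<sigma> x = nu A T \<rho> \<sigma> * (Gamma0 A T x powr (1 - \<sigma>) / (1 - \<sigma>))"


section \<open>The delay optimal control problem\<close>

definition glue :: "(real \<Rightarrow> real) \<Rightarrow> (real \<Rightarrow> real) \<Rightarrow> real \<Rightarrow> real" where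
  "glue \<iota> i = (\<lambda>s. if s < 0 then \<iota> s else i s)"

definition initial_capital :: "real \<Rightarrow> (real \<Rightarrow> real) \<Rightarrow> real" where
  "initial_capital T \<iota> = (LINT s|lebesgue_on {-T..0}. \<iota> s)"

text \<open>The (locally absolutely continuous) solution of \<open>k'(t) = i(t) - i(t - T)\<close>,
  \<open>k(0) = \<integral> \<iota>\<close>, in integrated form.\<close>

definition capital :: "real \<Rightarrow> (real \<Rightarrow> real) \<Rightarrow> (real \<Rightarrow> real) \<Rightarrow> real \<Rightarrow> real" where
  "capital T \<iota> i t = initial_capital T \<iota> +
     (LINT s|lebesgue_on {0..t}. glue \<iota> i s - glue \<iota> i (s - T))"

definition consumption :: "real \<Rightarrow> real \<Rightarrow> (real \<Rightarrow> real) \<Rightarrow> (real \<Rightarrow> real) \<Rightarrow> real \<Rightarrow> real" where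
  "consumption A T \<iota> i t = A * capital T \<iota> i t - i t"

definition admissible :: "real \<Rightarrow> real \<Rightarrow> (real \<Rightarrow> real) \<Rightarrow> (real \<Rightarrow> real) set" where
  "admissible A T \<iota> = {i. (\<forall>\<tau>>0. square_integrable_on i {0..\<tau>}) \<and>
     (AE t in lebesgue_on {0..}. 0 \<le> i t \<and> i t \<le> A * capital T \<iota> i t)}"

text \<open>\<open>c\<^sup>1\<^sup>-\<^sup>\<sigma>/(1-\<sigma>)\<close> for \<open>c \<ge> 0\<close>. At \<open>c = 0\<close> with \<open>\<sigma> > 1\<close> the value is \<open>-\<infinity>\<close>, whereas \<open>powr\<close>
  would give \<open>0\<close>.\<close>

definition utility :: "real \<Rightarrow> real \<Rightarrow> ereal" where
  "utility \<sigma> c = (if c = 0 \<and> \<sigma> > 1 then - \<infinity> else ereal (c powr (1 - \<sigma>) / (1 - \<sigma>)))"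

text \<open>Lebesgue integral with values in the extended reals, as positive minus negative part; the
  integrand of the objective has a constant sign, so \<open>\<infinity> - \<infinity>\<close> does not occur there.\<close>

definition ereal_integral :: "'a measure \<Rightarrow> ('a \<Rightarrow> ereal) \<Rightarrow> ereal" where
  "ereal_integral M f =
     enn2ereal (\<integral>\<^sup>+ t. e2ennreal (f t) \<partial>M) - enn2ereal (\<integral>\<^sup>+ t. e2ennreal (- f t) \<partial>M)"

definition objective ::
  "real \<Rightarrow> real \<Rightarrow> real \<Rightarrow> real \<Rightarrow> (real \<Rightarrow> real) \<Rightarrow> (real \<Rightarrow> real) \<Rightarrow> ereal" where
  "objective A T \<rho> \<sigma> \<iota> i = ereal_integral (lebesgue_on {0..})
     (\<lambda>t. ereal (exp (- \<rho> * t)) * utility \<sigma> (consumption A T \<iota> i t))"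

text \<open>The map \<open>\<iota> \<mapsto> (\<integral> \<iota>, F \<iota>)\<close> is injective, so the value function \<open>V(x)\<close> is written as a
  function of \<open>\<iota>\<close>.\<close>

definition value_function ::
  "real \<Rightarrow> real \<Rightarrow> real \<Rightarrow> real \<Rightarrow> (real \<Rightarrow> real) \<Rightarrow> ereal" where
  "value_function A T \<rho> \<sigma> \<iota> = (SUP i\<in>admissible A T \<iota>. objective A T \<rho> \<sigma> \<iota> i)"

definition optimal ::
  "real \<Rightarrow> real \<Rightarrow> real \<Rightarrow> real \<Rightarrow> (real \<Rightarrow> real) \<Rightarrow> (real \<Rightarrow> real) \<Rightarrow> bool" where
  "optimal A T \<rho> \<sigma> \<iota> i \<longleftrightarrow> i \<in> admissible A T \<iota> \<and>
     (\<forall>j\<in>admissible A T \<iota>. objective A T \<rho> \<sigma> \<iota> j \<le> objective A T \<rho> \<sigma> \<iota> i)"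

end

theory Submission
  imports Defs
begin

text \<open>
  Solutions of the state equation are exactly the pairs of capital and reflected history generated by
  their control. Testing the equation with \<open>(1, exp (\<xi> s)) \<in> D(A)\<close> turns it into the scalar law
  \<open>\<Gamma>\<^sub>0' = \<xi> \<Gamma>\<^sub>0 - (\<xi> / A) c\<close> for \<open>c = A k - i\<close>. In the closed loop \<open>c\<close> is a multiple of \<open>\<Gamma>\<^sub>0\<close>, so
  \<open>\<Gamma>\<^sub>0\<close> is an explicit exponential and the control solves a linear Volterra equation. For an arbitrary
  admissible control the scalar law and \<open>\<Gamma>\<^sub>0 \<ge> 0\<close> give the budget constraint
  \<open>\<integral> exp (- \<xi> t) c dt \<le> (A / \<xi>) \<Gamma>\<^sub>0(x)\<close>, with equality in the closed loop, whose discounted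
  marginal utility is a multiple of \<open>exp (- \<xi> t)\<close>. Concavity of the utility then shows optimality
  and the integral along the exponential gives the value.
\<close>

section \<open>Square-integrable functions\<close>

text \<open>The test function \<psi> = (1, exp (\<xi> s)) is almost an eigenvector: A \<psi> = \<xi>
  (\<psi> - (1, 0)), and B \<psi> = 1 - exp (- \<xi> T) equals \<xi> / A precisely because \<xi>
  solves its defining equation. This is why capital and investment occur in the scalar law only
  through consumption. The obstacle is the weak solution class. Investment histories are merely
  square integrable and the derivative lives in the dual of D(A), so product rules are replaced by
  exchanges of integrals, and uniqueness is proved with test functions that move in time. Uniqueness
  of the closed loop is reduced to that of an open loop: the feedback along any solution is a
  continuous function of time, hence a prescribed control, and the closed-loop condition becomes an
  equation for this control alone.\<close>

lemma L2_iff: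
  "square_integrable_on f {a..b} \<longleftrightarrow>
     f absolutely_integrable_on {a..b} \<and> (\<lambda>x. (f x)\<^sup>2) integrable_on {a..b}" (is "?L \<longleftrightarrow> ?R")
proof
  assume L: ?L
  then have m: "f \<in> borel_measurable (lebesgue_on {a..b})" and 2: "(\<lambda>x. (f x)\<^sup>2) integrable_on {a..b}"
    by (auto simp: square_integrable_on_def integrable_on_lebesgue_on)
  \<comment> \<open>On a bounded interval the constant 1 is integrable, so square integrability
    controls the function itself through this majorant.\<close>
  have "(\<lambda>x. 1 + (f x)\<^sup>2) integrable_on {a..b}"
    using 2 by (intro integrable_add) auto
  moreover have "norm (f x) \<le> 1 + (f x)\<^sup>2" for x
  proof -
    have "0 \<le> (\<bar>f x\<bar> - 1/2)\<^sup>2" by simp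
    then show ?thesis by (simp add: power2_eq_square algebra_simps flip: abs_mult)
  qed
  ultimately show ?R using 2 m
    by (auto intro: measurable_bounded_by_integrable_imp_absolutely_integrable)
next
  assume R: ?R
  then have "(\<lambda>x. (f x)\<^sup>2) absolutely_integrable_on {a..b}"
    by (intro nonnegative_absolutely_integrable_1) auto
  then show ?L using R
    by (auto simp: square_integrable_on_def absolutely_integrable_imp_borel_measurable
        absolutely_integrable_imp_integrable)
qed

lemma L2_integrable:
  assumes "square_integrable_on f {a..b}"
  shows "f absolutely_integrable_on {a..b}" "f integrable_on {a..b}" "(\<lambda>x. (f x)\<^sup>2) integrable_on {a..b}"
  using assms by (auto simp: L2_iff absolutely_integrable_on_def)

lemma L2_mult:
  assumes "square_integrable_on f {a..b}" "square_integrable_on g {a..b}"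
  shows "(\<lambda>x. f x * g x) absolutely_integrable_on {a..b}"
proof (rule measurable_bounded_by_integrable_imp_absolutely_integrable)
  show "(\<lambda>x. f x * g x) \<in> borel_measurable (lebesgue_on {a..b})"
    using assms by (auto simp: square_integrable_on_def)
  show "(\<lambda>x. (f x)\<^sup>2 + (g x)\<^sup>2) integrable_on {a..b}"
    using assms by (auto simp: L2_iff intro: integrable_add)
  show "norm (f x * g x) \<le> (f x)\<^sup>2 + (g x)\<^sup>2" for x
  proof -
    have "0 \<le> (\<bar>f x\<bar> - \<bar>g x\<bar>)\<^sup>2" "0 \<le> \<bar>f x\<bar> * \<bar>g x\<bar>" by auto
    then show ?thesis unfolding power2_diff power2_abs real_norm_def abs_mult by linarith
  qed
qed auto

lemma L2_mult_integrable:
  "square_integrable_on f {a..b} \<Longrightarrow> square_integrable_on g {a..b} \<Longrightarrow> (\<lambda>x. f x * g x) integrable_on {a..b}"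
  using L2_mult absolutely_integrable_on_def by blast

lemma L2_scale:
  "square_integrable_on f {a..b} \<Longrightarrow> square_integrable_on (\<lambda>x. c * f x) {a..b}"
  by (auto simp: L2_iff power_mult_distrib intro: integrable_on_mult_right)

lemma L2_add:
  assumes "square_integrable_on f {a..b}" "square_integrable_on g {a..b}"
  shows "square_integrable_on (\<lambda>x. f x + g x) {a..b}"
proof -
  have "(\<lambda>x. (f x)\<^sup>2 + (g x)\<^sup>2 + 2 * (f x * g x)) integrable_on {a..b}"
    using assms L2_mult_integrable[OF assms]
    by (auto simp: L2_iff intro!: integrable_add)
  then show ?thesis using assms
    by (auto simp: L2_iff power2_sum mult.assoc intro: set_integral_add)
qed

lemma L2_minus:
  "square_integrable_on f {a..b} \<Longrightarrow> square_integrable_on (\<lambda>x. - f x) {a..b}"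
  using L2_scale[of f a b "-1"] by simp

lemma L2_diff:
  "square_integrable_on f {a..b} \<Longrightarrow> square_integrable_on g {a..b} \<Longrightarrow>
   square_integrable_on (\<lambda>x. f x - g x) {a..b}"
  using L2_add[of f a b "\<lambda>x. - g x"] L2_minus by auto

lemma L2_continuous:
  "continuous_on {a..b} f \<Longrightarrow> square_integrable_on f {a..b}"
  by (auto simp: L2_iff intro!: absolutely_integrable_continuous_real
      integrable_continuous_real continuous_intros)

lemma L2_subinterval:
  "square_integrable_on f {a..b} \<Longrightarrow> {c..d} \<subseteq> {a..b} \<Longrightarrow> square_integrable_on f {c..d}"
  unfolding L2_iff
  by (meson absolutely_integrable_on_subinterval integrable_on_subinterval)

lemma L2_spike:
  assumes "square_integrable_on f {a..b}" "negligible N" "\<And>x. x \<in> {a..b} - N \<Longrightarrow> g x = f x"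
  shows "square_integrable_on g {a..b}"
  using assms absolutely_integrable_spike[where f=f and T="{a..b}" and S=N and g=g]
    integrable_spike[where f="\<lambda>x. (f x)\<^sup>2" and T="{a..b}" and S=N and g="\<lambda>x. (g x)\<^sup>2"]
  unfolding L2_iff by auto

lemma L2_combine:
  assumes "square_integrable_on f {a..c}" "square_integrable_on f {c..b}" "a \<le> c" "c \<le> b"
  shows "square_integrable_on f {a..b}"
  using assms unfolding L2_iff
  by (meson absolutely_integrable_on_combine Henstock_Kurzweil_Integration.integrable_combine)

section \<open>Reflections, translations and null sets on the real line\<close>

lemma has_integral_reverse:
  fixes f :: "real \<Rightarrow> 'a::real_normed_vector"
  shows "((\<lambda>s. f (c - s)) has_integral i) {a..b} \<longleftrightarrow> (f has_integral i) {c-b..c-a}"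
proof -
  have "((\<lambda>s. f (c - s)) has_integral i) {a..b} \<longleftrightarrow> ((\<lambda>s. f (s + c)) has_integral i) {-b..-a}"
    using has_integral_reflect_real[of "\<lambda>s. f (s + c)" i "-a" "-b"] by simp
  also have "\<dots> \<longleftrightarrow> (f has_integral i) {c-b..c-a}"
    using has_integral_shift_real_ivl_iff[of f i "c-b" "c-a" c] by simp
  finally show ?thesis .
qed

lemma integral_reverse:
  fixes f :: "real \<Rightarrow> 'a::banach"
  shows "integral {a..b} (\<lambda>s. f (c - s)) = integral {c-b..c-a} f"
  unfolding integral_def integrable_on_def has_integral_reverse by simp

lemma integrable_reverse:
  fixes f :: "real \<Rightarrow> 'a::banach"
  shows "(\<lambda>s. f (c - s)) integrable_on {a..b} \<longleftrightarrow> f integrable_on {c-b..c-a}"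
  unfolding integrable_on_def has_integral_reverse by simp

lemma L2_reverse:
  "square_integrable_on (\<lambda>s. f (c - s)) {a..b} \<longleftrightarrow> square_integrable_on f {c-b..c-a}"
  unfolding L2_iff absolutely_integrable_on_def
  using integrable_reverse[of f c a b] integrable_reverse[of "\<lambda>x. norm (f x)" c a b]
    integrable_reverse[of "\<lambda>x. (f x)\<^sup>2" c a b] by auto

lemma L2_shift:
  "square_integrable_on (\<lambda>s. f (s + c)) {a..b} \<longleftrightarrow> square_integrable_on f {a+c..b+c}"
  unfolding L2_iff absolutely_integrable_on_def
  using integrable_shift_real_ivl_iff[of f c "a+c" "b+c"]
    integrable_shift_real_ivl_iff[of "\<lambda>x. norm (f x)" c "a+c" "b+c"]
    integrable_shift_real_ivl_iff[of "\<lambda>x. (f x)\<^sup>2" c "a+c" "b+c"] by auto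

lemma AE_lebesgue_on_iff_negligible:
  assumes "S \<in> sets lebesgue"
  shows "(AE x in lebesgue_on S. P x) \<longleftrightarrow> negligible {x \<in> S. \<not> P x}"
proof -
  have "(AE x in lebesgue_on S. P x) \<longleftrightarrow> (AE x in lebesgue. x \<in> S \<longrightarrow> P x)"
    using assms by (subst AE_restrict_space_iff) auto
  also have "\<dots> \<longleftrightarrow> negligible {x \<in> S. \<not> P x}"
    unfolding eventually_ae_filter_negligible
    by (auto intro: negligible_subset)
  finally show ?thesis .
qed

lemma negligible_reverse:
  fixes N :: "real set"
  assumes "negligible N"
  shows "negligible {s. c - s \<in> N}"
proof -
  have "negligible ((\<lambda>x. c - x) ` N)"
    using assms by (intro negligible_differentiable_image_negligible)
      (auto intro!: derivative_intros)
  moreover have "{s. c - s \<in> N} = (\<lambda>x. c - x) ` N"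
    by (force simp: image_iff algebra_simps)
  ultimately show ?thesis by simp
qed

text \<open>By Lebesgue differentiation the right averages of \<open>f\<close>, extended by zero,
  converge to \<open>f\<close> off a null set; here each of these averages is a difference of
  vanishing primitives.\<close>

lemma integral_eq_0_imp_negligible:
  fixes f :: "real \<Rightarrow> real"
  assumes "\<And>x. x \<in> {a..b} \<Longrightarrow> integral {a..x} f = 0" "f integrable_on {a..b}"
  shows "negligible {x \<in> {a..b}. f x \<noteq> 0}"
proof -
  define F where "F x = (if x \<in> {a..b} then f x else 0)" for x
  have "F integrable_on cbox c d" for c d
  proof -
    have "F integrable_on UNIV"
      using assms(2) unfolding F_def integrable_restrict_UNIV .
    then show ?thesis by (rule integrable_on_subcbox) simp
  qed
  then obtain N where N: "negligible N"
    and *: "\<And>x e. x \<notin> N \<Longrightarrow> 0 < e \<Longrightarrow> \<exists>d>0. \<forall>h. 0 < h \<and> h < d \<longrightarrow>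
              norm (integral (cbox x (x + h *\<^sub>R One)) F /\<^sub>R h ^ DIM(real) - F x) < e"
    using integrable_ccontinuous_explicit[of F] by metis
  have "f x = 0" if x: "x \<in> {a..<b}" "x \<notin> N" for x
  proof (rule ccontr)
    assume "f x \<noteq> 0"
    then have "norm (F x) > 0" using x by (simp add: F_def)
    from *[OF x(2) this] obtain d where d: "d > 0" and **: "\<And>h. 0 < h \<Longrightarrow> h < d \<Longrightarrow>
              norm (integral (cbox x (x + h *\<^sub>R One)) F /\<^sub>R h ^ DIM(real) - F x) < norm (F x)"
      by blast
    \<comment> \<open>The window \<open>{x..x+h}\<close> has to stay inside the interval. The
      endpoint \<open>b\<close>, which has no right neighbourhood in it, is added to the null set at
      the end.\<close>
    define h where "h = min (d/2) (b - x)"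
    have h: "0 < h" "h < d" "x + h \<le> b" using x d by (auto simp: h_def)
    have "integral {a..x+h} f = integral {a..x} f + integral {x..x+h} f"
      using x h assms(2) by (intro Henstock_Kurzweil_Integration.integral_combine[symmetric]) (auto intro: integrable_on_subinterval)
    moreover have "integral {x..x+h} f = integral {x..x+h} F"
      using x h by (intro integral_cong) (auto simp: F_def)
    ultimately have "integral {x..x+h} F = 0" using assms(1) x h by auto
    then show False using **[of h] h by simp
  qed
  then have "{x \<in> {a..b}. f x \<noteq> 0} \<subseteq> insert b N" by force
  then show ?thesis using N negligible_subset negligible_insert by metis
qed

text \<open>The instance x = r, y = - p gives r (q r - p^2) \<ge> 0, which settles r > 0. For r = 0
  the form is affine in y and can stay nonnegative only if p = 0.\<close>

lemma quadratic_form_nonneg_discriminant: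
  fixes p q r :: real
  assumes pos: "\<And>x y. 0 \<le> x\<^sup>2 * q + 2 * x * y * p + y\<^sup>2 * r"
  shows "p\<^sup>2 \<le> q * r"
proof (cases "r = 0")
  case True
  have "p = 0"
  proof (rule ccontr)
    assume "p \<noteq> 0"
    then show False using pos[of 1 "- (q + 1) / (2 * p)"] True by (auto simp: field_simps)
  qed
  then show ?thesis using True by simp
next
  case False
  have "r\<^sup>2 * q + 2 * r * (- p) * p + (- p)\<^sup>2 * r = r * (q * r - p\<^sup>2)"
    by (simp add: power2_eq_square algebra_simps)
  then have "0 \<le> r * (q * r - p\<^sup>2)" using pos[of r "- p"] by simp
  moreover have "0 \<le> r" using pos[of 0 1] by simp
  ultimately show ?thesis using False by (simp add: zero_le_mult_iff)
qed

section \<open>Approximation by continuous functions and continuity of translations in the mean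
  square\<close>

lemma tendsto_integral_of_tendsto_ae:
  fixes f :: "nat \<Rightarrow> real \<Rightarrow> real"
  assumes "\<And>k. f k integrable_on S" "h integrable_on S" "\<And>k x. x \<in> S \<Longrightarrow> \<bar>f k x\<bar> \<le> h x"
    and N: "negligible N" and "\<And>x. x \<in> S - N \<Longrightarrow> (\<lambda>k. f k x) \<longlonglongrightarrow> g x"
  shows "(\<lambda>k. integral S (f k)) \<longlonglongrightarrow> integral S g"
proof -
  \<comment> \<open>The exceptional null set is cut out of the domain, which leaves convergence at
    every remaining point.\<close>
  have e: "integral S u = integral (S - N) u" for u :: "real \<Rightarrow> real"
    by (rule integral_spike_set) (auto intro: negligible_subset[OF N])
  have i: "u integrable_on S \<Longrightarrow> u integrable_on (S - N)" for u :: "real \<Rightarrow> real"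
    by (erule integrable_spike_set) (auto intro: negligible_subset[OF N])
  show ?thesis unfolding e
    by (rule dominated_convergence(2)[where h = h]) (use assms i in auto)
qed

text \<open>Clipping \<open>f\<close> at height \<open>m\<close> costs little by dominated
  convergence. Continuous functions converging to \<open>f\<close> almost everywhere, clipped at the
  same height, are uniformly bounded, so they converge to the clipped \<open>f\<close> in the mean
  square as well.\<close>

lemma L2_approx_continuous:
  assumes f: "square_integrable_on f {a..b}" and e: "e > 0"
  obtains g where "continuous_on UNIV g" "integral {a..b} (\<lambda>x. (f x - g x)\<^sup>2) < e"
proof -
  define cl where "cl m x = max (- real m) (min (real m) x)" for m :: nat and x :: real
  have m: "f \<in> borel_measurable (lebesgue_on {a..b})" using f by (simp add: square_integrable_on_def)
  have clf: "square_integrable_on (\<lambda>x. cl m (f x)) {a..b}" for m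
  proof -
    have m': "(\<lambda>x. cl m (f x)) \<in> borel_measurable (lebesgue_on {a..b})"
      unfolding cl_def using m by measurable
    have le: "\<bar>cl m (f x)\<bar> \<le> real m" for x by (auto simp: cl_def)
    have "(\<lambda>x. (cl m (f x))\<^sup>2) absolutely_integrable_on {a..b}"
      by (rule measurable_bounded_by_integrable_imp_absolutely_integrable[where g = "\<lambda>_. (real m)\<^sup>2"])
         (use m' abs_le_square_iff[of "cl m (f _)" "real m"] le in auto)
    then show ?thesis
      using m' by (auto simp: square_integrable_on_def intro: absolutely_integrable_imp_integrable)
  qed
  have "(\<lambda>m. integral {a..b} (\<lambda>x. (f x - cl m (f x))\<^sup>2)) \<longlonglongrightarrow> integral {a..b} (\<lambda>x. 0)"
  proof (rule dominated_convergence(2)[where h = "\<lambda>x. (f x)\<^sup>2"])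
    show "(\<lambda>x. (f x - cl k (f x))\<^sup>2) integrable_on {a..b}" for k
      by (intro L2_integrable L2_diff f clf)
    show "norm ((f x - cl k (f x))\<^sup>2) \<le> (f x)\<^sup>2" for k x
    proof -
      have "\<bar>f x - cl k (f x)\<bar> \<le> \<bar>f x\<bar>" by (auto simp: cl_def)
      then show ?thesis by (simp add: abs_le_square_iff)
    qed
    show "(\<lambda>k. (f x - cl k (f x))\<^sup>2) \<longlonglongrightarrow> 0" for x
    proof -
      obtain n where "\<bar>f x\<bar> \<le> real n" using real_arch_simple by blast
      then have "eventually (\<lambda>k. (f x - cl k (f x))\<^sup>2 = 0) sequentially"
        unfolding eventually_sequentially by (intro exI[of _ n]) (auto simp: cl_def)
      then show ?thesis by (simp add: tendsto_eventually)
    qed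
  qed (use f L2_integrable in auto)
  \<comment> \<open>Each of the two errors may be \<open>e/4\<close>, since (p + q)^2 \<le> 2 p^2 +
    2 q^2 doubles both.\<close>
  then have "eventually (\<lambda>m. integral {a..b} (\<lambda>x. (f x - cl m (f x))\<^sup>2) < e/4) sequentially"
    using e by (intro order_tendstoD(2)[where y = 0]) auto
  then obtain m where m1: "integral {a..b} (\<lambda>x. (f x - cl m (f x))\<^sup>2) < e/4"
    by (auto simp: eventually_sequentially)
  obtain N g where N: "negligible N" and g: "\<And>n. continuous_on UNIV (g n)"
    and lim: "\<And>x. x \<notin> N \<Longrightarrow> (\<lambda>n. g n x) \<longlonglongrightarrow> (if x \<in> {a..b} then f x else 0)"
    using m measurable_on_iff_borel_measurable[of "{a..b}" f] unfolding measurable_on_def by auto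
  have clg: "continuous_on UNIV (\<lambda>x. cl m (g n x))" for n
    unfolding cl_def by (intro continuous_intros g)
  have clg': "square_integrable_on (\<lambda>x. cl m (g n x)) {a..b}" for n
    by (rule L2_continuous) (rule continuous_on_subset[OF clg], simp)
  have "(\<lambda>n. integral {a..b} (\<lambda>x. (cl m (f x) - cl m (g n x))\<^sup>2)) \<longlonglongrightarrow> integral {a..b} (\<lambda>x. 0)"
  proof (rule tendsto_integral_of_tendsto_ae[where h = "\<lambda>x. (2 * real m)\<^sup>2", OF _ _ _ N])
    show "(\<lambda>x. (cl m (f x) - cl m (g k x))\<^sup>2) integrable_on {a..b}" for k
      by (intro L2_integrable L2_diff clf clg')
    show "\<bar>(cl m (f x) - cl m (g k x))\<^sup>2\<bar> \<le> (2 * real m)\<^sup>2" for k x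
    proof -
      have "\<bar>cl m (f x) - cl m (g k x)\<bar> \<le> \<bar>2 * real m\<bar>" by (auto simp: cl_def)
      then show ?thesis by (simp only: abs_le_square_iff abs_power2)
    qed
    show "(\<lambda>k. (cl m (f x) - cl m (g k x))\<^sup>2) \<longlonglongrightarrow> 0" if "x \<in> {a..b} - N" for x
    proof -
      have "(\<lambda>k. g k x) \<longlonglongrightarrow> f x" using lim[of x] that by simp
      then have "(\<lambda>k. (cl m (f x) - cl m (g k x))\<^sup>2) \<longlonglongrightarrow> (cl m (f x) - cl m (f x))\<^sup>2"
        unfolding cl_def by (intro tendsto_intros)
      then show ?thesis by simp
    qed
  qed auto
  then have "eventually (\<lambda>n. integral {a..b} (\<lambda>x. (cl m (f x) - cl m (g n x))\<^sup>2) < e/4) sequentially"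
    using e by (intro order_tendstoD(2)[where y = 0]) auto
  then obtain n where n: "integral {a..b} (\<lambda>x. (cl m (f x) - cl m (g n x))\<^sup>2) < e/4"
    by (auto simp: eventually_sequentially)
  have i: "(\<lambda>x. (f x - cl m (f x))\<^sup>2) integrable_on {a..b}"
    "(\<lambda>x. (cl m (f x) - cl m (g n x))\<^sup>2) integrable_on {a..b}"
    by (intro L2_integrable L2_diff f clf clg')+
  have "integral {a..b} (\<lambda>x. (f x - cl m (g n x))\<^sup>2)
      \<le> integral {a..b} (\<lambda>x. 2 * (f x - cl m (f x))\<^sup>2 + 2 * (cl m (f x) - cl m (g n x))\<^sup>2)"
  proof (rule integral_le)
    show "(\<lambda>x. (f x - cl m (g n x))\<^sup>2) integrable_on {a..b}"
      by (intro L2_integrable L2_diff f clg')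
    show "(f x - cl m (g n x))\<^sup>2 \<le> 2 * (f x - cl m (f x))\<^sup>2 + 2 * (cl m (f x) - cl m (g n x))\<^sup>2" for x
    proof -
      have "(p + q)\<^sup>2 \<le> 2 * p\<^sup>2 + 2 * q\<^sup>2" for p q :: real
        using zero_le_power2[of "p - q"] unfolding power2_sum power2_diff by linarith
      from this[of "f x - cl m (f x)" "cl m (f x) - cl m (g n x)"] show ?thesis by simp
    qed
  qed (use i in \<open>auto intro!: integrable_add\<close>)
  also have "\<dots> = 2 * integral {a..b} (\<lambda>x. (f x - cl m (f x))\<^sup>2) + 2 * integral {a..b} (\<lambda>x. (cl m (f x) - cl m (g n x))\<^sup>2)"
    using i by (simp add: integral_add)
  also have "\<dots> < e" using m1 n by simp
  finally show ?thesis using that clg by blast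
qed

text \<open>Compare with a continuous \<open>g\<close>: the two errors between \<open>f\<close> and
  \<open>g\<close> are translates of each other, and the translation error of \<open>g\<close> is
  uniformly small. Enlarging the interval by 1 on both sides makes it contain every translate with
  \<bar>h\<bar> < 1.\<close>

lemma square_integrable_translation_continuous:
  assumes f: "\<And>a b. square_integrable_on f {a..b}" and e: "e > 0"
  shows "\<exists>d>0. \<forall>h. \<bar>h\<bar> < d \<longrightarrow> integral {a..b} (\<lambda>x. (f (x + h) - f x)\<^sup>2) < e"
proof (cases "a \<le> b")
  case False
  then show ?thesis using e by (intro exI[of _ 1]) auto
next
  case ab: True
  obtain g where g: "continuous_on UNIV g" and ge: "integral {a-1..b+1} (\<lambda>x. (f x - g x)\<^sup>2) < e/12"
    using L2_approx_continuous[OF f, of "e/12" "a-1" "b+1"] e by auto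
  \<comment> \<open>Splitting into three squares costs a factor 3: the two errors below
    \<open>e/12\<close> give less than \<open>e/2\<close>, and this \<open>e'\<close> gives at most
    \<open>e/2\<close> for the middle term.\<close>
  define e' where "e' = sqrt (e / (6 * (b - a + 1)))"
  have e': "e' > 0" "e'\<^sup>2 = e / (6 * (b - a + 1))" using e ab by (auto simp: e'_def)
  have "uniformly_continuous_on {a-1..b+1} g"
    by (intro compact_uniformly_continuous continuous_on_subset[OF g]) auto
  then obtain d where d: "d > 0" "\<And>x y. x \<in> {a-1..b+1} \<Longrightarrow> y \<in> {a-1..b+1} \<Longrightarrow> dist y x < d \<Longrightarrow> dist (g y) (g x) < e'"
    unfolding uniformly_continuous_on_def using e' by metis
  have gs: "square_integrable_on g {c..d}" for c d
    by (rule L2_continuous) (rule continuous_on_subset[OF g], simp)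
  have fh: "square_integrable_on (\<lambda>x. f (x + h)) {c..d}" "square_integrable_on (\<lambda>x. g (x + h)) {c..d}" for h c d
    unfolding L2_shift by (fact f gs)+
  show ?thesis
  proof (intro exI[of _ "min d 1"] conjI allI impI)
    show "0 < min d 1" using d by simp
    fix h assume h: "\<bar>h\<bar> < min d 1"
    let ?A = "\<lambda>x. (f (x + h) - g (x + h))\<^sup>2" let ?B = "\<lambda>x. (g (x + h) - g x)\<^sup>2" let ?C = "\<lambda>x. (f x - g x)\<^sup>2"
    have i: "?A integrable_on {a..b}" "?B integrable_on {a..b}" "?C integrable_on {a..b}"
      by (intro L2_integrable L2_diff f fh gs)+
    have i': "?C integrable_on {a-1..b+1}"
      by (intro L2_integrable L2_diff f fh gs)+
    have "integral {a..b} (\<lambda>x. (f (x + h) - f x)\<^sup>2) \<le> integral {a..b} (\<lambda>x. 3 * ?A x + 3 * ?B x + 3 * ?C x)"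
    proof (rule integral_le)
      show "(\<lambda>x. (f (x + h) - f x)\<^sup>2) integrable_on {a..b}"
        by (intro L2_integrable L2_diff f fh)
      show "(f (x + h) - f x)\<^sup>2 \<le> 3 * ?A x + 3 * ?B x + 3 * ?C x" for x
      proof -
        have "(p + q + r)\<^sup>2 \<le> 3 * p\<^sup>2 + 3 * q\<^sup>2 + 3 * r\<^sup>2" for p q r :: real
        proof -
          have "0 \<le> (p - q)\<^sup>2 + (q - r)\<^sup>2 + (p - r)\<^sup>2" by simp
          then show ?thesis by (simp add: power2_eq_square algebra_simps)
        qed
        from this[of "f (x + h) - g (x + h)" "g (x + h) - g x" "g x - f x"]
        show ?thesis by (simp add: power2_commute)
      qed
    qed (use i in \<open>auto intro!: integrable_add\<close>)
    also have "\<dots> = 3 * integral {a..b} ?A + 3 * integral {a..b} ?B + 3 * integral {a..b} ?C"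
      using i by (simp add: integral_add integrable_add)
    also have "integral {a..b} ?A = integral {a+h..b+h} ?C"
      using integral_shift_real_ivl[of "a+h" h "b+h" ?C] by simp
    also have "\<dots> \<le> integral {a-1..b+1} ?C"
      by (rule integral_subset_le) (use h i' in \<open>auto intro!: integrable_on_subinterval[OF i']\<close>)
    also have "integral {a..b} ?C \<le> integral {a-1..b+1} ?C"
      by (rule integral_subset_le) (use h i' in \<open>auto intro!: integrable_on_subinterval[OF i']\<close>)
    also have "integral {a..b} ?B \<le> integral {a..b} (\<lambda>_. e'\<^sup>2)"
    proof (rule integral_le)
      fix x assume x: "x \<in> {a..b}"
      have "dist (g (x + h)) (g x) < e'" using x h by (intro d(2)) (auto simp: dist_real_def)
      then show "?B x \<le> e'\<^sup>2" using e' by (intro abs_le_square_iff[THEN iffD1]) (auto simp: dist_real_def)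
    qed (use i in auto)
    also have "\<dots> = (b - a) * e / (6 * (b - a + 1))" using ab e' by simp
    also have "\<dots> \<le> e / 6" using ab e by (auto simp: field_simps)
    also have "3 * integral {a-1..b+1} ?C + 3 * (e / 6) + 3 * integral {a-1..b+1} ?C < e"
      using ge by simp
    finally show "integral {a..b} (\<lambda>x. (f (x + h) - f x)\<^sup>2) < e" by simp
  qed
qed

section \<open>The space X and the dual of D(A)\<close>

lemma LINT_lebesgue_on_eq_integral:
  fixes f :: "real \<Rightarrow> real"
  assumes "f absolutely_integrable_on {a..b}"
  shows "(LINT s|lebesgue_on {a..b}. f s) = integral {a..b} f"
  using assms by (intro lebesgue_integral_eq_integral absolutely_integrable_imp_integrable) auto

lemma innerX_eq:
  assumes "x \<in> spaceX T" "y \<in> spaceX T"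
  shows "innerX T x y = fst x * fst y + integral {-T..0} (\<lambda>s. snd x s * snd y s)"
  unfolding innerX_def using assms
  by (subst LINT_lebesgue_on_eq_integral) (auto simp: spaceX_def intro: L2_mult)

lemma mult_integrable_spaceX:
  assumes "x \<in> spaceX T" "y \<in> spaceX T"
  shows "(\<lambda>s. snd x s * snd y s) integrable_on {-T..0}"
  using assms by (auto simp: spaceX_def intro: L2_mult_integrable)

lemma addX_spaceX: "x \<in> spaceX T \<Longrightarrow> y \<in> spaceX T \<Longrightarrow> addX x y \<in> spaceX T"
  by (auto simp: spaceX_def addX_def intro: L2_add)

lemma scaleX_spaceX: "x \<in> spaceX T \<Longrightarrow> scaleX c x \<in> spaceX T"
  by (auto simp: spaceX_def scaleX_def intro: L2_scale)

lemma innerX_commute: "innerX T x y = innerX T y x"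
  by (simp add: innerX_def mult.commute)

lemma innerX_add_left:
  assumes "x \<in> spaceX T" "y \<in> spaceX T" "w \<in> spaceX T"
  shows "innerX T (addX x y) w = innerX T x w + innerX T y w"
  using assms mult_integrable_spaceX[of x T w] mult_integrable_spaceX[of y T w]
  by (simp add: innerX_eq addX_spaceX) (simp add: addX_def distrib_right integral_add)

lemma innerX_scale_left:
  assumes "x \<in> spaceX T" "w \<in> spaceX T"
  shows "innerX T (scaleX c x) w = c * innerX T x w"
  using assms by (simp add: innerX_eq scaleX_spaceX) (simp add: scaleX_def algebra_simps)

lemma innerX_add_right:
  "x \<in> spaceX T \<Longrightarrow> y \<in> spaceX T \<Longrightarrow> w \<in> spaceX T \<Longrightarrow>
   innerX T w (addX x y) = innerX T w x + innerX T w y"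
  using innerX_add_left by (simp add: innerX_commute)

lemma innerX_scale_right:
  "x \<in> spaceX T \<Longrightarrow> w \<in> spaceX T \<Longrightarrow> innerX T w (scaleX c x) = c * innerX T w x"
  using innerX_scale_left by (simp add: innerX_commute)

lemma innerX_diff_left:
  "x \<in> spaceX T \<Longrightarrow> y \<in> spaceX T \<Longrightarrow> w \<in> spaceX T \<Longrightarrow>
   innerX T (addX x (scaleX (-1) y)) w = innerX T x w - innerX T y w"
  by (simp add: innerX_add_left innerX_scale_left scaleX_spaceX)

lemma innerX_self_nonneg: "0 \<le> innerX T x x"
  by (auto simp: innerX_def intro!: add_nonneg_nonneg integral_nonneg_AE)

lemma normX_nonneg: "0 \<le> normX T x"
  by (simp add: normX_def innerX_self_nonneg)

lemma normX_square: "(normX T x)\<^sup>2 = innerX T x x"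
  by (simp add: normX_def innerX_self_nonneg)

text \<open>On representatives \<open>innerX\<close> is only semidefinite, as functions that vanish
  almost everywhere have norm zero; the discriminant argument works without definiteness.\<close>

lemma innerX_Cauchy_Schwarz:
  assumes "x \<in> spaceX T" "y \<in> spaceX T"
  shows "\<bar>innerX T x y\<bar> \<le> normX T x * normX T y"
proof -
  have "0 \<le> a\<^sup>2 * innerX T x x + 2 * a * b * innerX T x y + b\<^sup>2 * innerX T y y" for a b
  proof -
    have "0 \<le> innerX T (addX (scaleX a x) (scaleX b y)) (addX (scaleX a x) (scaleX b y))"
      by (rule innerX_self_nonneg)
    also have "\<dots> = a\<^sup>2 * innerX T x x + 2 * a * b * innerX T x y + b\<^sup>2 * innerX T y y"
      using assms innerX_commute[of T y x]
      by (simp add: innerX_add_left innerX_add_right innerX_scale_left innerX_scale_right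
          addX_spaceX scaleX_spaceX power2_eq_square algebra_simps)
    finally show ?thesis .
  qed
  then have "(innerX T x y)\<^sup>2 \<le> innerX T x x * innerX T y y"
    by (rule quadratic_form_nonneg_discriminant)
  then show ?thesis
    by (metis normX_nonneg normX_square abs_le_square_iff abs_of_nonneg mult_nonneg_nonneg power_mult_distrib)
qed

lemma normX_scaleX: "x \<in> spaceX T \<Longrightarrow> normX T (scaleX c x) = \<bar>c\<bar> * normX T x"
  by (simp add: normX_def innerX_scale_left innerX_scale_right scaleX_spaceX real_sqrt_mult
      flip: power2_eq_square mult.assoc)

lemma normX_addX:
  assumes "x \<in> spaceX T" "y \<in> spaceX T"
  shows "normX T (addX x y) \<le> normX T x + normX T y"
proof (rule power2_le_imp_le)
  have "(normX T (addX x y))\<^sup>2 = (normX T x)\<^sup>2 + 2 * innerX T x y + (normX T y)\<^sup>2"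
    using assms innerX_commute[of T y x]
    by (simp add: normX_square innerX_add_left innerX_add_right addX_spaceX)
  then show "(normX T (addX x y))\<^sup>2 \<le> (normX T x + normX T y)\<^sup>2"
    using innerX_Cauchy_Schwarz[OF assms] by (simp add: power2_sum)
qed (simp add: normX_nonneg)

lemma innerX_cong:
  assumes "eqX T x x'" "x \<in> spaceX T" "x' \<in> spaceX T" "w \<in> spaceX T"
  shows "innerX T x w = innerX T x' w"
proof -
  have "negligible {s \<in> {-T..0}. snd x s \<noteq> snd x' s}"
    using assms(1) by (simp add: eqX_def AE_lebesgue_on_iff_negligible)
  then have "integral {-T..0} (\<lambda>s. snd x' s * snd w s) = integral {-T..0} (\<lambda>s. snd x s * snd w s)"
    by (intro integral_spike) auto
  then show ?thesis using assms by (simp add: innerX_eq eqX_def)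
qed

lemma eqX_sym: "eqX T x y \<longleftrightarrow> eqX T y x"
  by (simp only: eqX_def eq_commute[of "fst x"] eq_commute[of "snd x _"])
lemma eqX_trans:
  assumes "eqX T x y" "eqX T y z"
  shows "eqX T x z"
proof -
  have "AE s in lebesgue_on {-T..0}. snd x s = snd y s" "AE s in lebesgue_on {-T..0}. snd y s = snd z s"
    using assms by (auto simp: eqX_def)
  then have "AE s in lebesgue_on {-T..0}. snd x s = snd z s" by eventually_elim simp
  then show ?thesis using assms by (simp add: eqX_def)
qed

section \<open>Sobolev functions and the domain of \<open>opA\<close>\<close>

lemma LINT_L2_derivative:
  assumes "square_integrable_on g {-T..0}" "s \<in> {-T..0}"
  shows "(LINT r|lebesgue_on {-T..s}. g r) = integral {-T..s} g"
  by (rule LINT_lebesgue_on_eq_integral[OF L2_integrable(1)])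
     (rule L2_subinterval[OF assms(1)], use assms(2) in auto)

lemma has_L2_derivativeI:
  assumes "square_integrable_on g {-T..0}"
    and "\<And>s. s \<in> {-T..0} \<Longrightarrow> f s = f (-T) + integral {-T..s} g"
  shows "has_L2_derivative T f g"
  unfolding has_L2_derivative_def
proof (intro conjI ballI)
  fix s assume "s \<in> {-T..0}"
  then show "f s = f (-T) + (LINT r|lebesgue_on {-T..s}. g r)"
    using assms(2)[of s] LINT_L2_derivative[OF assms(1)] by metis
qed fact

lemma has_L2_derivativeD:
  assumes "has_L2_derivative T f g"
  shows "square_integrable_on g {-T..0}"
    and "s \<in> {-T..0} \<Longrightarrow> f s = f (-T) + integral {-T..s} g"
  using assms LINT_L2_derivative[of g T s] unfolding has_L2_derivative_def by metis+

lemma has_L2_derivative_continuous_on: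
  assumes "has_L2_derivative T f g"
  shows "continuous_on {-T..0} f"
proof -
  have "continuous_on {-T..0} (\<lambda>s. f (-T) + integral {-T..s} g)"
    by (intro continuous_intros indefinite_integral_continuous_1 L2_integrable
        has_L2_derivativeD[OF assms])
  then show ?thesis
    using has_L2_derivativeD(2)[OF assms] by (metis (no_types, lifting) continuous_on_cong)
qed

text \<open>Both derivatives have the same integral over every \<open>{-T..s}\<close>. Hence the
  arbitrary choice in \<open>L2_deriv\<close> can vary only on a null set.\<close>

lemma has_L2_derivative_unique:
  assumes "has_L2_derivative T f g" "has_L2_derivative T f g'"
  shows "negligible {s \<in> {-T..0}. g s \<noteq> g' s}"
proof -
  note i = has_L2_derivativeD(1)[OF assms(1), THEN L2_integrable(2)]
    has_L2_derivativeD(1)[OF assms(2), THEN L2_integrable(2)]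
  have "negligible {s \<in> {-T..0}. g s - g' s \<noteq> 0}"
  proof (rule integral_eq_0_imp_negligible)
    fix s assume s: "s \<in> {-T..0}"
    have "integral {-T..s} g = integral {-T..s} g'"
      using has_L2_derivativeD(2)[OF assms(1) s] has_L2_derivativeD(2)[OF assms(2) s] by linarith
    moreover have "g integrable_on {-T..s}" "g' integrable_on {-T..s}"
      using s by (auto intro: integrable_on_subinterval[OF i(1)] integrable_on_subinterval[OF i(2)])
    ultimately show "integral {-T..s} (\<lambda>s. g s - g' s) = 0" by (simp add: integral_diff)
  qed (intro integrable_diff i)
  then show ?thesis by simp
qed

lemma has_L2_derivative_add:
  assumes "has_L2_derivative T f g" "has_L2_derivative T f' g'"
  shows "has_L2_derivative T (\<lambda>s. f s + f' s) (\<lambda>s. g s + g' s)"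
proof (rule has_L2_derivativeI)
  note sq = has_L2_derivativeD(1)[OF assms(1)] has_L2_derivativeD(1)[OF assms(2)]
  show "square_integrable_on (\<lambda>s. g s + g' s) {-T..0}"
    by (intro L2_add sq)
  fix s assume s: "s \<in> {-T..0}"
  have "integral {-T..s} (\<lambda>s. g s + g' s) = integral {-T..s} g + integral {-T..s} g'"
    using s by (intro integral_add) (auto intro: integrable_on_subinterval[OF L2_integrable(2)[OF sq(1)]]
        integrable_on_subinterval[OF L2_integrable(2)[OF sq(2)]])
  then show "f s + f' s = f (-T) + f' (-T) + integral {-T..s} (\<lambda>s. g s + g' s)"
    using has_L2_derivativeD(2)[OF assms(1) s] has_L2_derivativeD(2)[OF assms(2) s] by linarith
qed

lemma has_L2_derivative_scale:
  assumes "has_L2_derivative T f g"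
  shows "has_L2_derivative T (\<lambda>s. c * f s) (\<lambda>s. c * g s)"
proof (rule has_L2_derivativeI)
  show "square_integrable_on (\<lambda>s. c * g s) {-T..0}"
    by (intro L2_scale has_L2_derivativeD(1)[OF assms])
  fix s assume "s \<in> {-T..0}"
  from has_L2_derivativeD(2)[OF assms this]
  have "c * f s = c * (f (-T) + integral {-T..s} g)" by (rule arg_cong)
  then show "c * f s = c * f (-T) + integral {-T..s} (\<lambda>s. c * g s)" by (simp add: distrib_left)
qed

lemma domA_derivative:
  assumes "\<psi> \<in> domA T"
  shows "has_L2_derivative T (snd \<psi>) (L2_deriv T (snd \<psi>))"
proof -
  have "\<exists>g. has_L2_derivative T (snd \<psi>) g" using assms by (simp add: domA_def W12_def)
  then show ?thesis unfolding L2_deriv_def by (rule someI_ex)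
qed

lemma domA_spaceX: "\<psi> \<in> domA T \<Longrightarrow> \<psi> \<in> spaceX T"
  unfolding spaceX_def
  using has_L2_derivative_continuous_on[OF domA_derivative] L2_continuous by blast

lemma opA_spaceX: "\<psi> \<in> domA T \<Longrightarrow> opA T \<psi> \<in> spaceX T"
  using has_L2_derivativeD(1)[OF domA_derivative] by (simp add: spaceX_def opA_def)

lemma domA_addX: "\<psi> \<in> domA T \<Longrightarrow> \<phi> \<in> domA T \<Longrightarrow> addX \<psi> \<phi> \<in> domA T"
  unfolding domA_def W12_def addX_def by (auto intro: has_L2_derivative_add)

lemma domA_scaleX: "\<psi> \<in> domA T \<Longrightarrow> scaleX c \<psi> \<in> domA T"
  unfolding domA_def W12_def scaleX_def by (auto intro: has_L2_derivative_scale)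

text \<open>\<open>opA\<close> contains the choice \<open>L2_deriv\<close>, but pairings in X do not
  see null sets; this lets any explicit derivative of the test function be used in its
  place.\<close>

lemma adjA_eq:
  assumes "x \<in> spaceX T" "\<psi> \<in> domA T" "has_L2_derivative T (snd \<psi>) g"
  shows "adjA T x \<psi> = innerX T x (0, g)"
proof -
  have "eqX T (opA T \<psi>) (0, g)"
    using has_L2_derivative_unique[OF domA_derivative[OF assms(2)] assms(3)]
    by (simp add: eqX_def opA_def AE_lebesgue_on_iff_negligible)
  then show ?thesis
    unfolding adjA_def using assms opA_spaceX
      has_L2_derivativeD(1)[OF assms(3)]
    by (subst (1 2) innerX_commute, intro innerX_cong) (auto simp: spaceX_def)
qed

lemma adjA_bound:
  assumes "x \<in> spaceX T" "\<psi> \<in> domA T"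
  shows "\<bar>adjA T x \<psi>\<bar> \<le> normX T x * graph_norm T \<psi>"
proof -
  have "normX T (opA T \<psi>) \<le> graph_norm T \<psi>"
    unfolding graph_norm_def by (rule real_le_rsqrt) simp
  then show ?thesis
    using innerX_Cauchy_Schwarz[OF assms(1) opA_spaceX[OF assms(2)]] normX_nonneg[of T x]
    unfolding adjA_def by (meson mult_left_mono order_trans)
qed

lemma opB_eq:
  assumes "T > 0" "\<psi> \<in> domA T" "has_L2_derivative T (snd \<psi>) g"
  shows "opB T \<psi> = integral {-T..0} g"
proof -
  have "snd \<psi> 0 = snd \<psi> (-T) + integral {-T..0} g"
    using assms(1) by (intro has_L2_derivativeD(2)[OF assms(3)]) auto
  then show ?thesis by (simp add: opB_def)
qed

text \<open>B \<psi> is the integral of the derivative, that is, the pairing of A \<psi> with the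
  state (0, 1), whose norm is sqrt T.\<close>

lemma opB_bound:
  assumes "T > 0" "\<psi> \<in> domA T"
  shows "\<bar>opB T \<psi>\<bar> \<le> sqrt T * graph_norm T \<psi>"
proof -
  have 1: "(0, \<lambda>_. 1) \<in> spaceX T"
    by (simp add: spaceX_def L2_continuous)
  have "opB T \<psi> = adjA T (0, \<lambda>_. 1) \<psi>"
    using assms 1 opB_eq[OF assms domA_derivative] innerX_eq[OF 1 opA_spaceX] by (simp add: adjA_def opA_def)
  moreover have "normX T (0, \<lambda>_. 1) = sqrt T"
    using assms innerX_eq[OF 1 1] by (simp add: normX_def)
  ultimately show ?thesis using adjA_bound[OF 1 assms(2)] by simp
qed

text \<open>The derivative chosen for a sum need not be pointwise the sum of the chosen derivatives;
  additivity appears only after pairing, through \<open>adjA_eq\<close>.\<close>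

lemma adjA_add:
  assumes "x \<in> spaceX T" "\<psi> \<in> domA T" "\<phi> \<in> domA T"
  shows "adjA T x (addX \<psi> \<phi>) = adjA T x \<psi> + adjA T x \<phi>"
proof -
  have "has_L2_derivative T (snd (addX \<psi> \<phi>)) (snd (addX (opA T \<psi>) (opA T \<phi>)))"
    using has_L2_derivative_add[OF domA_derivative[OF assms(2)] domA_derivative[OF assms(3)]]
    by (simp add: addX_def opA_def)
  then have "adjA T x (addX \<psi> \<phi>) = innerX T x (0, snd (addX (opA T \<psi>) (opA T \<phi>)))"
    using assms domA_addX by (intro adjA_eq)
  also have "\<dots> = innerX T x (addX (opA T \<psi>) (opA T \<phi>))"
    by (simp add: addX_def opA_def)
  finally show ?thesis using assms by (simp add: adjA_def innerX_add_right opA_spaceX)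
qed

lemma adjA_scale:
  assumes "x \<in> spaceX T" "\<psi> \<in> domA T"
  shows "adjA T x (scaleX c \<psi>) = c * adjA T x \<psi>"
proof -
  have "has_L2_derivative T (snd (scaleX c \<psi>)) (snd (scaleX c (opA T \<psi>)))"
    using has_L2_derivative_scale[OF domA_derivative[OF assms(2)]]
    by (simp add: scaleX_def opA_def)
  then have "adjA T x (scaleX c \<psi>) = innerX T x (0, snd (scaleX c (opA T \<psi>)))"
    using assms domA_scaleX by (intro adjA_eq)
  also have "\<dots> = innerX T x (scaleX c (opA T \<psi>))"
    by (simp add: scaleX_def opA_def)
  finally show ?thesis using assms by (simp add: adjA_def innerX_scale_right opA_spaceX)
qed

section \<open>The dual norm\<close>

lemma zero_unit_ball:
  "(0, \<lambda>_. 0) \<in> {\<psi> \<in> domA T. graph_norm T \<psi> \<le> 1}"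
proof -
  have z: "has_L2_derivative T (\<lambda>_. 0) (\<lambda>_. 0)"
    by (intro has_L2_derivativeI) (auto simp: L2_continuous)
  then have d: "(0, \<lambda>_. 0) \<in> domA T" by (auto simp: domA_def W12_def)
  have "innerX T (opA T (0, \<lambda>_. 0)) (opA T (0, \<lambda>_. 0)) = 0"
    using adjA_eq[OF opA_spaceX[OF d] d] z by (simp add: adjA_def innerX_def)
  then show ?thesis using d by (simp add: graph_norm_def normX_def innerX_def)
qed

text \<open>A real \<open>SUP\<close> is meaningful only over a nonempty set that is bounded above:
  the zero element of the unit ball provides the first property, the explicit bound \<open>C\<close>
  the second.\<close>

lemma dual_norm_le:
  assumes "\<And>\<psi>. \<psi> \<in> domA T \<Longrightarrow> \<bar>l \<psi>\<bar> \<le> C * graph_norm T \<psi>" "C \<ge> 0"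
  shows "dual_norm T l \<le> C" "0 \<le> dual_norm T l"
    "\<And>\<psi>. \<psi> \<in> domA T \<Longrightarrow> graph_norm T \<psi> \<le> 1 \<Longrightarrow> \<bar>l \<psi>\<bar> \<le> dual_norm T l"
proof -
  let ?B = "{\<psi> \<in> domA T. graph_norm T \<psi> \<le> 1}"
  have le: "\<bar>l \<psi>\<bar> \<le> C" if "\<psi> \<in> ?B" for \<psi>
  proof -
    have "C * graph_norm T \<psi> \<le> C * 1"
      using that assms(2) by (intro mult_left_mono) auto
    then show ?thesis using assms(1)[of \<psi>] that by auto
  qed
  show "dual_norm T l \<le> C" unfolding dual_norm_def
    by (rule cSUP_least) (use zero_unit_ball le in blast)+
  have bdd: "bdd_above ((\<lambda>\<psi>. \<bar>l \<psi>\<bar>) ` ?B)"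
    using le by (auto intro!: bdd_aboveI2[where M = C])
  then show *: "\<bar>l \<psi>\<bar> \<le> dual_norm T l" if "\<psi> \<in> domA T" "graph_norm T \<psi> \<le> 1" for \<psi>
    unfolding dual_norm_def using that by (intro cSUP_upper) auto
  show "0 \<le> dual_norm T l"
    using *[of "(0, \<lambda>_. 0)"] zero_unit_ball[of T] by (auto intro: order_trans[OF abs_ge_zero])
qed

text \<open>A reverse triangle inequality; it turns Lipschitz estimates of the right-hand side into
  continuity of its dual norm in time.\<close>

lemma dual_norm_diff_le:
  assumes "\<And>\<psi>. \<psi> \<in> domA T \<Longrightarrow> \<bar>l \<psi>\<bar> \<le> K * graph_norm T \<psi>" "K \<ge> 0"
    and "\<And>\<psi>. \<psi> \<in> domA T \<Longrightarrow> \<bar>m \<psi>\<bar> \<le> K' * graph_norm T \<psi>" "K' \<ge> 0"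
    and "\<And>\<psi>. \<psi> \<in> domA T \<Longrightarrow> \<bar>l \<psi> - m \<psi>\<bar> \<le> C * graph_norm T \<psi>" and C: "C \<ge> 0"
  shows "\<bar>dual_norm T l - dual_norm T m\<bar> \<le> C"
proof -
  have *: "dual_norm T l \<le> dual_norm T m + C"
    if lm: "\<And>\<psi>. \<psi> \<in> domA T \<Longrightarrow> \<bar>l \<psi> - m \<psi>\<bar> \<le> C * graph_norm T \<psi>"
    and m: "\<And>\<psi>. \<psi> \<in> domA T \<Longrightarrow> \<bar>m \<psi>\<bar> \<le> K * graph_norm T \<psi>" "K \<ge> 0" for l m K
    unfolding dual_norm_def[of T l]
  proof (rule cSUP_least)
    show "{\<psi> \<in> domA T. graph_norm T \<psi> \<le> 1} \<noteq> {}" using zero_unit_ball by blast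
    fix \<psi> assume p: "\<psi> \<in> {\<psi> \<in> domA T. graph_norm T \<psi> \<le> 1}"
    have "C * graph_norm T \<psi> \<le> C * 1" using p C by (intro mult_left_mono) auto
    then have "\<bar>l \<psi> - m \<psi>\<bar> \<le> C" using lm[of \<psi>] p by auto
    moreover have "\<bar>m \<psi>\<bar> \<le> dual_norm T m" using p m by (intro dual_norm_le(3)[of T m K]) auto
    ultimately show "\<bar>l \<psi>\<bar> \<le> dual_norm T m + C" by linarith
  qed
  have "dual_norm T l \<le> dual_norm T m + C" using assms by (intro *[of l m K']) auto
  moreover have "dual_norm T m \<le> dual_norm T l + C"
    using assms by (intro *[of m l K]) (auto simp: abs_minus_commute)
  ultimately show ?thesis by linarith
qed

section \<open>The right-hand side of the state equation as an element of the dual of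
  \<open>domA\<close>\<close>

definition rhs :: "real \<Rightarrow> state \<Rightarrow> real \<Rightarrow> functional" where
  "rhs T x u = (\<lambda>\<psi>. adjA T x \<psi> + adjB T u \<psi>)"

lemma rhs_bound:
  assumes "T > 0" "x \<in> spaceX T" "\<psi> \<in> domA T"
  shows "\<bar>rhs T x u \<psi>\<bar> \<le> (normX T x + sqrt T * \<bar>u\<bar>) * graph_norm T \<psi>"
proof -
  have "\<bar>u\<bar> * \<bar>opB T \<psi>\<bar> \<le> \<bar>u\<bar> * (sqrt T * graph_norm T \<psi>)"
    by (intro mult_left_mono opB_bound assms) auto
  then have "\<bar>adjA T x \<psi>\<bar> + \<bar>u * opB T \<psi>\<bar> \<le> normX T x * graph_norm T \<psi> + \<bar>u\<bar> * (sqrt T * graph_norm T \<psi>)"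
    using adjA_bound[OF assms(2,3)] by (simp add: abs_mult)
  then show ?thesis
    using abs_triangle_ineq[of "adjA T x \<psi>" "u * opB T \<psi>"] by (simp add: rhs_def adjB_def algebra_simps)
qed

lemma rhs_diff_bound:
  assumes "T > 0" "x \<in> spaceX T" "y \<in> spaceX T" "\<psi> \<in> domA T"
  shows "\<bar>rhs T x u \<psi> - rhs T y w \<psi>\<bar> \<le> (distX T x y + sqrt T * \<bar>u - w\<bar>) * graph_norm T \<psi>"
proof -
  have "rhs T x u \<psi> - rhs T y w \<psi> = rhs T (addX x (scaleX (-1) y)) (u - w) \<psi>"
    using assms by (simp add: rhs_def adjA_def adjB_def innerX_diff_left opA_spaceX algebra_simps)
  then show ?thesis unfolding distX_def
    using assms by (simp add: rhs_bound addX_spaceX scaleX_spaceX)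
qed

lemma rhs_dualA:
  assumes "T > 0" "x \<in> spaceX T"
  shows "rhs T x u \<in> dualA T"
  unfolding dualA_def
proof (intro CollectI conjI ballI allI)
  show "\<exists>C. \<forall>\<psi>\<in>domA T. \<bar>rhs T x u \<psi>\<bar> \<le> C * graph_norm T \<psi>"
    using rhs_bound[OF assms] by blast
next
  fix \<psi> \<phi> assume "\<psi> \<in> domA T" "\<phi> \<in> domA T"
  moreover have "opB T (addX \<psi> \<phi>) = opB T \<psi> + opB T \<phi>" by (simp add: opB_def addX_def)
  ultimately show "rhs T x u (addX \<psi> \<phi>) = rhs T x u \<psi> + rhs T x u \<phi>"
    using assms by (simp add: rhs_def adjA_add adjB_def distrib_left)
next
  fix c \<psi> assume "\<psi> \<in> domA T"
  moreover have "opB T (scaleX c \<psi>) = c * opB T \<psi>" by (simp add: opB_def scaleX_def algebra_simps)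
  ultimately show "rhs T x u (scaleX c \<psi>) = c * rhs T x u \<psi>"
    using assms by (simp add: rhs_def adjA_scale adjB_def distrib_left)
qed

section \<open>Regularity in time and the weak form of the state equation\<close>

lemma continuousX_spaceX: "continuousX T \<tau> y \<Longrightarrow> t \<in> {0..\<tau>} \<Longrightarrow> y t \<in> spaceX T"
  by (simp add: continuousX_def)

lemma continuousX_dist_tendsto:
  assumes "continuousX T \<tau> y" "continuous_on {0..\<tau>} u" "t \<in> {0..\<tau>}"
  shows "((\<lambda>s. distX T (y s) (y t) + sqrt T * \<bar>u s - u t\<bar>) \<longlongrightarrow> 0) (at t within {0..\<tau>})"
proof -
  have "((\<lambda>s. sqrt T * \<bar>u s - u t\<bar>) \<longlongrightarrow> sqrt T * \<bar>u t - u t\<bar>) (at t within {0..\<tau>})"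
    using assms by (intro tendsto_intros) (auto simp: continuous_on_def)
  then show ?thesis using assms tendsto_add[of "\<lambda>s. distX T (y s) (y t)" 0] 
    by (auto simp: continuousX_def)
qed

lemma continuous_on_dual_norm_rhs:
  assumes "T > 0" "continuousX T \<tau> y" "continuous_on {0..\<tau>} u"
  shows "continuous_on {0..\<tau>} (\<lambda>t. dual_norm T (rhs T (y t) (u t)))"
  unfolding continuous_on_def
proof
  fix t assume t: "t \<in> {0..\<tau>}"
  show "((\<lambda>t. dual_norm T (rhs T (y t) (u t))) \<longlongrightarrow> dual_norm T (rhs T (y t) (u t))) (at t within {0..\<tau>})"
  proof (rule Lim_transform_bound[OF _ continuousX_dist_tendsto[OF assms(2,3) t], THEN LIM_zero_cancel])
    show "\<forall>\<^sub>F s in at t within {0..\<tau>}. norm (dual_norm T (rhs T (y s) (u s)) - dual_norm T (rhs T (y t) (u t)))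
      \<le> norm (distX T (y s) (y t) + sqrt T * \<bar>u s - u t\<bar>)"
    proof (rule eventually_at_topological[THEN iffD2], intro exI[of _ UNIV] conjI ballI impI)
      fix s assume s: "s \<in> {0..\<tau>}"
      have nn: "0 \<le> distX T (y s) (y t) + sqrt T * \<bar>u s - u t\<bar>"
        using assms by (simp add: distX_def normX_nonneg)
      have "\<bar>dual_norm T (rhs T (y s) (u s)) - dual_norm T (rhs T (y t) (u t))\<bar>
        \<le> distX T (y s) (y t) + sqrt T * \<bar>u s - u t\<bar>"
        using assms s t nn
        by (intro dual_norm_diff_le[OF rhs_bound _ rhs_bound _ rhs_diff_bound])
          (auto simp: normX_nonneg intro: continuousX_spaceX)
      then show "norm (dual_norm T (rhs T (y s) (u s)) - dual_norm T (rhs T (y t) (u t)))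
        \<le> norm (distX T (y s) (y t) + sqrt T * \<bar>u s - u t\<bar>)" using nn by simp
    qed auto
  qed
qed

text \<open>The floor functions give a sequence of simple functions converging pointwise, because
  \<open>y\<close> and \<open>u\<close> are continuous.\<close>

lemma rhs_L2_dualA:
  assumes T: "T > 0" and y: "continuousX T \<tau> y" and u: "continuous_on {0..\<tau>} u"
  shows "(\<lambda>t. rhs T (y t) (u t)) \<in> L2_dualA T \<tau>"
  unfolding L2_dualA_def
proof (intro CollectI conjI)
  show "AE t in lebesgue_on {0..\<tau>}. rhs T (y t) (u t) \<in> dualA T"
    using y T by (intro AE_I2) (auto intro!: rhs_dualA continuousX_spaceX)
  show "integrable (lebesgue_on {0..\<tau>}) (\<lambda>t. (dual_norm T (rhs T (y t) (u t)))\<^sup>2)"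
    by (intro continuous_imp_integrable_real continuous_intros continuous_on_dual_norm_rhs assms)
  \<comment> \<open>Rounding downwards keeps every sample point inside
    \<open>{0..\<tau>}\<close>.\<close>
  define p where "p n t = real_of_int \<lfloor>t * real (Suc n)\<rfloor> / real (Suc n)" for n t
  have p: "p n t \<in> {0..\<tau>}" "\<bar>p n t - t\<bar> \<le> 1 / real (Suc n)" if "t \<in> {0..\<tau>}" for n t
  proof -
    define k where "k = real_of_int \<lfloor>t * real (Suc n)\<rfloor>"
    have k: "0 \<le> k" "k \<le> t * real (Suc n)" "t * real (Suc n) - 1 \<le> k"
      using that unfolding k_def by (auto simp del: of_nat_Suc)
    have "0 \<le> k / real (Suc n)" "k / real (Suc n) \<le> t" "t - 1 / real (Suc n) \<le> k / real (Suc n)"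
      using k by (simp_all add: pos_divide_le_eq pos_le_divide_eq left_diff_distrib del: of_nat_Suc)
    then show "p n t \<in> {0..\<tau>}" "\<bar>p n t - t\<bar> \<le> 1 / real (Suc n)"
      using that by (auto simp: p_def k_def[symmetric] abs_le_iff simp del: of_nat_Suc)
  qed
  define S where "S n t = rhs T (y (p n t)) (u (p n t))" for n t
  have "simple_function (lebesgue_on {0..\<tau>}) (S n)" for n
  proof -
    have "simple_function (lebesgue_on {0..\<tau>}) (\<lambda>t. \<lfloor>t * real (Suc n)\<rfloor>)"
      unfolding simple_function_eq_measurable
    proof
      have "(\<lambda>t. \<lfloor>t * real (Suc n)\<rfloor>) ` space (lebesgue_on {0..\<tau>}) \<subseteq> {0..\<lfloor>\<tau> * real (Suc n)\<rfloor>}"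
        by (auto simp del: of_nat_Suc intro!: floor_mono mult_right_mono)
      then show "finite ((\<lambda>t. \<lfloor>t * real (Suc n)\<rfloor>) ` space (lebesgue_on {0..\<tau>}))"
        by (rule finite_subset) simp
      have "(\<lambda>t. \<lfloor>t * real (Suc n)\<rfloor>) \<in> measurable borel (count_space UNIV)" by measurable
      then show "(\<lambda>t. \<lfloor>t * real (Suc n)\<rfloor>) \<in> measurable (lebesgue_on {0..\<tau>}) (count_space UNIV)"
        by (intro measurable_restrict_space1 measurable_completion) simp
    qed
    from simple_function_compose1[OF this, of "\<lambda>k. rhs T (y (real_of_int k / real (Suc n))) (u (real_of_int k / real (Suc n)))"]
    show ?thesis unfolding S_def p_def by simp
  qed
  moreover have "S n t \<in> dualA T" if "t \<in> {0..\<tau>}" for n t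
    unfolding S_def using continuousX_spaceX[OF y p(1)[OF that]] T by (intro rhs_dualA)
  moreover have "(\<lambda>n. dual_norm T (\<lambda>\<psi>. S n t \<psi> - rhs T (y t) (u t) \<psi>)) \<longlonglongrightarrow> 0" if t: "t \<in> {0..\<tau>}" for t
  proof -
    define e where "e s = distX T (y s) (y t) + sqrt T * \<bar>u s - u t\<bar>" for s
    have e0: "e s \<ge> 0" for s using T by (simp add: e_def distX_def normX_nonneg)
    have "(\<lambda>n. p n t) \<longlonglongrightarrow> t"
    proof (rule Lim_transform_bound[THEN LIM_zero_cancel])
      show "(\<lambda>n. 1 / real (Suc n)) \<longlonglongrightarrow> 0" by (rule LIMSEQ_Suc[OF lim_1_over_n])
      show "\<forall>\<^sub>F n in sequentially. norm (p n t - t) \<le> norm (1 / real (Suc n))"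
        using p(2)[OF t] by (intro always_eventually) auto
    qed
    moreover have "continuous (at t within {0..\<tau>}) e"
    proof -
      have "distX T (y t) (y t) = 0"
        by (simp add: distX_def normX_def innerX_def addX_def scaleX_def)
      then have "e t = 0" by (simp add: e_def)
      then show ?thesis unfolding continuous_within
        using continuousX_dist_tendsto[OF y u t] by (simp add: e_def[abs_def])
    qed
    ultimately have "(\<lambda>n. e (p n t)) \<longlonglongrightarrow> e t"
      using p(1)[OF t] unfolding continuous_within_sequentially comp_def
      by (elim allE[where x = "\<lambda>n. p n t"]) simp
    moreover have "e t = 0"
      by (simp add: e_def distX_def normX_def innerX_def addX_def scaleX_def)
    ultimately have lim: "(\<lambda>n. e (p n t)) \<longlonglongrightarrow> 0" by simp
    have b: "\<bar>S n t \<psi> - rhs T (y t) (u t) \<psi>\<bar> \<le> e (p n t) * graph_norm T \<psi>" if "\<psi> \<in> domA T" for n \<psi>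
      unfolding S_def e_def using that t p(1)[OF t] T by (intro rhs_diff_bound continuousX_spaceX[OF y])
    show ?thesis
      by (rule Lim_null_comparison[OF _ lim], intro always_eventually allI)
        (use dual_norm_le(1,2)[OF b e0] in auto)
  qed
  ultimately show "strongly_measurable_dualA T \<tau> (\<lambda>t. rhs T (y t) (u t))"
    unfolding strongly_measurable_dualA_def by (intro exI[of _ S] conjI allI ballI AE_I2) auto
qed

lemma continuous_on_innerX:
  assumes y: "continuousX T \<tau> y" and w: "w \<in> spaceX T"
  shows "continuous_on {0..\<tau>} (\<lambda>t. innerX T (y t) w)"
  unfolding continuous_on_def
proof
  fix t assume t: "t \<in> {0..\<tau>}"
  have "((\<lambda>s. normX T w * distX T (y s) (y t)) \<longlongrightarrow> normX T w * 0) (at t within {0..\<tau>})"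
    using y t by (intro tendsto_intros) (auto simp: continuousX_def)
  then have l: "((\<lambda>s. normX T w * distX T (y s) (y t)) \<longlongrightarrow> 0) (at t within {0..\<tau>})" by simp
  show "((\<lambda>t. innerX T (y t) w) \<longlongrightarrow> innerX T (y t) w) (at t within {0..\<tau>})"
  proof (rule Lim_null_comparison[OF _ l, THEN LIM_zero_cancel])
    show "\<forall>\<^sub>F s in at t within {0..\<tau>}. norm (innerX T (y s) w - innerX T (y t) w) \<le> normX T w * distX T (y s) (y t)"
    proof (rule eventually_at_topological[THEN iffD2], intro exI[of _ UNIV] conjI ballI impI)
      fix s assume s: "s \<in> {0..\<tau>}"
      have "y s \<in> spaceX T" "y t \<in> spaceX T" using s t y by (auto intro: continuousX_spaceX)
      then show "norm (innerX T (y s) w - innerX T (y t) w) \<le> normX T w * distX T (y s) (y t)"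
        using innerX_Cauchy_Schwarz[of "addX (y s) (scaleX (-1) (y t))" T w] w
        by (simp add: innerX_diff_left addX_spaceX scaleX_spaceX distX_def mult.commute)
    qed auto
  qed
qed

lemma continuous_on_rhs:
  assumes "continuousX T \<tau> y" "continuous_on {0..\<tau>} u" "\<psi> \<in> domA T"
  shows "continuous_on {0..\<tau>} (\<lambda>t. rhs T (y t) (u t) \<psi>)"
  unfolding rhs_def adjA_def adjB_def
  by (intro continuous_intros continuous_on_innerX opA_spaceX assms)

text \<open>A derivative \<open>z\<close> agrees with \<open>rhs\<close> almost everywhere, so
  testing it with a fixed \<psi> gives an ordinary integral equation. Conversely \<open>rhs\<close>
  itself serves as the derivative, and its membership in \<open>L2_dualA\<close> follows from
  continuity of \<open>y\<close> and \<open>u\<close>. Continuous controls are the relevant ones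
  because the feedback along a solution is continuous.\<close>

lemma state_solution_iff:
  assumes T: "T > 0" and u: "continuous_on {0..} u"
  shows "state_solution T u x y \<longleftrightarrow> eqX T (y 0) x \<and> (\<forall>\<tau>>0. continuousX T \<tau> y) \<and>
    (\<forall>t\<ge>0. \<forall>\<psi>\<in>domA T. innerX T (y t) \<psi> = innerX T (y 0) \<psi> + integral {0..t} (\<lambda>s. rhs T (y s) (u s) \<psi>))"
    (is "?L \<longleftrightarrow> ?R")
proof
  assume L: ?L
  have "innerX T (y t) \<psi> = innerX T (y 0) \<psi> + integral {0..t} (\<lambda>s. rhs T (y s) (u s) \<psi>)"
    if t: "t \<ge> 0" and p: "\<psi> \<in> domA T" for t \<psi>
  proof -
    \<comment> \<open>The definition speaks of intervals \<open>{0..\<tau>}\<close> with \<tau> > 0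
      only, whereas \<open>t\<close> may be 0.\<close>
    have "t + 1 > 0" using t by simp
    then obtain z where y: "continuousX T (t + 1) y" and z: "has_derivative_dualA T (t + 1) y z"
      and ae: "AE s in lebesgue_on {0..t + 1}. \<forall>\<psi>\<in>domA T. z s \<psi> = rhs T (y s) (u s) \<psi>"
      using L unfolding state_solution_def rhs_def by blast
    have N: "negligible {s \<in> {0..t+1}. \<not> (\<forall>\<psi>\<in>domA T. z s \<psi> = rhs T (y s) (u s) \<psi>)}" (is "negligible ?N")
      using ae by (simp add: AE_lebesgue_on_iff_negligible)
    have c: "continuous_on {0..t} (\<lambda>s. rhs T (y s) (u s) \<psi>)"
      by (rule continuous_on_subset[OF continuous_on_rhs[OF y _ p]]) (auto intro: continuous_on_subset[OF u])
    have "(\<lambda>s. z s \<psi>) absolutely_integrable_on {0..t}"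
      by (rule absolutely_integrable_spike[OF absolutely_integrable_continuous_real[OF c] N]) (use p in auto)
    then have "(LINT s|lebesgue_on {0..t}. z s \<psi>) = integral {0..t} (\<lambda>s. z s \<psi>)"
      by (rule LINT_lebesgue_on_eq_integral)
    also have "\<dots> = integral {0..t} (\<lambda>s. rhs T (y s) (u s) \<psi>)"
      by (rule integral_spike[OF N]) (use p in auto)
    finally have "(LINT s|lebesgue_on {0..t}. z s \<psi>) = integral {0..t} (\<lambda>s. rhs T (y s) (u s) \<psi>)" .
    moreover have "innerX T (y t) \<psi> = innerX T (y 0) \<psi> + (LINT s|lebesgue_on {0..t}. z s \<psi>)"
    proof -
      have "\<forall>r\<in>{0..t + 1}. \<forall>\<psi>\<in>domA T. innerX T (y r) \<psi> = innerX T (y 0) \<psi> + (LINT s|lebesgue_on {0..r}. z s \<psi>)"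
        using z unfolding has_derivative_dualA_def embedX_def by (rule conjunct2)
      then show ?thesis using t p by (elim ballE[where x = t] ballE[where x = \<psi>]) auto
    qed
    ultimately show ?thesis by simp
  qed
  then show ?R using L unfolding state_solution_def by blast
next
  assume R: ?R
  have "has_derivative_dualA T \<tau> y (\<lambda>t. rhs T (y t) (u t))" if \<tau>: "\<tau> > 0" for \<tau>
    unfolding has_derivative_dualA_def
  proof (intro conjI ballI)
    have y: "continuousX T \<tau> y" and u': "continuous_on {0..\<tau>} u"
      using R \<tau> by (auto intro: continuous_on_subset[OF u])
    then show "(\<lambda>t. rhs T (y t) (u t)) \<in> L2_dualA T \<tau>" by (rule rhs_L2_dualA[OF T])
    fix t \<psi> assume t: "t \<in> {0..\<tau>}" and p: "\<psi> \<in> domA T"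
    have "continuous_on {0..t} (\<lambda>s. rhs T (y s) (u s) \<psi>)"
      by (rule continuous_on_subset[OF continuous_on_rhs[OF y u' p]]) (use t in auto)
    then have "(LINT s|lebesgue_on {0..t}. rhs T (y s) (u s) \<psi>) = integral {0..t} (\<lambda>s. rhs T (y s) (u s) \<psi>)"
      by (intro LINT_lebesgue_on_eq_integral absolutely_integrable_continuous_real)
    then show "embedX T (y t) \<psi> = embedX T (y 0) \<psi> + (LINT s|lebesgue_on {0..t}. rhs T (y s) (u s) \<psi>)"
      unfolding embedX_def
    proof -
      assume e: "(LINT s|lebesgue_on {0..t}. rhs T (y s) (u s) \<psi>) = integral {0..t} (\<lambda>s. rhs T (y s) (u s) \<psi>)"
      have "0 \<le> t" using t by simp
      then show "innerX T (y t) \<psi> = innerX T (y 0) \<psi> + (LINT s|lebesgue_on {0..t}. rhs T (y s) (u s) \<psi>)"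
        unfolding e using R p by blast
    qed
  qed
  then have "\<exists>z. has_derivative_dualA T \<tau> y z \<and>
      (AE t in lebesgue_on {0..\<tau>}. \<forall>\<psi>\<in>domA T. z t \<psi> = adjA T (y t) \<psi> + adjB T (u t) \<psi>)"
    if "\<tau> > 0" for \<tau>
    using that by (intro exI[of _ "\<lambda>t. rhs T (y t) (u t)"]) (simp add: rhs_def)
  then show ?L using R unfolding state_solution_def by simp
qed

section \<open>History states solve the state equation\<close>

lemma absolutely_integrable_borel_representative:
  fixes f :: "real \<Rightarrow> real"
  assumes "f absolutely_integrable_on {a..b}"
  obtains f' N where "f' \<in> borel_measurable borel" "integrable lborel f'" "negligible N"
    "\<And>x. x \<notin> N \<Longrightarrow> x \<in> {a..b} \<Longrightarrow> f' x = f x" "\<And>x. x \<notin> {a..b} \<Longrightarrow> f' x = 0"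
proof -
  define F where "F x = indicator {a..b} x * f x" for x
  have F: "integrable lebesgue F"
    using assms by (simp add: set_integrable_def F_def[abs_def])
  then have "F \<in> borel_measurable lebesgue" by (rule borel_measurable_integrable)
  \<comment> \<open>The Lebesgue measurable function is traded for a Borel one, so that products and
    convolutions of representatives are measurable for the product of \<open>lborel\<close> with
    itself.\<close>
  then obtain f0 where f0: "f0 \<in> borel_measurable lborel" and ae: "AE x in lborel. F x = f0 x"
    using completion_ex_borel_measurable_real by blast
  define f' where "f' x = indicator {a..b} x * f0 x" for x
  have f': "f' \<in> borel_measurable borel" using f0 unfolding f'_def by auto
  have ae': "AE x in lebesgue. F x = f' x"
    using AE_completion[OF ae] by eventually_elim (auto simp: f'_def F_def split: split_indicator)
  then obtain N where N: "negligible N" "{x. F x \<noteq> f' x} \<subseteq> N"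
    unfolding eventually_ae_filter_negligible by blast
  have "integrable lebesgue f'"
  proof (rule integrable_cong_AE_imp[OF F])
    show "f' \<in> borel_measurable lebesgue" using f' by (intro measurable_completion) simp
  qed (use ae' in \<open>simp add: eq_commute\<close>)
  then have "integrable lborel f'" using f' by (simp add: integrable_completion)
  then show ?thesis
    by (rule that[OF f' _ N(1)]) (use N(2) in \<open>auto simp: F_def f'_def indicator_def\<close>)
qed

lemma integrable_lborel_pair_mult:
  fixes f g :: "real \<Rightarrow> real"
  assumes [measurable]: "integrable lborel f" "integrable lborel g"
  shows "integrable (lborel \<Otimes>\<^sub>M lborel) (\<lambda>(x, y). f x * g y)"
  by (rule lborel_pair.Fubini_integrable) (use assms in \<open>auto simp: abs_mult\<close>)

lemma integrable_lborel_pair_convolution: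
  fixes f g :: "real \<Rightarrow> real"
  assumes [measurable]: "f \<in> borel_measurable borel" "g \<in> borel_measurable borel"
    and f: "integrable lborel f" and g: "integrable lborel g"
  shows "integrable (lborel \<Otimes>\<^sub>M lborel) (\<lambda>(x, y). g x * f (y - x))"
proof (rule lborel_pair.Fubini_integrable)
  have "(\<integral>y. \<bar>f (y - x)\<bar> \<partial>lborel) = (\<integral>y. \<bar>f y\<bar> \<partial>lborel)" for x
    using lborel_integral_real_affine[of 1 "\<lambda>y. \<bar>f y\<bar>" "-x"] by simp
  then show "integrable lborel (\<lambda>x. \<integral>y. norm (case (x, y) of (x, y) \<Rightarrow> g x * f (y - x)) \<partial>lborel)"
    using g by (simp add: abs_mult)
  have "integrable lborel (\<lambda>y. f (y - x))" for x
    using lborel_integrable_real_affine[OF f, of 1 "-x"] by simp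
  then show "AE x in lborel. integrable lborel (\<lambda>y. case (x, y) of (x, y) \<Rightarrow> g x * f (y - x))"
    by auto
qed measurable

lemma integral_lborel_support:
  fixes f :: "real \<Rightarrow> real"
  assumes "integrable lborel f" "\<And>x. x \<notin> {a..b} \<Longrightarrow> f x = 0"
  shows "(\<integral>x. f x \<partial>lborel) = integral {a..b} f"
proof -
  have "(\<integral>x. f x \<partial>lborel) = integral UNIV f" using integral_lborel[OF assms(1)] by simp
  also have "f = (\<lambda>x. if x \<in> {a..b} then f x else 0)" using assms(2) by auto
  then have "integral UNIV f = integral UNIV (\<lambda>x. if x \<in> {a..b} then f x else 0)" by simp
  also have "\<dots> = integral {a..b} f" by (rule integral_restrict_UNIV)
  finally show ?thesis .
qed

text \<open>Fubini on the triangle a \<le> s \<le> r \<le> b; it serves as integration by parts for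
  functions that are only integrable.\<close>

lemma integral_triangle_swap:
  fixes f g :: "real \<Rightarrow> real"
  assumes f: "f absolutely_integrable_on {a..b}" and g: "g absolutely_integrable_on {a..b}"
  shows "integral {a..b} (\<lambda>s. f s * integral {s..b} g) = integral {a..b} (\<lambda>r. g r * integral {a..r} f)"
proof -
  obtain f' N where f'[measurable]: "f' \<in> borel_measurable borel" and fi: "integrable lborel f'"
    and N: "negligible N" and fe: "\<And>x. x \<notin> N \<Longrightarrow> x \<in> {a..b} \<Longrightarrow> f' x = f x"
    and f0: "\<And>x. x \<notin> {a..b} \<Longrightarrow> f' x = 0"
    using absolutely_integrable_borel_representative[OF f] by blast
  obtain g' M where g'[measurable]: "g' \<in> borel_measurable borel" and gi: "integrable lborel g'"
    and M: "negligible M" and ge: "\<And>x. x \<notin> M \<Longrightarrow> x \<in> {a..b} \<Longrightarrow> g' x = g x"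
    and g0: "\<And>x. x \<notin> {a..b} \<Longrightarrow> g' x = 0"
    using absolutely_integrable_borel_representative[OF g] by blast
  define H where "H s r = indicator {s..} r * (f' s * g' r)" for s r
  have H: "integrable (lborel \<Otimes>\<^sub>M lborel) (case_prod H)"
  proof (rule Bochner_Integration.integrable_bound[OF integrable_lborel_pair_mult[OF fi gi]])
    have [measurable]: "Measurable.pred (borel \<Otimes>\<^sub>M borel) (\<lambda>x :: real \<times> real. snd x \<in> {fst x..})"
      unfolding atLeast_iff by measurable
    show "case_prod H \<in> borel_measurable (lborel \<Otimes>\<^sub>M lborel)"
      unfolding H_def split_beta indicator_def by measurable
  qed (auto simp: H_def split: split_indicator)
  have g_in: "(\<integral>r. H s r \<partial>lborel) = f' s * integral {s..b} g" if "s \<in> {a..b}" for s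
  proof -
    have "integrable lborel (\<lambda>r. indicator {s..} r * g' r)"
      using integrable_mult_indicator[OF _ gi, of "{s..}"] by simp
    then have "(\<integral>r. indicator {s..} r * g' r \<partial>lborel) = integral {s..b} (\<lambda>r. indicator {s..} r * g' r)"
      by (rule integral_lborel_support) (use g0 in \<open>auto split: split_indicator\<close>)
    also have "\<dots> = integral {s..b} g"
      by (rule integral_spike[OF M]) (use ge that in auto)
    finally show ?thesis by (simp add: H_def mult.left_commute[of _ "f' s"])
  qed
  have f_in: "(\<integral>s. H s r \<partial>lborel) = g' r * integral {a..r} f" if "r \<in> {a..b}" for r
  proof -
    have "integrable lborel (\<lambda>s. indicator {..r} s * f' s)"
      using integrable_mult_indicator[OF _ fi, of "{..r}"] by simp
    then have "(\<integral>s. indicator {..r} s * f' s \<partial>lborel) = integral {a..r} (\<lambda>s. indicator {..r} s * f' s)"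
      by (rule integral_lborel_support) (use f0 in \<open>auto split: split_indicator\<close>)
    also have "\<dots> = integral {a..r} f"
      by (rule integral_spike[OF N]) (use fe that in auto)
    finally have "(\<integral>s. indicator {..r} s * f' s \<partial>lborel) = integral {a..r} f" .
    moreover have "(\<lambda>s. H s r) = (\<lambda>s. g' r * (indicator {..r} s * f' s))"
      by (auto simp: H_def split: split_indicator)
    ultimately show ?thesis by (simp only: integral_mult_right_zero)
  qed
  have "integral {a..b} (\<lambda>s. f s * integral {s..b} g) = integral {a..b} (\<lambda>s. \<integral>r. H s r \<partial>lborel)"
    by (rule integral_spike[OF N]) (simp add: g_in fe)
  also have "\<dots> = (\<integral>s. (\<integral>r. H s r \<partial>lborel) \<partial>lborel)"
    by (rule integral_lborel_support[symmetric, OF lborel_pair.integrable_fst[OF H]]) (simp add: H_def f0)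
  also have "\<dots> = (\<integral>r. (\<integral>s. H s r \<partial>lborel) \<partial>lborel)"
    by (rule lborel_pair.Fubini_integral[OF H, symmetric])
  also have "\<dots> = integral {a..b} (\<lambda>r. \<integral>s. H s r \<partial>lborel)"
    by (rule integral_lborel_support[OF lborel_pair.integrable_snd[OF H]]) (simp add: H_def g0)
  also have "\<dots> = integral {a..b} (\<lambda>r. g r * integral {a..r} f)"
    by (rule integral_spike[OF M]) (simp add: f_in ge)
  finally show ?thesis .
qed

text \<open>Fubini on a rectangle. With both factors merely integrable, the slice in
  \<open>r\<close> is integrable only for almost every \<open>s\<close>, hence the null set
  \<open>K\<close>; the slice in \<open>s\<close> is a truncated translate of \<open>f'\<close> and
  is integrable for every \<open>r\<close>.\<close>

lemma integral_convolution_swap: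
  fixes f g :: "real \<Rightarrow> real"
  assumes f: "f absolutely_integrable_on {0-d..t-c}" and g: "g absolutely_integrable_on {c..d}"
  shows "integral {0..t} (\<lambda>s. integral {c..d} (\<lambda>r. g r * f (s - r))) =
         integral {c..d} (\<lambda>r. g r * integral {0..t} (\<lambda>s. f (s - r)))"
proof -
  obtain f' N where f'[measurable]: "f' \<in> borel_measurable borel" and fi: "integrable lborel f'"
    and N: "negligible N" and fe: "\<And>x. x \<notin> N \<Longrightarrow> x \<in> {0-d..t-c} \<Longrightarrow> f' x = f x"
    and "\<And>x. x \<notin> {0-d..t-c} \<Longrightarrow> f' x = 0"
    using absolutely_integrable_borel_representative[OF f] by blast
  obtain g' M where g'[measurable]: "g' \<in> borel_measurable borel" and gi: "integrable lborel g'"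
    and M: "negligible M" and ge: "\<And>x. x \<notin> M \<Longrightarrow> x \<in> {c..d} \<Longrightarrow> g' x = g x"
    and g0: "\<And>x. x \<notin> {c..d} \<Longrightarrow> g' x = 0"
    using absolutely_integrable_borel_representative[OF g] by blast
  define H where "H r s = indicator {0..t} s * (g' r * f' (s - r))" for r s
  have H: "integrable (lborel \<Otimes>\<^sub>M lborel) (case_prod H)"
  proof (rule Bochner_Integration.integrable_bound[OF integrable_lborel_pair_convolution[OF f' g' fi gi]])
    show "case_prod H \<in> borel_measurable (lborel \<Otimes>\<^sub>M lborel)"
      unfolding H_def split_beta by measurable
  qed (auto simp: H_def split: split_indicator)
  obtain K where K: "negligible K" "{s. \<not> integrable lborel (\<lambda>r. H r s)} \<subseteq> K"
    using AE_completion[OF lborel_pair.AE_integrable_snd[OF H]]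
    unfolding eventually_ae_filter_negligible by blast
  have in_r: "(\<integral>r. H r s \<partial>lborel) = integral {c..d} (\<lambda>r. g r * f (s - r))" if s: "s \<in> {0..t} - K" for s
  proof -
    have "integrable lborel (\<lambda>r. H r s)" using K s by blast
    then have "(\<integral>r. H r s \<partial>lborel) = integral {c..d} (\<lambda>r. H r s)"
      by (rule integral_lborel_support) (simp add: H_def g0)
    also have "\<dots> = integral {c..d} (\<lambda>r. g r * f (s - r))"
    proof (rule integral_spike)
      show "negligible (M \<union> {r. s - r \<in> N})" by (intro negligible_Un M negligible_reverse N)
    qed (use s in \<open>auto simp: H_def ge fe\<close>)
    finally show ?thesis .
  qed
  have in_s: "(\<integral>s. H r s \<partial>lborel) = g' r * integral {0..t} (\<lambda>s. f (s - r))" if r: "r \<in> {c..d}" for r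
  proof -
    have "integrable lborel (\<lambda>s. f' (s - r))"
      using lborel_integrable_real_affine[OF fi, of 1 "-r"] by simp
    then have "integrable lborel (\<lambda>s. indicator {0..t} s * f' (s - r))"
      using integrable_mult_indicator[of "{0..t}" lborel "\<lambda>s. f' (s - r)"] by simp
    then have "(\<integral>s. indicator {0..t} s * f' (s - r) \<partial>lborel)
        = integral {0..t} (\<lambda>s. indicator {0..t} s * f' (s - r))"
      by (rule integral_lborel_support) auto
    also have "\<dots> = integral {0..t} (\<lambda>s. f' (s - r))" by (rule integral_cong) simp
    also have "\<dots> = integral {0-r..t-r} f'" using integral_shift_real_ivl[of "0-r" "-r" "t-r" f'] by simp
    also have "\<dots> = integral {0-r..t-r} f" by (rule integral_spike[OF N]) (use r fe in auto)
    also have "\<dots> = integral {0..t} (\<lambda>s. f (s - r))" using integral_shift_real_ivl[of "0-r" "-r" "t-r" f] by simp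
    finally show ?thesis by (simp add: H_def mult.left_commute[of _ "g' r"])
  qed
  have "integral {0..t} (\<lambda>s. integral {c..d} (\<lambda>r. g r * f (s - r))) = integral {0..t} (\<lambda>s. \<integral>r. H r s \<partial>lborel)"
    by (rule integral_spike[OF K(1)]) (simp add: in_r)
  also have "\<dots> = (\<integral>s. (\<integral>r. H r s \<partial>lborel) \<partial>lborel)"
    by (rule integral_lborel_support[symmetric, OF lborel_pair.integrable_snd[OF H]]) (simp add: H_def)
  also have "\<dots> = (\<integral>r. (\<integral>s. H r s \<partial>lborel) \<partial>lborel)"
    by (rule lborel_pair.Fubini_integral[OF H])
  also have "\<dots> = integral {c..d} (\<lambda>r. \<integral>s. H r s \<partial>lborel)"
    by (rule integral_lborel_support[OF lborel_pair.integrable_fst[OF H]]) (simp add: H_def g0)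
  also have "\<dots> = integral {c..d} (\<lambda>r. g r * integral {0..t} (\<lambda>s. f (s - r)))"
    by (rule integral_spike[OF M]) (simp add: in_s ge)
  finally show ?thesis .
qed

section \<open>History states: continuity in X and the weak equation\<close>

lemma continuous_on_atLeastI:
  fixes f :: "real \<Rightarrow> 'a::topological_space"
  assumes "\<And>b. continuous_on {0..b} f"
  shows "continuous_on {0..} f"
  unfolding continuous_on_def
proof
  fix t :: real assume t: "t \<in> {0..}"
  have "at t within {0..} = at t within {0..t+1}"
    by (rule at_within_nhd[of t "{t-1<..<t+1}"]) (use t in auto)
  then show "(f \<longlongrightarrow> f t) (at t within {0..})"
    using assms[of "t+1"] t by (auto simp: continuous_on_def)
qed

text \<open>Capital is the investment of the last \<open>T\<close> time units, which is the
  integrated form of k'(t) = i(t) - i(t - T) with the prescribed k(0). One function \<open>I\<close>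
  on the whole line removes the distinction between datum and control.\<close>

definition hist :: "real \<Rightarrow> (real \<Rightarrow> real) \<Rightarrow> real \<Rightarrow> state" where
  "hist T I t = (integral {t-T..t} I, F T (\<lambda>s. I (t + s)))"

lemma snd_hist: "snd (hist T I t) = (\<lambda>s. - I (t - T - s))"
  by (simp add: hist_def F_def algebra_simps)

definition primitive :: "real \<Rightarrow> (real \<Rightarrow> real) \<Rightarrow> real \<Rightarrow> real" where
  "primitive T I x = integral {-T..x} I"

context
  fixes T :: real and I :: "real \<Rightarrow> real"
  assumes T: "T > 0" and I: "\<And>a b. square_integrable_on I {a..b}"
begin

lemma history_integrable: "I integrable_on {a..b}"
  using I L2_integrable by blast

lemma primitive_continuous_on: "continuous_on {-T..b} (primitive T I)"
  unfolding primitive_def by (intro indefinite_integral_continuous_1 history_integrable)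

lemma integral_eq_primitive:
  assumes "-T \<le> a" "a \<le> b"
  shows "integral {a..b} I = primitive T I b - primitive T I a"
  using Henstock_Kurzweil_Integration.integral_combine[OF assms history_integrable]
  by (simp add: primitive_def)

lemma hist_spaceX: "hist T I t \<in> spaceX T"
  unfolding spaceX_def mem_Collect_eq snd_hist
  by (rule L2_minus) (simp add: L2_reverse I)

text \<open>After reflection, the second components of two histories differ by \<open>I\<close>
  minus its translate on a window of length \<open>T\<close>; continuity in X thus becomes
  continuity of translations.\<close>

lemma hist_distX:
  "distX T (hist T I s) (hist T I t) = sqrt ((fst (hist T I s) - fst (hist T I t))\<^sup>2 +
     integral {t-T..t} (\<lambda>x. (I (x + (s - t)) - I x)\<^sup>2))"
proof -
  let ?d = "addX (hist T I s) (scaleX (-1) (hist T I t))"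
  have "innerX T ?d ?d = (fst ?d)\<^sup>2 + integral {-T..0} (\<lambda>r. (snd ?d r)\<^sup>2)"
    by (subst innerX_eq) (auto intro!: addX_spaceX scaleX_spaceX hist_spaceX simp: power2_eq_square)
  also have "snd ?d = (\<lambda>r. I (t - T - r) - I ((t - T - r) + (s - t)))"
    by (auto simp: addX_def scaleX_def snd_hist algebra_simps)
  also have "integral {-T..0} (\<lambda>r. (I (t - T - r) - I ((t - T - r) + (s - t)))\<^sup>2)
      = integral {t-T..t} (\<lambda>x. (I (x + (s - t)) - I x)\<^sup>2)"
    using integral_reverse[of "-T" 0 "\<lambda>x. (I x - I (x + (s - t)))\<^sup>2" "t - T"]
    by (simp add: power2_commute)
  finally show ?thesis by (simp add: distX_def normX_def addX_def scaleX_def)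
qed

lemma hist_fst_continuous_on: "continuous_on {0..} (\<lambda>t. fst (hist T I t))"
proof -
  have "continuous_on {0..b} (\<lambda>t. fst (hist T I t))" for b
  proof -
    have "continuous_on {0..b} (\<lambda>t. primitive T I t - primitive T I (t - T))"
      using T by (intro continuous_intros continuous_on_compose2[OF primitive_continuous_on[of b]]) auto
    then show ?thesis
      by (rule continuous_on_cong[THEN iffD1, rotated 2])
        (use T in \<open>auto simp: hist_def integral_eq_primitive\<close>)
  qed
  then show ?thesis by (rule continuous_on_atLeastI)
qed

lemma hist_continuousX: "continuousX T \<tau> (hist T I)"
  unfolding continuousX_def
proof (intro ballI conjI hist_spaceX)
  fix t assume t: "t \<in> {0..\<tau>}"
  have "((\<lambda>s. integral {t-T..t} (\<lambda>x. (I (x + (s - t)) - I x)\<^sup>2)) \<longlongrightarrow> 0) (at t within {0..\<tau>})"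
    unfolding tendsto_iff
  proof (intro allI impI)
    fix e :: real assume "e > 0"
    then obtain d where d: "d > 0" "\<And>h. \<bar>h\<bar> < d \<Longrightarrow> integral {t-T..t} (\<lambda>x. (I (x + h) - I x)\<^sup>2) < e"
      using square_integrable_translation_continuous[OF I, of e "t-T" t] by blast
    have "0 \<le> integral {t-T..t} (\<lambda>x. (I (x + h) - I x)\<^sup>2)" for h
      by (rule integral_nonneg) (auto intro!: L2_integrable
          L2_diff L2_shift[THEN iffD2] I)
    then show "\<forall>\<^sub>F s in at t within {0..\<tau>}. dist (integral {t-T..t} (\<lambda>x. (I (x + (s - t)) - I x)\<^sup>2)) 0 < e"
      unfolding eventually_at using d by (intro exI[of _ d]) (auto simp: dist_real_def)
  qed
  moreover have "((\<lambda>s. (fst (hist T I s) - fst (hist T I t))\<^sup>2) \<longlongrightarrow> (fst (hist T I t) - fst (hist T I t))\<^sup>2) (at t within {0..\<tau>})"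
    using continuous_on_subset[OF hist_fst_continuous_on, of "{0..\<tau>}"] t
    unfolding continuous_on_def by (intro tendsto_power tendsto_diff tendsto_const) auto
  ultimately have "((\<lambda>s. (fst (hist T I s) - fst (hist T I t))\<^sup>2 + integral {t-T..t} (\<lambda>x. (I (x + (s - t)) - I x)\<^sup>2))
      \<longlongrightarrow> 0 + 0) (at t within {0..\<tau>})"
    by (intro tendsto_add) auto
  then show "((\<lambda>s. distX T (hist T I s) (hist T I t)) \<longlongrightarrow> 0) (at t within {0..\<tau>})"
    unfolding hist_distX using tendsto_real_sqrt by force
qed

text \<open>Only the increment \<open>\<psi> 0 - \<psi> s\<close> enters, because \<open>k(t)\<close> is the integral of the history.\<close>

lemma innerX_hist:
  assumes \<psi>: "\<psi> \<in> domA T" and g: "has_L2_derivative T (snd \<psi>) g"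
  shows "innerX T (hist T I t) \<psi> = integral {-T..0} (\<lambda>r. g r * integral {t-T-r..t} I)"
proof -
  note gs = has_L2_derivativeD(1)[OF g]
  have Ir: "square_integrable_on (\<lambda>s. I (t - T - s)) {-T..0}" by (simp add: L2_reverse I)
  have \<psi>s: "square_integrable_on (snd \<psi>) {-T..0}" using domA_spaceX[OF \<psi>] by (simp add: spaceX_def)
  have "innerX T (hist T I t) \<psi> = fst (hist T I t) * fst \<psi> + integral {-T..0} (\<lambda>s. - (I (t - T - s) * snd \<psi> s))"
    using innerX_eq[OF hist_spaceX domA_spaceX[OF \<psi>]] by (simp add: snd_hist)
  also have "fst (hist T I t) = integral {-T..0} (\<lambda>s. I (t - T - s))"
    using integral_reverse[of "-T" 0 I "t - T"] by (simp add: hist_def)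
  also have "fst \<psi> = snd \<psi> 0" using \<psi> by (simp add: domA_def)
  also have "integral {-T..0} (\<lambda>s. I (t - T - s)) * snd \<psi> 0 + integral {-T..0} (\<lambda>s. - (I (t - T - s) * snd \<psi> s))
     = integral {-T..0} (\<lambda>s. I (t - T - s) * snd \<psi> 0 + - (I (t - T - s) * snd \<psi> s))"
    by (subst integral_add) (auto intro!: integrable_neg L2_mult_integrable Ir \<psi>s
        integrable_on_mult_left L2_integrable(2)[OF Ir])
  also have "\<dots> = integral {-T..0} (\<lambda>s. I (t - T - s) * integral {s..0} g)"
  proof (rule integral_cong)
    fix s assume s: "s \<in> {-T..0}"
    have "snd \<psi> 0 = snd \<psi> (-T) + integral {-T..0} g" using s by (intro has_L2_derivativeD(2)[OF g]) auto
    moreover have "snd \<psi> s = snd \<psi> (-T) + integral {-T..s} g" by (rule has_L2_derivativeD(2)[OF g s])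
    moreover have "integral {-T..s} g + integral {s..0} g = integral {-T..0} g"
      using s by (intro Henstock_Kurzweil_Integration.integral_combine L2_integrable gs) auto
    ultimately have e: "integral {s..0} g = snd \<psi> 0 - snd \<psi> s" by linarith
    show "I (t - T - s) * snd \<psi> 0 + - (I (t - T - s) * snd \<psi> s) = I (t - T - s) * integral {s..0} g"
      unfolding e by (simp add: algebra_simps)
  qed
  also have "\<dots> = integral {-T..0} (\<lambda>r. g r * integral {-T..r} (\<lambda>s. I (t - T - s)))"
    by (intro integral_triangle_swap L2_integrable Ir gs)
  also have "\<dots> = integral {-T..0} (\<lambda>r. g r * integral {t-T-r..t} I)"
    by (simp add: integral_reverse)
  finally show ?thesis .
qed

text \<open>By \<open>innerX_hist\<close> the increment of the pairing is an integral over
  \<open>r\<close> of \<open>g r\<close> times the integral of \<open>I\<close> over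
  \<open>{0..t}\<close> minus that of its translate by T + r. The first term is the contribution of
  B, because \<open>g\<close> integrates to B \<psi>; Fubini turns the second into the contribution
  of A. Nothing is differentiated in time, so \<open>I\<close> may be merely square
  integrable.\<close>

lemma hist_weak_solution:
  assumes \<psi>: "\<psi> \<in> domA T" and t: "t \<ge> 0"
  shows "innerX T (hist T I t) \<psi> = innerX T (hist T I 0) \<psi> + integral {0..t} (\<lambda>s. rhs T (hist T I s) (I s) \<psi>)"
proof -
  obtain g where g: "has_L2_derivative T (snd \<psi>) g" using domA_derivative[OF \<psi>] by blast
  note gs = has_L2_derivativeD(1)[OF g]
  define J where "J = primitive T I"
  have i: "(\<lambda>r. g r * integral {s-T-r..s} I) integrable_on {-T..0}" if "s \<ge> 0" for s
  proof (intro L2_mult_integrable gs L2_continuous)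
    have "continuous_on {-T..0} (\<lambda>r. J s - J (s - T - r))"
      unfolding J_def using that
      by (intro continuous_intros continuous_on_compose2[OF primitive_continuous_on[of s]]) auto
    then show "continuous_on {-T..0} (\<lambda>r. integral {s-T-r..s} I)"
      by (rule continuous_on_cong[THEN iffD1, rotated 2])
        (use that in \<open>auto simp: J_def integral_eq_primitive\<close>)
  qed
  have ic: "(\<lambda>r. g r * integral {0..t} (\<lambda>s. I (s - r - T))) integrable_on {-T..0}"
  proof (intro L2_mult_integrable gs L2_continuous)
    have "continuous_on {-T..0} (\<lambda>r. J (t - T - r) - J (-T-r))"
      unfolding J_def using t
      by (intro continuous_intros continuous_on_compose2[OF primitive_continuous_on[of t]]) auto
    then show "continuous_on {-T..0} (\<lambda>r. integral {0..t} (\<lambda>s. I (s - r - T)))"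
    proof (rule continuous_on_cong[THEN iffD1, rotated 2])
      fix r assume "r \<in> {-T..0}"
      then show "J (t - T - r) - J (-T-r) = integral {0..t} (\<lambda>s. I (s - r - T))"
        using t integral_shift_real_ivl[of "-T-r" "-T-r" "t-T-r" I]
        by (simp add: J_def integral_eq_primitive algebra_simps)
    qed simp
  qed
  have "innerX T (hist T I t) \<psi> - innerX T (hist T I 0) \<psi>
     = integral {-T..0} (\<lambda>r. g r * integral {t-T-r..t} I - g r * integral {0-T-r..0} I)"
    using integral_diff[OF i[OF t] i[of 0]] by (simp add: innerX_hist[OF \<psi> g])
  also have "\<dots> = integral {-T..0} (\<lambda>r. g r * integral {0..t} I - g r * integral {0..t} (\<lambda>s. I (s - r - T)))"
  proof (rule integral_cong)
    fix r assume r: "r \<in> {-T..0}"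
    have "integral {0..t} (\<lambda>s. I (s - r - T)) = integral {-T-r..t-T-r} I"
      using integral_shift_real_ivl[of "-T-r" "-T-r" "t-T-r" I] by (simp add: algebra_simps)
    also have "integral {t-T-r..t} I - integral {0-T-r..0} I = integral {0..t} I - integral {-T-r..t-T-r} I"
      using r t T by (simp add: integral_eq_primitive)
    ultimately show "g r * integral {t-T-r..t} I - g r * integral {0-T-r..0} I =
        g r * integral {0..t} I - g r * integral {0..t} (\<lambda>s. I (s - r - T))"
      by (metis right_diff_distrib)
  qed
  also have "\<dots> = integral {0..t} I * integral {-T..0} g - integral {-T..0} (\<lambda>r. g r * integral {0..t} (\<lambda>s. I (s - r - T)))"
    by (subst integral_diff[OF _ ic]) (auto intro: integrable_on_mult_left L2_integrable(2)[OF gs])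
  also have "integral {-T..0} (\<lambda>r. g r * integral {0..t} (\<lambda>s. I (s - r - T)))
     = integral {0..t} (\<lambda>s. integral {-T..0} (\<lambda>r. g r * I (s - r - T)))"
  proof (rule integral_convolution_swap[where f = "\<lambda>x. I (x - T)", symmetric])
    show "(\<lambda>x. I (x - T)) absolutely_integrable_on {0 - 0..t - - T}"
      using L2_shift[of I "-T" 0 "t+T"] I
      by (intro L2_integrable(1)) auto
  qed (intro L2_integrable gs)
  also have "\<dots> = integral {0..t} (\<lambda>s. - adjA T (hist T I s) \<psi>)"
  proof (rule integral_cong)
    fix s
    have "adjA T (hist T I s) \<psi> = integral {-T..0} (\<lambda>r. - (g r * I (s - r - T)))"
      using adjA_eq[OF hist_spaceX \<psi> g] innerX_eq[OF hist_spaceX, of "(0, g)"] gs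
      by (simp add: snd_hist spaceX_def algebra_simps)
    then show "integral {-T..0} (\<lambda>r. g r * I (s - r - T)) = - adjA T (hist T I s) \<psi>" by simp
  qed
  also have "integral {0..t} I * integral {-T..0} g - integral {0..t} (\<lambda>s. - adjA T (hist T I s) \<psi>)
     = integral {0..t} (\<lambda>s. adjA T (hist T I s) \<psi>) + integral {0..t} (\<lambda>s. I s * opB T \<psi>)"
    using opB_eq[OF T \<psi> g] by simp
  also have "\<dots> = integral {0..t} (\<lambda>s. rhs T (hist T I s) (I s) \<psi>)"
    unfolding rhs_def adjB_def
  proof (rule integral_add[symmetric])
    show "(\<lambda>s. adjA T (hist T I s) \<psi>) integrable_on {0..t}"
      unfolding adjA_def
      by (intro integrable_continuous_real continuous_on_innerX hist_continuousX opA_spaceX \<psi>)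
    show "(\<lambda>s. I s * opB T \<psi>) integrable_on {0..t}"
      by (intro integrable_on_mult_left history_integrable)
  qed
  finally show ?thesis by simp
qed

end

section \<open>Uniqueness for the state equation\<close>

lemma distX_self: "distX T x x = 0"
  by (simp add: distX_def normX_def innerX_def addX_def scaleX_def)

lemma normX_le_const:
  assumes "T > 0" "square_integrable_on f {-T..0}" "\<And>q. q \<in> {-T..0} \<Longrightarrow> \<bar>f q\<bar> \<le> K"
  shows "normX T (0, f) \<le> K * sqrt T"
proof -
  have K: "K \<ge> 0" using assms(3)[of 0] assms(1) by auto
  have f: "(0, f) \<in> spaceX T" using assms by (simp add: spaceX_def)
  have "innerX T (0, f) (0, f) = integral {-T..0} (\<lambda>q. (f q)\<^sup>2)"
    using innerX_eq[OF f f] by (simp add: power2_eq_square)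
  also have "\<dots> \<le> integral {-T..0} (\<lambda>q. K\<^sup>2)"
    using assms K
    by (intro integral_le L2_integrable(3)[OF assms(2)])
      (auto simp: abs_le_square_iff[symmetric])
  also have "\<dots> = (K * sqrt T)\<^sup>2" using assms(1) by (simp add: power_mult_distrib)
  finally show ?thesis unfolding normX_def using K assms(1) by (intro real_le_lsqrt) auto
qed

text \<open>The mean value inequality for z \<mapsto> p z - z * g x, whose derivative g z - g x is
  small on the segment. The truncated squares used as test functions have only a Lipschitz
  derivative, so this stands in for a second order Taylor expansion.\<close>

lemma DERIV_Lipschitz_remainder:
  fixes p g :: "real \<Rightarrow> real"
  assumes p: "\<And>x. (p has_real_derivative g x) (at x)" and g: "\<And>x y. \<bar>g x - g y\<bar> \<le> L * \<bar>x - y\<bar>"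
  shows "\<bar>p y - p x - (y - x) * g x\<bar> \<le> L * \<bar>y - x\<bar> * \<bar>y - x\<bar>"
proof -
  let ?S = "closed_segment x y"
  have L: "L \<ge> 0" using g[of 1 0] by auto
  have "norm ((p y - y * g x) - (p x - x * g x)) \<le> (L * \<bar>y - x\<bar>) * norm (y - x)"
  proof (rule field_differentiable_bound[where S = ?S])
    fix z assume z: "z \<in> ?S"
    show "((\<lambda>z. p z - z * g x) has_field_derivative g z - g x) (at z within ?S)"
      by (auto intro!: derivative_eq_intros DERIV_subset[OF p])
    have "\<bar>z - x\<bar> \<le> \<bar>y - x\<bar>"
      using z by (auto simp: closed_segment_eq_real_ivl split: if_splits)
    then show "norm (g z - g x) \<le> L * \<bar>y - x\<bar>"
      using g[of z x] L by (auto intro: order_trans mult_left_mono)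
  qed auto
  then show ?thesis by (simp add: algebra_simps)
qed

text \<open>Duality argument: along \<open>d' = A\<^sup>* d\<close> the pairing of \<open>d t\<close> with the translated test function
  \<open>p (\<cdot> + \<tau> - t)\<close>, that is with the semigroup of \<open>A\<close> applied to \<open>(p 0, p)\<close>, is constant in \<open>t\<close>.\<close>

context
  fixes T \<tau> :: real and d :: "real \<Rightarrow> state" and p g :: "real \<Rightarrow> real" and L :: real
  assumes T: "T > 0" and \<tau>: "\<tau> > 0"
    and d: "continuousX T \<tau> d"
    and weak: "\<And>t \<psi>. t \<in> {0..\<tau>} \<Longrightarrow> \<psi> \<in> domA T \<Longrightarrow> innerX T (d t) \<psi> = integral {0..t} (\<lambda>s. adjA T (d s) \<psi>)"
    and p: "\<And>x. (p has_real_derivative g x) (at x)"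
    and g: "\<And>x y. \<bar>g x - g y\<bar> \<le> L * \<bar>x - y\<bar>"
    and p0: "\<And>x. x \<ge> 0 \<Longrightarrow> p x = p 0"
begin

lemma L_nonneg: "L \<ge> 0" using g[of 1 0] by auto

lemma g_continuous: "continuous_on S g"
proof -
  have "L-lipschitz_on UNIV g" using g L_nonneg by (auto simp: lipschitz_on_def dist_real_def)
  then show ?thesis using lipschitz_on_continuous_on continuous_on_subset by blast
qed

lemma p_continuous: "continuous_on S p"
  by (rule DERIV_continuous_on) (rule DERIV_subset[OF p], simp)

lemma shift_spaceX: "(a, \<lambda>q. g (q + r)) \<in> spaceX T" "(a, \<lambda>q. p (q + r)) \<in> spaceX T"
  unfolding spaceX_def
  by (auto intro!: L2_continuous continuous_intros
      continuous_on_compose2[OF g_continuous[of UNIV]] continuous_on_compose2[OF p_continuous[of UNIV]])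

lemma shift_derivative: "has_L2_derivative T (\<lambda>q. p (q + r)) (\<lambda>q. g (q + r))"
proof (rule has_L2_derivativeI)
  show "square_integrable_on (\<lambda>q. g (q + r)) {-T..0}" using shift_spaceX(1) by (simp add: spaceX_def)
  fix s assume s: "s \<in> {-T..0}"
  have "((\<lambda>q. g (q + r)) has_integral p (s + r) - p (-T + r)) {-T..s}"
    using s by (intro fundamental_theorem_of_calculus)
      (auto simp: has_real_derivative_iff_has_vector_derivative[symmetric]
        intro!: DERIV_subset[OF DERIV_shift[THEN iffD1, OF p]])
  then show "p (s + r) = p (-T + r) + integral {-T..s} (\<lambda>q. g (q + r))"
    by (simp add: integral_unique)
qed

definition pair :: "real \<Rightarrow> real \<Rightarrow> real" where
  "pair t r = innerX T (d t) (p 0, \<lambda>q. p (q + r))"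

text \<open>The partial derivative of \<open>pair\<close> in both variables: in \<open>t\<close> by
  the weak equation, in \<open>r\<close> by differentiating the translated test function. Since the
  two coincide, \<open>pair\<close> does not change along the line t + r = \<tau>.\<close>

definition pair' :: "real \<Rightarrow> real \<Rightarrow> real" where
  "pair' t r = innerX T (d t) (0, \<lambda>q. g (q + r))"

lemma d_spaceX: "t \<in> {0..\<tau>} \<Longrightarrow> d t \<in> spaceX T"
  using d continuousX_spaceX by blast

text \<open>Membership in \<open>domA\<close> requires the first component to be the value at 0 of
  the translate, which is p r; for r \<ge> 0 this is still \<open>p 0\<close>, as \<open>p\<close>
  is constant on the nonnegative axis.\<close>

lemma pair_eq_integral:
  assumes "t \<in> {0..\<tau>}" "r \<ge> 0"
  shows "pair t r = integral {0..t} (\<lambda>s. pair' s r)"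
proof -
  have \<psi>: "(p 0, \<lambda>q. p (q + r)) \<in> domA T"
    using shift_derivative[of r] p0[of r] assms by (auto simp: domA_def W12_def)
  have "pair t r = integral {0..t} (\<lambda>s. adjA T (d s) (p 0, \<lambda>q. p (q + r)))"
    unfolding pair_def by (rule weak[OF assms(1) \<psi>])
  also have "\<dots> = integral {0..t} (\<lambda>s. pair' s r)"
    unfolding pair'_def using assms
    by (intro integral_cong adjA_eq[OF d_spaceX \<psi>]) (auto simp: shift_derivative)
  finally show ?thesis .
qed

lemma pair_derivative:
  assumes "t \<in> {0..\<tau>}" "r \<ge> 0"
  shows "((\<lambda>t. pair t r) has_real_derivative pair' t r) (at t within {0..\<tau>})"
proof -
  have "continuous_on {0..\<tau>} (\<lambda>s. pair' s r)"
    unfolding pair'_def by (intro continuous_on_innerX[OF d] shift_spaceX)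
  then have "((\<lambda>t. integral {0..t} (\<lambda>s. pair' s r)) has_real_derivative pair' t r) (at t within {0..\<tau>})"
    by (rule integral_has_real_derivative) (use assms in auto)
  then show ?thesis
    by (rule has_field_derivative_transform_within[OF _ zero_less_one assms(1)])
      (simp add: pair_eq_integral assms)
qed

lemma pair_remainder:
  assumes "t \<in> {0..\<tau>}"
  shows "\<bar>pair t q - pair t r - (q - r) * pair' t r\<bar> \<le> normX T (d t) * (L * \<bar>q - r\<bar> * \<bar>q - r\<bar> * sqrt T)"
proof -
  let ?f = "\<lambda>x. p (x + q) - p (x + r) - (q - r) * g (x + r)"
  have e: "(0, ?f) = addX (addX (p 0, \<lambda>x. p (x + q)) (scaleX (-1) (p 0, \<lambda>x. p (x + r))))
      (scaleX (- (q - r)) (0, \<lambda>x. g (x + r)))"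
    by (auto simp: addX_def scaleX_def algebra_simps)
  have f: "(0, ?f) \<in> spaceX T"
    unfolding e by (intro addX_spaceX scaleX_spaceX shift_spaceX)
  have "pair t q - pair t r - (q - r) * pair' t r = innerX T (d t) (0, ?f)"
    unfolding e using d_spaceX[OF assms]
    by (simp add: pair_def pair'_def innerX_add_right innerX_scale_right addX_spaceX scaleX_spaceX shift_spaceX
        algebra_simps)
  then have "\<bar>pair t q - pair t r - (q - r) * pair' t r\<bar> \<le> normX T (d t) * normX T (0, ?f)"
    using innerX_Cauchy_Schwarz[OF d_spaceX[OF assms] f] by simp
  also have "\<dots> \<le> normX T (d t) * (L * \<bar>q - r\<bar> * \<bar>q - r\<bar> * sqrt T)"
  proof (intro mult_left_mono normX_nonneg normX_le_const[OF T])
    show "square_integrable_on ?f {-T..0}" using f by (simp add: spaceX_def)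
    fix x
    show "\<bar>?f x\<bar> \<le> L * \<bar>q - r\<bar> * \<bar>q - r\<bar>"
      using DERIV_Lipschitz_remainder[OF p g, of "x + q" "x + r"] by simp
  qed
  finally show ?thesis .
qed

lemma pair'_diff:
  assumes "s \<in> {0..\<tau>}" "t \<in> {0..\<tau>}"
  shows "\<bar>pair' s q - pair' t r\<bar> \<le> distX T (d s) (d t) * (normX T (0, \<lambda>x. g (x + r)) + L * \<bar>q - r\<bar> * sqrt T)
    + normX T (d t) * (L * \<bar>q - r\<bar> * sqrt T)"
proof -
  let ?\<delta> = "(0, \<lambda>x. g (x + q) - g (x + r))" and ?g = "\<lambda>r. (0, \<lambda>x. g (x + r))"
  have e: "?\<delta> = addX (?g q) (scaleX (-1) (?g r))" by (auto simp: addX_def scaleX_def)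
  have e': "?g q = addX (?g r) ?\<delta>" by (auto simp: addX_def)
  have \<delta>: "?\<delta> \<in> spaceX T" unfolding e by (intro addX_spaceX scaleX_spaceX shift_spaceX)
  have \<delta>n: "normX T ?\<delta> \<le> L * \<bar>q - r\<bar> * sqrt T"
  proof (rule normX_le_const[OF T])
    show "square_integrable_on (\<lambda>x. g (x + q) - g (x + r)) {-T..0}" using \<delta> by (simp add: spaceX_def)
    show "\<bar>g (x + q) - g (x + r)\<bar> \<le> L * \<bar>q - r\<bar>" for x using g[of "x + q" "x + r"] by simp
  qed
  have gq: "normX T (?g q) \<le> normX T (?g r) + L * \<bar>q - r\<bar> * sqrt T"
    unfolding e' using normX_addX[OF shift_spaceX(1) \<delta>, of 0 r] \<delta>n by linarith
  have "pair' s q - pair' t r = innerX T (addX (d s) (scaleX (-1) (d t))) (?g q) + innerX T (d t) ?\<delta>"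
    unfolding e using d_spaceX assms
    by (simp add: pair'_def innerX_diff_left innerX_add_right innerX_scale_right scaleX_spaceX shift_spaceX)
  also have "\<bar>\<dots>\<bar> \<le> distX T (d s) (d t) * normX T (?g q) + normX T (d t) * normX T ?\<delta>"
    unfolding distX_def using assms
    by (intro order_trans[OF abs_triangle_ineq] add_mono innerX_Cauchy_Schwarz addX_spaceX scaleX_spaceX
        d_spaceX shift_spaceX \<delta>)
  also have "\<dots> \<le> distX T (d s) (d t) * (normX T (?g r) + L * \<bar>q - r\<bar> * sqrt T) + normX T (d t) * (L * \<bar>q - r\<bar> * sqrt T)"
    by (intro add_mono mult_left_mono gq \<delta>n) (auto simp: distX_def normX_nonneg)
  finally show ?thesis .
qed

text \<open>Joint continuity of \<open>pair'\<close> is what the chain rule for t \<mapsto> pair t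
  (\<tau> - t) calls for, since the increment in time is taken at an already shifted
  \<open>r\<close>.\<close>

lemma pair'_near:
  assumes t: "t \<in> {0..\<tau>}" and e: "e > 0"
  obtains \<delta> where "\<delta> > 0"
    "\<And>s q. s \<in> {0..\<tau>} \<Longrightarrow> \<bar>s - t\<bar> < \<delta> \<Longrightarrow> \<bar>q - r\<bar> < \<delta> \<Longrightarrow> \<bar>pair' s q - pair' t r\<bar> \<le> e"
proof -
  \<comment> \<open>\<open>N\<close> bounds the factor of the distance in \<open>pair'_diff\<close>
    while \<bar>q - r\<bar> \<le> 1, and \<open>M\<close> bounds the factor of \<bar>q - r\<bar>;
    the trailing 1 keeps both positive. Each summand then gets \<open>e/2\<close>.\<close>
  define N where "N = normX T (0, \<lambda>x. g (x + r)) + L * sqrt T + 1"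
  define M where "M = normX T (d t) * (L * sqrt T) + 1"
  have N: "N > 0" and M: "M > 0"
    using normX_nonneg[of T "d t"] normX_nonneg[of T "(0, \<lambda>x. g (x + r))"] L_nonneg T
    by (auto simp: N_def M_def intro!: add_nonneg_pos add_nonneg_nonneg)
  have "((\<lambda>s. distX T (d s) (d t)) \<longlongrightarrow> 0) (at t within {0..\<tau>})" using d t by (simp add: continuousX_def)
  then obtain \<delta> where \<delta>: "\<delta> > 0"
    "\<And>s. s \<in> {0..\<tau>} \<Longrightarrow> s \<noteq> t \<Longrightarrow> dist s t < \<delta> \<Longrightarrow> dist (distX T (d s) (d t)) 0 < e / (2 * N)"
    using e N unfolding tendsto_iff eventually_at by (metis divide_pos_pos mult_pos_pos zero_less_numeral)
  define \<delta>' where "\<delta>' = min \<delta> (min 1 (e / (2 * M)))"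
  show ?thesis
  proof (rule that[of \<delta>'])
    show "\<delta>' > 0" using \<delta> e M by (simp add: \<delta>'_def)
    fix s q assume s: "s \<in> {0..\<tau>}" "\<bar>s - t\<bar> < \<delta>'" and q: "\<bar>q - r\<bar> < \<delta>'"
    have ds: "distX T (d s) (d t) \<le> e / (2 * N)"
    proof (cases "s = t")
      case False
      then show ?thesis using \<delta>(2)[of s] s by (auto simp: \<delta>'_def dist_real_def)
    qed (use e N in \<open>simp add: distX_self\<close>)
    have q1: "\<bar>q - r\<bar> \<le> 1" "\<bar>q - r\<bar> \<le> e / (2 * M)" using q by (auto simp: \<delta>'_def)
    have LT: "0 \<le> L * sqrt T" using L_nonneg T by simp
    have "L * \<bar>q - r\<bar> * sqrt T \<le> L * sqrt T"
      using mult_left_mono[OF q1(1) LT] by (simp add: algebra_simps)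
    then have "normX T (0, \<lambda>x. g (x + r)) + L * \<bar>q - r\<bar> * sqrt T \<le> N" by (simp add: N_def)
    then have "distX T (d s) (d t) * (normX T (0, \<lambda>x. g (x + r)) + L * \<bar>q - r\<bar> * sqrt T) \<le> e / (2 * N) * N"
      using ds N e L_nonneg T by (intro mult_mono) (auto intro!: add_nonneg_nonneg normX_nonneg)
    moreover have "normX T (d t) * (L * \<bar>q - r\<bar> * sqrt T) \<le> M * (e / (2 * M))"
    proof -
      have "normX T (d t) * (L * \<bar>q - r\<bar> * sqrt T) = normX T (d t) * (L * sqrt T) * \<bar>q - r\<bar>" by simp
      also have "\<dots> \<le> M * (e / (2 * M))"
        using q1 M by (intro mult_mono) (auto simp: M_def)
      finally show ?thesis .
    qed
    moreover have "e / (2 * N) * N + M * (e / (2 * M)) = e" using N M by (simp add: field_simps)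
    ultimately show "\<bar>pair' s q - pair' t r\<bar> \<le> e"
      using pair'_diff[OF s(1) t, of q r] by linarith
  qed
qed

text \<open>The increment from (t, r) to (s, q) is split at (t, q). The time part is (s - t) pair' t
  r up to a small error by the mean value inequality and joint continuity; the translation part is -
  (s - t) pair' t r up to a quadratic error. The main terms cancel.\<close>

lemma pair_transport_derivative:
  assumes t: "t \<in> {0..\<tau>}"
  shows "((\<lambda>t. pair t (\<tau> - t)) has_derivative (\<lambda>_. 0)) (at t within {0..\<tau>})"
  unfolding has_derivative_within_alt
proof (intro conjI allI impI)
  fix e :: real assume e: "e > 0"
  define r where "r = \<tau> - t"
  obtain \<delta> where \<delta>: "\<delta> > 0"
    "\<And>s q. s \<in> {0..\<tau>} \<Longrightarrow> \<bar>s - t\<bar> < \<delta> \<Longrightarrow> \<bar>q - r\<bar> < \<delta> \<Longrightarrow> \<bar>pair' s q - pair' t r\<bar> \<le> e / 2"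
    using pair'_near[OF t, of "e/2" r] e by auto
  \<comment> \<open>The quadratic error is at most C \<bar>s - t\<bar>^2, so \<bar>s - t\<bar> < e /
    (2 C) leaves at most e/2 times \<bar>s - t\<bar>.\<close>
  define C where "C = normX T (d t) * L * sqrt T + 1"
  have C: "C > 0" using normX_nonneg[of T "d t"] L_nonneg T by (auto simp: C_def intro!: add_nonneg_pos)
  show "\<exists>\<delta>>0. \<forall>s\<in>{0..\<tau>}. norm (s - t) < \<delta> \<longrightarrow>
      norm (pair s (\<tau> - s) - pair t (\<tau> - t) - 0) \<le> e * norm (s - t)"
  proof (intro exI[of _ "min \<delta> (e / (2 * C))"] conjI ballI impI)
    show "0 < min \<delta> (e / (2 * C))" using \<delta> e C by simp
    fix s assume s: "s \<in> {0..\<tau>}" and st: "norm (s - t) < min \<delta> (e / (2 * C))"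
    define q where "q = \<tau> - s"
    have q: "q \<ge> 0" "q - r = - (s - t)" "\<bar>q - r\<bar> = \<bar>s - t\<bar>" "\<bar>q - r\<bar> < \<delta>"
      using s st by (auto simp: q_def r_def)
    let ?S = "{0..\<tau>} \<inter> {t-\<delta><..<t+\<delta>}"
    have "norm ((pair s q - s * pair' t r) - (pair t q - t * pair' t r)) \<le> e / 2 * norm (s - t)"
    proof (rule field_differentiable_bound[where S = ?S])
      show "convex ?S" by (intro convex_Int) auto
      fix z assume z: "z \<in> ?S"
      have "((\<lambda>z. pair z q - z * pair' t r) has_real_derivative pair' z q - 1 * pair' t r) (at z within {0..\<tau>})"
      proof (rule DERIV_diff)
        show "((\<lambda>z. pair z q) has_real_derivative pair' z q) (at z within {0..\<tau>})"
          using z q by (intro pair_derivative) auto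
        show "((\<lambda>z. z * pair' t r) has_real_derivative 1 * pair' t r) (at z within {0..\<tau>})"
          by (auto intro!: derivative_eq_intros)
      qed
      then show "((\<lambda>z. pair z q - z * pair' t r) has_real_derivative pair' z q - pair' t r) (at z within ?S)"
        by (auto intro: DERIV_subset)
      show "norm (pair' z q - pair' t r) \<le> e / 2" using \<delta>(2)[of z q] z q by (auto simp: abs_less_iff)
    qed (use s t st \<delta> in \<open>auto simp: abs_less_iff\<close>)
    then have 1: "\<bar>pair s q - pair t q - (s - t) * pair' t r\<bar> \<le> e / 2 * \<bar>s - t\<bar>"
      by (simp add: algebra_simps)
    have "\<bar>pair t q - pair t r - (q - r) * pair' t r\<bar> \<le> normX T (d t) * (L * \<bar>q - r\<bar> * \<bar>q - r\<bar> * sqrt T)"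
      by (rule pair_remainder[OF t])
    also have "\<dots> = (normX T (d t) * L * sqrt T) * \<bar>s - t\<bar> * \<bar>s - t\<bar>" using q by (simp add: algebra_simps)
    also have "\<dots> \<le> C * (e / (2 * C)) * \<bar>s - t\<bar>"
      using st C normX_nonneg[of T "d t"] L_nonneg T
      by (intro mult_right_mono mult_mono) (auto simp: C_def)
    also have "\<dots> = e / 2 * \<bar>s - t\<bar>" using C by simp
    finally have "\<bar>pair t q - pair t r - (q - r) * pair' t r\<bar> \<le> e / 2 * \<bar>s - t\<bar>" .
    then have 2: "\<bar>pair t q - pair t r + (s - t) * pair' t r\<bar> \<le> e / 2 * \<bar>s - t\<bar>"
      unfolding q(2) by (simp only: minus_mult_left[symmetric] diff_minus_eq_add)
    have "\<bar>pair s q - pair t r\<bar> \<le> e * \<bar>s - t\<bar>" using 1 2 by argo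
    then show "norm (pair s (\<tau> - s) - pair t (\<tau> - t) - 0) \<le> e * norm (s - t)"
      by (simp add: q_def r_def)
  qed
qed simp

text \<open>At t = 0 the pairing is an integral over a single point, hence zero; constancy carries
  this value to t = \<tau>, where the test function is untranslated.\<close>

lemma pair_test_zero: "innerX T (d \<tau>) (p 0, p) = 0"
proof -
  have "pair \<tau> (\<tau> - \<tau>) = pair 0 (\<tau> - 0)"
    by (rule has_derivative_zero_unique[where s = "{0..\<tau>}"]) (use pair_transport_derivative \<tau> in auto)
  then show ?thesis using pair_eq_integral[of 0 \<tau>] \<tau> by (simp add: pair_def)
qed

end

section \<open>Recovering a state from its pairings\<close>

text \<open>Cauchy's formula for threefold repeated integration, with kernel (b - q)^2 / 2, obtained
  by two exchanges on triangles.\<close>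

lemma integral_triangle_twice:
  fixes f :: "real \<Rightarrow> real"
  assumes f: "f absolutely_integrable_on {a..b}"
  shows "integral {a..b} (\<lambda>q. f q * (b - q)\<^sup>2) = 2 * integral {a..b} (\<lambda>r. integral {a..r} (\<lambda>q. integral {a..q} f))"
proof -
  define E where "E r = integral {a..r} f" for r
  have E: "E absolutely_integrable_on {a..b}"
    unfolding E_def using f
    by (intro absolutely_integrable_continuous_real indefinite_integral_continuous_1)
      (auto simp: absolutely_integrable_on_def)
  have "integral {a..b} (\<lambda>q. f q * (b - q)\<^sup>2) = integral {a..b} (\<lambda>q. f q * integral {q..b} (\<lambda>r. 2 * (b - r)))"
  proof (rule integral_cong)
    fix q assume q: "q \<in> {a..b}"
    have "((\<lambda>r. 2 * (b - r)) has_integral - (b - b)\<^sup>2 - - (b - q)\<^sup>2) {q..b}"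
      using q by (intro fundamental_theorem_of_calculus)
        (auto intro!: derivative_eq_intros simp: has_real_derivative_iff_has_vector_derivative[symmetric])
    then show "f q * (b - q)\<^sup>2 = f q * integral {q..b} (\<lambda>r. 2 * (b - r))"
      by (subst integral_unique, assumption) simp
  qed
  also have "\<dots> = integral {a..b} (\<lambda>r. 2 * (b - r) * E r)"
    unfolding E_def by (intro integral_triangle_swap f absolutely_integrable_continuous_real continuous_intros)
  also have "\<dots> = integral {a..b} (\<lambda>r. 2 * (E r * integral {r..b} (\<lambda>_. 1)))"
    by (rule integral_cong) simp
  also have "\<dots> = 2 * integral {a..b} (\<lambda>r. E r * integral {r..b} (\<lambda>_. 1))" by simp
  also have "integral {a..b} (\<lambda>r. E r * integral {r..b} (\<lambda>_. 1)) = integral {a..b} (\<lambda>r. 1 * integral {a..r} E)"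
    by (intro integral_triangle_swap E absolutely_integrable_continuous_real continuous_intros)
  finally show ?thesis by (simp add: E_def[abs_def])
qed

text \<open>Differentiation of a vanishing primitive. Continuity gives the conclusion at every
  point, so that one level of a repeated integral can be stripped off.\<close>

lemma integral_eq_0_imp_eq_0:
  fixes g :: "real \<Rightarrow> real"
  assumes g: "continuous_on {a..b} g" and "a < b"
    and 0: "\<And>s. s \<in> {a..b} \<Longrightarrow> integral {a..s} g = 0" and s: "s \<in> {a..b}"
  shows "g s = 0"
proof -
  have "((\<lambda>s. integral {a..s} g) has_vector_derivative g s) (at s within {a..b})"
    by (rule integral_has_vector_derivative[OF g s])
  moreover have "((\<lambda>s. integral {a..s} g) has_vector_derivative 0) (at s within {a..b})"
    by (rule has_vector_derivative_transform[OF s _ has_vector_derivative_const]) (simp add: 0)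
  ultimately show ?thesis
    using vector_derivative_unique_within_closed_interval[of a b s] assms by auto
qed

text \<open>The square smooths the corner at q = s, where the difference quotient is bounded by
  \<bar>h\<bar>. The derivative is then Lipschitz, the regularity that the pairing argument asks
  for.\<close>

lemma DERIV_truncated_square:
  "((\<lambda>q. (max 0 (s - q))\<^sup>2) has_real_derivative - 2 * max 0 (s - q)) (at q)" for s q :: real
proof -
  consider "q < s" | "q = s" | "q > s" by linarith
  then show ?thesis
  proof cases
    case 1
    have "((\<lambda>q. (s - q)\<^sup>2) has_real_derivative - 2 * (s - q)) (at q)"
      by (auto intro!: derivative_eq_intros)
    then have "((\<lambda>q. (max 0 (s - q))\<^sup>2) has_real_derivative - 2 * (s - q)) (at q)"
      by (rule has_field_derivative_transform_within_open[where S = "{..<s}"]) (use 1 in auto)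
    then show ?thesis using 1 by simp
  next
    case 2
    have "((\<lambda>h. (max 0 (s - (s + h)))\<^sup>2 / h) \<longlongrightarrow> 0) (at 0)"
    proof (rule Lim_null_comparison)
      show "\<forall>\<^sub>F h in at 0. norm ((max 0 (s - (s + h)))\<^sup>2 / h) \<le> \<bar>h\<bar>"
        by (auto simp: eventually_at_filter max_def power2_eq_square abs_mult)
      show "((\<lambda>h. \<bar>h\<bar>) \<longlongrightarrow> 0) (at (0::real))" by (rule tendsto_rabs_zero) (rule tendsto_ident_at)
    qed
    then show ?thesis using 2 by (simp add: DERIV_def)
  next
    case 3
    have "((\<lambda>q. (max 0 (s - q))\<^sup>2) has_real_derivative 0) (at q)"
      by (rule has_field_derivative_transform_within_open[OF DERIV_const, where S = "{s<..}"]) (use 3 in auto)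
    then show ?thesis using 3 by simp
  qed
qed

text \<open>For s \<le> 0 the truncated square (max 0 (s - q))^2 vanishes at q \<ge> 0, so it is an
  allowed test function that ignores the scalar component; all these tests together say that the
  threefold primitive of \<open>f\<close> is zero, whence \<open>f\<close> is null. The constant
  test function then isolates the scalar component.\<close>

lemma homogeneous_solution_zero:
  assumes T: "T > 0" and \<tau>: "\<tau> > 0" and d: "continuousX T \<tau> d"
    and weak: "\<And>t \<psi>. t \<in> {0..\<tau>} \<Longrightarrow> \<psi> \<in> domA T \<Longrightarrow> innerX T (d t) \<psi> = integral {0..t} (\<lambda>s. adjA T (d s) \<psi>)"
  shows "eqX T (d \<tau>) (0, \<lambda>_. 0)"
proof -
  note z = pair_test_zero[OF T \<tau> d weak]
  have d\<tau>: "d \<tau> \<in> spaceX T" using d \<tau> by (auto intro: continuousX_spaceX)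
  define f where "f = snd (d \<tau>)"
  have f: "square_integrable_on f {-T..0}" using d\<tau> by (simp add: f_def spaceX_def)
  have sq: "square_integrable_on (\<lambda>q. (max 0 (s - q))\<^sup>2) {-T..0}" for s
    by (intro L2_continuous continuous_intros)
  have trunc: "integral {-T..0} (\<lambda>q. f q * (max 0 (s - q))\<^sup>2) = 0" if s: "s \<le> 0" for s
  proof -
    have "innerX T (d \<tau>) ((max 0 (s - 0))\<^sup>2, \<lambda>q. (max 0 (s - q))\<^sup>2) = 0"
    proof (rule z[where L = 2 and g = "\<lambda>q. - 2 * max 0 (s - q)"])
      show "\<bar>- 2 * max 0 (s - x) - - 2 * max 0 (s - y)\<bar> \<le> 2 * \<bar>x - y\<bar>" for x y
        by (auto simp: max_def abs_if)
      show "((\<lambda>q. (max 0 (s - q))\<^sup>2) has_real_derivative - 2 * max 0 (s - x)) (at x)" for x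
        by (rule DERIV_truncated_square)
    qed (use s in auto)
    moreover have "(max 0 (s - 0))\<^sup>2 = 0" using s by simp
    ultimately show ?thesis using innerX_eq[OF d\<tau>, of "(0, \<lambda>q. (max 0 (s - q))\<^sup>2)"] sq
      by (simp add: spaceX_def f_def)
  qed
  have fi: "f absolutely_integrable_on {-T..s}" if "s \<le> 0" for s
    by (rule absolutely_integrable_on_subinterval[OF L2_integrable(1)[OF f]]) (use that in auto)
  then have fi': "f integrable_on {-T..0}" by (auto simp: absolutely_integrable_on_def)
  define E where "E r = integral {-T..r} f" for r
  define E2 where "E2 r = integral {-T..r} E" for r
  have E: "continuous_on {-T..0} E" unfolding E_def by (rule indefinite_integral_continuous_1[OF fi'])
  have E2: "continuous_on {-T..0} E2"
    unfolding E2_def by (intro indefinite_integral_continuous_1 integrable_continuous_real E)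
  have "integral {-T..s} E2 = 0" if s: "s \<in> {-T..0}" for s
  proof -
    have "integral {-T..s} (\<lambda>q. f q * (s - q)\<^sup>2) = integral {-T..0} (\<lambda>q. f q * (max 0 (s - q))\<^sup>2)"
      (is "integral _ ?g = integral _ ?h")
    proof -
      have "integral {-T..s} ?h + integral {s..0} ?h = integral {-T..0} ?h"
        using s by (intro Henstock_Kurzweil_Integration.integral_combine L2_mult_integrable f sq) auto
      moreover have "integral {-T..s} ?h = integral {-T..s} ?g" by (rule integral_cong) simp
      moreover have "integral {s..0} ?h = integral {s..0} (\<lambda>_. 0)" by (rule integral_cong) simp
      ultimately show ?thesis by simp
    qed
    then show ?thesis
      using integral_triangle_twice[OF fi, of s] trunc[of s] s by (simp add: E_def[abs_def] E2_def[abs_def])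
  qed
  then have "E2 s = 0" if "s \<in> {-T..0}" for s
    using integral_eq_0_imp_eq_0[OF E2 _ _ that] T by simp
  then have "E s = 0" if "s \<in> {-T..0}" for s
    using integral_eq_0_imp_eq_0[OF E _ _ that] T by (simp add: E2_def[abs_def])
  then have N: "negligible {q \<in> {-T..0}. f q \<noteq> 0}"
    by (intro integral_eq_0_imp_negligible fi') (simp add: E_def)
  have "innerX T (d \<tau>) (1, \<lambda>q. 1) = 0"
    by (rule z[where L = 0 and g = "\<lambda>q. 0"]) auto
  moreover have "innerX T (d \<tau>) (1, \<lambda>q. 1) = fst (d \<tau>) + integral {-T..0} f"
    using innerX_eq[OF d\<tau>, of "(1, \<lambda>q. 1)"] by (simp add: spaceX_def f_def L2_continuous)
  moreover have "integral {-T..0} f = integral {-T..0} (\<lambda>_. 0)" by (rule integral_spike[OF N]) auto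
  ultimately have "fst (d \<tau>) = 0" by simp
  then show ?thesis using N by (simp add: eqX_def AE_lebesgue_on_iff_negligible f_def)
qed

text \<open>With the same control on both sides the B terms cancel and the difference solves the
  homogeneous equation. In \<open>closed_loop_unique\<close> the control is the feedback along a
  given solution, so no estimate on the feedback is involved.\<close>

lemma state_solution_unique:
  assumes T: "T > 0" and u: "continuous_on {0..} u"
    and y: "state_solution T u x y" and y': "state_solution T u x y'" and t: "t \<ge> 0"
  shows "eqX T (y t) (y' t)"
proof (cases "t = 0")
  case True
  then show ?thesis using y y' eqX_trans eqX_sym unfolding state_solution_def by blast
next
  case False
  then have t: "t > 0" using t by simp
  note yD = y[unfolded state_solution_iff[OF T u]] and yD' = y'[unfolded state_solution_iff[OF T u]]
  have c: "continuousX T t y" "continuousX T t y'" using yD yD' t by auto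
  have sp: "y s \<in> spaceX T" "y' s \<in> spaceX T" if "s \<in> {0..t}" for s
    using c that by (auto intro: continuousX_spaceX)
  define d where "d s = addX (y s) (scaleX (-1) (y' s))" for s
  have "eqX T (d t) (0, \<lambda>_. 0)"
  proof (rule homogeneous_solution_zero[OF T t])
    show "continuousX T t d"
      unfolding continuousX_def
    proof (intro ballI conjI)
      fix s assume s: "s \<in> {0..t}"
      show "d s \<in> spaceX T" unfolding d_def by (intro addX_spaceX scaleX_spaceX sp s)
      have l: "((\<lambda>r. distX T (y r) (y s) + distX T (y' r) (y' s)) \<longlongrightarrow> 0) (at s within {0..t})"
      proof -
        have "((\<lambda>r. distX T (y r) (y s)) \<longlongrightarrow> 0) (at s within {0..t})"
          "((\<lambda>r. distX T (y' r) (y' s)) \<longlongrightarrow> 0) (at s within {0..t})"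
          using c s by (simp_all add: continuousX_def)
        from tendsto_add[OF this] show ?thesis by simp
      qed
      show "((\<lambda>r. distX T (d r) (d s)) \<longlongrightarrow> 0) (at s within {0..t})"
      proof (rule Lim_null_comparison[OF _ l], rule eventually_at_topological[THEN iffD2],
          intro exI[of _ UNIV] conjI ballI impI)
        fix r assume r: "r \<in> {0..t}"
        have "addX (d r) (scaleX (-1) (d s)) =
            addX (addX (y r) (scaleX (-1) (y s))) (scaleX (-1) (addX (y' r) (scaleX (-1) (y' s))))"
          by (auto simp: d_def addX_def scaleX_def)
        then have "distX T (d r) (d s) \<le> distX T (y r) (y s) + normX T (scaleX (-1) (addX (y' r) (scaleX (-1) (y' s))))"
          using r s unfolding distX_def by (auto intro!: normX_addX addX_spaceX scaleX_spaceX sp)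
        then show "norm (distX T (d r) (d s)) \<le> distX T (y r) (y s) + distX T (y' r) (y' s)"
          using r s normX_nonneg[of T] by (simp add: normX_scaleX addX_spaceX scaleX_spaceX sp distX_def)
      qed auto
    qed
  next
    fix s \<psi> assume s: "s \<in> {0..t}" and \<psi>: "\<psi> \<in> domA T"
    have 0: "innerX T (y 0) \<psi> = innerX T (y' 0) \<psi>"
    proof (rule innerX_cong)
      show "eqX T (y 0) (y' 0)" using yD yD' eqX_trans eqX_sym by blast
    qed (use sp t domA_spaceX[OF \<psi>] in auto)
    have e: "innerX T (y s) \<psi> = innerX T (y 0) \<psi> + integral {0..s} (\<lambda>r. rhs T (y r) (u r) \<psi>)"
      "innerX T (y' s) \<psi> = innerX T (y' 0) \<psi> + integral {0..s} (\<lambda>r. rhs T (y' r) (u r) \<psi>)"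
      using yD yD' s \<psi> by (meson atLeastAtMost_iff)+
    have i: "(\<lambda>r. rhs T (y r) (u r) \<psi>) integrable_on {0..s}" "(\<lambda>r. rhs T (y' r) (u r) \<psi>) integrable_on {0..s}"
      by (rule integrable_on_subinterval[OF integrable_continuous_real[OF continuous_on_rhs[OF c(1) continuous_on_subset[OF u] \<psi>]]]
         integrable_on_subinterval[OF integrable_continuous_real[OF continuous_on_rhs[OF c(2) continuous_on_subset[OF u] \<psi>]]],
        use s in auto)+
    have "innerX T (d s) \<psi> = integral {0..s} (\<lambda>r. rhs T (y r) (u r) \<psi>) - integral {0..s} (\<lambda>r. rhs T (y' r) (u r) \<psi>)"
      using e 0 s \<psi> by (simp add: d_def innerX_diff_left sp domA_spaceX)
    also have "\<dots> = integral {0..s} (\<lambda>r. adjA T (d r) \<psi>)"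
    proof (subst integral_diff[OF i, symmetric], rule integral_cong)
      fix r assume "r \<in> {0..s}"
      then show "rhs T (y r) (u r) \<psi> - rhs T (y' r) (u r) \<psi> = adjA T (d r) \<psi>"
        using s by (simp add: rhs_def adjA_def d_def innerX_diff_left sp opA_spaceX \<psi>)
    qed
    finally show "innerX T (d s) \<psi> = integral {0..s} (\<lambda>r. adjA T (d r) \<psi>)" .
  qed
  then have "fst (y t) = fst (y' t)" "AE s in lebesgue_on {-T..0}. snd (y t) s - snd (y' t) s = 0"
    by (auto simp: eqX_def d_def addX_def scaleX_def)
  then show ?thesis by (simp add: eqX_def)
qed

section \<open>Scalar equations\<close>

text \<open>\<open>f\<close> vanishes at 0 with slope A T - 1 > 0 and is negative from
  \<open>A\<close> on, so a positive root exists. Two positive roots besides the root 0 would give,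
  by the mean value theorem, two points with equal derivative, while f' is strictly
  decreasing.\<close>

lemma xi_root:
  assumes A: "A > 0" and T: "T > 0" and AT: "A * T > 1"
  shows "xi A T > 0" "xi A T = A * (1 - exp (- xi A T * T))"
proof -
  define f where "f z = A * (1 - exp (- z * T)) - z" for z
  have f': "(f has_real_derivative A * T * exp (- z * T) - 1) (at z)" for z
    unfolding f_def by (auto intro!: derivative_eq_intros)
  have cont: "isCont f z" for z using f' DERIV_isCont by blast
  have "\<exists>e>0. f e > 0"
  proof -
    obtain d where "d > 0" "\<And>h. 0 < h \<Longrightarrow> h < d \<Longrightarrow> f 0 < f (0 + h)"
      using DERIV_pos_inc_right[OF f'[of 0]] AT by auto
    from this(2)[of "d/2"] this(1) show ?thesis by (intro exI[of _ "d/2"]) (auto simp: f_def)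
  qed
  then obtain e where e: "e > 0" "f e > 0" by blast
  have fA: "f z < 0" if "z \<ge> A" for z
    using mult_strict_left_mono[OF _ A, of "1 - exp (- z * T)" 1] that by (auto simp: f_def)
  then have "e < A" using e(2) by (meson less_le_not_le linorder_le_less_linear order.asym)
  then have "\<exists>z. e \<le> z \<and> z \<le> A \<and> f z = 0"
    using e fA[of A] by (intro IVT2) (auto simp: cont)
  then obtain z where "e \<le> z" and z0: "f z = 0" by blast
  then have z: "z > 0" "f z = 0" using e by auto
  have uniq: "z1 = z2" if "z1 > 0" "f z1 = 0" "z2 > 0" "f z2 = 0" for z1 z2
  proof -
    have *: False if "0 < z1" "z1 < z2" "f z1 = 0" "f z2 = 0" for z1 z2
    proof -
      obtain c1 where c1: "0 < c1" "c1 < z1" "f z1 - f 0 = (z1 - 0) * (A * T * exp (- c1 * T) - 1)"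
        using MVT2[of 0 z1 f "\<lambda>z. A * T * exp (- z * T) - 1"] f' \<open>0 < z1\<close> by blast
      obtain c2 where c2: "z1 < c2" "c2 < z2" "f z2 - f z1 = (z2 - z1) * (A * T * exp (- c2 * T) - 1)"
        using MVT2[of z1 z2 f "\<lambda>z. A * T * exp (- z * T) - 1"] f' \<open>z1 < z2\<close> by blast
      have "A * T * exp (- c1 * T) = A * T * exp (- c2 * T)"
        using c1 c2 that by (auto simp: f_def)
      then show False using A T c1 c2 by auto
    qed
    show ?thesis using *[of z1 z2] *[of z2 z1] that by (meson linorder_neqE_linordered_idom)
  qed
  have "xi A T > 0 \<and> xi A T = A * (1 - exp (- xi A T * T))"
    unfolding xi_def
  proof (rule theI[where P = "\<lambda>z. z > 0 \<and> z = A * (1 - exp (- z * T))"])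
    show "z > 0 \<and> z = A * (1 - exp (- z * T))" using z by (simp add: f_def)
    fix y assume y: "y > 0 \<and> y = A * (1 - exp (- y * T))"
    then have "f y = 0" unfolding f_def by linarith
    then show "y = z" using uniq y z by blast
  qed
  then show "xi A T > 0" "xi A T = A * (1 - exp (- xi A T * T))" by auto
qed

lemma has_integral_exp:
  fixes c :: real
  assumes "a \<le> b"
  shows "((\<lambda>s. c * exp (c * s)) has_integral exp (c * b) - exp (c * a)) {a..b}"
  using assms by (intro fundamental_theorem_of_calculus)
    (auto intro!: derivative_eq_intros simp: has_real_derivative_iff_has_vector_derivative[symmetric])

lemma integral_exp_le:
  fixes c :: real
  assumes c: "c > 0"
  shows "integral {a..b} (\<lambda>s. exp (c * s)) \<le> exp (c * b) / c"
proof (cases "a \<le> b")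
  case True
  have "c * integral {a..b} (\<lambda>s. exp (c * s)) = exp (c * b) - exp (c * a)"
    using integral_unique[OF has_integral_exp[OF True, of c]] by simp
  then show ?thesis using c by (simp add: pos_le_divide_eq mult.commute)
qed (use c in simp)

text \<open>Since \<open>h\<close> is only integrable, the product rule is replaced by an exchange of integrals.\<close>

lemma integrating_factor:
  fixes f h :: "real \<Rightarrow> real"
  assumes f: "continuous_on {0..t} f" and h: "h absolutely_integrable_on {0..t}" and t: "t \<ge> 0"
    and eq: "\<And>s. s \<in> {0..t} \<Longrightarrow> f s = f0 + integral {0..s} (\<lambda>r. c * f r - h r)"
  shows "exp (- c * t) * f t = f0 - integral {0..t} (\<lambda>s. exp (- c * s) * h s)"
proof -
  define H where "H s = integral {0..s} h" for s
  have hi: "h integrable_on {0..t}" using h by (simp add: absolutely_integrable_on_def)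
  have H: "continuous_on {0..t} H" unfolding H_def by (rule indefinite_integral_continuous_1[OF hi])
  \<comment> \<open>\<open>q\<close> is the differentiable part of \<open>f\<close>: q = f + H and
    q' = c f, so exp (- c s) q has derivative - c exp (- c s) H. The exchange below then passes from
    \<open>H\<close> back to \<open>h\<close>.\<close>
  define q where "q s = f0 + integral {0..s} (\<lambda>r. c * f r)" for s
  have qe: "q s = f s + H s" if "s \<in> {0..t}" for s
  proof -
    have "(\<lambda>r. c * f r) integrable_on {0..s}" "h integrable_on {0..s}"
      by (intro integrable_continuous_real continuous_intros continuous_on_subset[OF f]
          integrable_on_subinterval[OF hi], use that in auto)+
    then show ?thesis using eq[OF that] by (simp add: q_def H_def integral_diff)
  qed
  have q': "(q has_real_derivative c * f s) (at s within {0..t})" if "s \<in> {0..t}" for s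
  proof -
    have "((\<lambda>s. integral {0..s} (\<lambda>r. c * f r)) has_real_derivative c * f s) (at s within {0..t})"
      by (rule integral_has_real_derivative) (use that f in \<open>auto intro!: continuous_intros\<close>)
    from DERIV_add[OF DERIV_const this, of f0] show ?thesis unfolding q_def by simp
  qed
  have "((\<lambda>s. - c * exp (- c * s) * H s) has_integral exp (- c * t) * q t - exp (- c * 0) * q 0) {0..t}"
  proof (rule fundamental_theorem_of_calculus[OF t])
    fix s assume s: "s \<in> {0..t}"
    have "((\<lambda>s. exp (- c * s) * q s) has_real_derivative - c * exp (- c * s) * H s) (at s within {0..t})"
      by (rule derivative_eq_intros q'[OF s] refl)+ (simp add: qe[OF s] algebra_simps)
    then show "((\<lambda>s. exp (- c * s) * q s) has_vector_derivative - c * exp (- c * s) * H s) (at s within {0..t})"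
      by (simp add: has_real_derivative_iff_has_vector_derivative)
  qed
  then have 1: "integral {0..t} (\<lambda>s. (- c * exp (- c * s)) * H s) = exp (- c * t) * q t - f0"
    by (subst integral_unique, assumption) (simp add: q_def)
  have "integral {0..t} (\<lambda>s. h s * integral {s..t} (\<lambda>r. - c * exp (- c * r)))
      = integral {0..t} (\<lambda>r. (- c * exp (- c * r)) * H r)"
    unfolding H_def by (intro integral_triangle_swap h absolutely_integrable_continuous_real continuous_intros)
  also have "integral {0..t} (\<lambda>s. h s * integral {s..t} (\<lambda>r. - c * exp (- c * r)))
      = integral {0..t} (\<lambda>s. exp (- c * t) * h s - exp (- c * s) * h s)"
  proof (rule integral_cong)
    fix s assume s: "s \<in> {0..t}"
    have "((\<lambda>r. - c * exp (- c * r)) has_integral exp (- c * t) - exp (- c * s)) {s..t}"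
      by (rule has_integral_exp) (use s in auto)
    then show "h s * integral {s..t} (\<lambda>r. - c * exp (- c * r)) = exp (- c * t) * h s - exp (- c * s) * h s"
      by (subst integral_unique, assumption) (simp add: algebra_simps)
  qed
  also have "\<dots> = exp (- c * t) * H t - integral {0..t} (\<lambda>s. exp (- c * s) * h s)"
  proof (subst integral_diff)
    have "(\<lambda>s. exp (- c * s) * h s) absolutely_integrable_on {0..t}"
      by (rule absolutely_integrable_bounded_measurable_product_real[OF _ _ _ h])
        (auto intro!: continuous_imp_measurable_on_sets_lebesgue compact_imp_bounded compact_continuous_image
           continuous_intros)
    then show "(\<lambda>s. exp (- c * s) * h s) integrable_on {0..t}" by (simp add: absolutely_integrable_on_def)
  qed (auto simp: H_def hi intro: integrable_on_mult_right)
  finally show ?thesis using 1 qe[of t] t by (simp add: algebra_simps)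
qed

text \<open>At a maximum of exp (- 2 A s) \<bar>d s\<bar> the integral term reproduces at most half
  of the maximum, because integrating exp (2 A r) up to s gives at most exp (2 A s) / (2 A). Hence
  the maximum is zero.\<close>

lemma delay_Volterra_unique:
  fixes u w :: "real \<Rightarrow> real"
  assumes A: "A > 0" and u: "continuous_on {0..} u" and w: "continuous_on {0..} w"
    and ue: "\<And>t. t \<ge> 0 \<Longrightarrow> u t = h t + A * integral {max 0 (t - T)..t} u"
    and we: "\<And>t. t \<ge> 0 \<Longrightarrow> w t = h t + A * integral {max 0 (t - T)..t} w"
    and t: "t \<ge> 0"
  shows "u t = w t"
proof -
  define d where "d s = u s - w s" for s
  define m where "m s = exp (- (2 * A) * s) * \<bar>d s\<bar>" for s
  have d: "continuous_on {0..t} d" and m: "continuous_on {0..t} m"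
    unfolding m_def d_def by (auto intro!: continuous_intros continuous_on_subset[OF u] continuous_on_subset[OF w])
  obtain s where s: "s \<in> {0..t}" and max: "\<And>r. r \<in> {0..t} \<Longrightarrow> m r \<le> m s"
    using continuous_attains_sup[OF _ _ m] t by auto
  have i: "f integrable_on {max 0 (s - T)..s}" if "continuous_on {0..} f" for f :: "real \<Rightarrow> real"
    using s that by (intro integrable_continuous_real) (auto intro: continuous_on_subset)
  have "d s = A * integral {max 0 (s - T)..s} d"
    using ue[of s] we[of s] s i[OF u] i[OF w] unfolding d_def by (simp add: integral_diff algebra_simps)
  moreover have "norm (integral {max 0 (s - T)..s} d) \<le> integral {max 0 (s - T)..s} (\<lambda>r. m s * exp (2 * A * r))"
  proof (rule integral_norm_bound_integral)
    show "d integrable_on {max 0 (s - T)..s}"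
      using i[OF u] i[OF w] unfolding d_def by (rule integrable_diff)
    fix r assume "r \<in> {max 0 (s - T)..s}"
    then have "m r * exp (2 * A * r) \<le> m s * exp (2 * A * r)" using s by (intro mult_right_mono max) auto
    moreover have "m r * exp (2 * A * r) = \<bar>d r\<bar>"
      by (simp add: m_def mult.commute mult.left_commute flip: exp_add)
    ultimately show "norm (d r) \<le> m s * exp (2 * A * r)" by simp
  qed (auto intro!: integrable_continuous_real continuous_intros)
  moreover have "integral {max 0 (s - T)..s} (\<lambda>r. m s * exp (2 * A * r)) \<le> m s * (exp (2 * A * s) / (2 * A))"
  proof -
    have "m s * integral {max 0 (s - T)..s} (\<lambda>r. exp (2 * A * r)) \<le> m s * (exp (2 * A * s) / (2 * A))"
      using A by (intro mult_left_mono integral_exp_le) (auto simp: m_def)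
    then show ?thesis by simp
  qed
  ultimately have "\<bar>d s\<bar> \<le> A * (m s * (exp (2 * A * s) / (2 * A)))"
    using A mult_left_mono[of "\<bar>integral {max 0 (s - T)..s} d\<bar>" "m s * (exp (2 * A * s) / (2 * A))" A]
    by (simp only: real_norm_def abs_mult abs_of_pos)
  also have "\<dots> = \<bar>d s\<bar> / 2" using A by (simp add: m_def exp_minus field_simps)
  finally have "m s = 0" by (simp add: m_def)
  moreover have "m t \<ge> 0" by (simp add: m_def)
  ultimately have "m t = 0" using max[of t] t by simp
  then show ?thesis by (simp add: m_def d_def)
qed

lemma continuous_on_delay_integral:
  fixes f :: "real \<Rightarrow> real"
  assumes "continuous_on {0..} f" and T: "T > 0"
  shows "continuous_on {0..} (\<lambda>t. integral {max 0 (t - T)..t} f)"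
proof (rule continuous_on_atLeastI)
  fix b :: real
  have i: "f integrable_on {0..c}" for c
    by (intro integrable_continuous_real continuous_on_subset[OF assms(1)]) auto
  have c: "continuous_on {0..b} (\<lambda>t. integral {0..t} f)"
    by (rule indefinite_integral_continuous_1[OF i])
  have "continuous_on {0..b} (\<lambda>t. integral {0..t} f - integral {0..max 0 (t - T)} f)"
    using T by (intro continuous_intros c continuous_on_compose2[OF c]) auto
  then show "continuous_on {0..b} (\<lambda>t. integral {max 0 (t - T)..t} f)"
  proof (rule continuous_on_cong[THEN iffD1, rotated 2])
    fix t assume t: "t \<in> {0..b}"
    have "integral {0..max 0 (t - T)} f + integral {max 0 (t - T)..t} f = integral {0..t} f"
      using t T by (intro Henstock_Kurzweil_Integration.integral_combine i) auto
    then show "integral {0..t} f - integral {0..max 0 (t - T)} f = integral {max 0 (t - T)..t} f" by simp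
  qed simp
qed

text \<open>Banach's fixed point theorem for \<open>w t = exp (- b t) * u t\<close>; the weight makes the Volterra operator
  a contraction on bounded continuous functions, which are extended to the negative axis by a constant.\<close>

lemma delay_Volterra_exists:
  fixes h :: "real \<Rightarrow> real"
  assumes A: "A > 0" and T: "T > 0" and h: "continuous_on {0..} h"
    and b: "b \<ge> 2 * A" and hb: "\<And>t. t \<ge> 0 \<Longrightarrow> \<bar>h t\<bar> \<le> C * exp (b * t)"
  obtains u where "continuous_on {0..} u"
    "\<And>t. t \<ge> 0 \<Longrightarrow> u t = h t + A * integral {max 0 (t - T)..t} u"
proof -
  have b0: "b > 0" using b A by linarith
  define E where "E w t = integral {max 0 (t - T)..t} (\<lambda>s. exp (b * s) * w s)" for w t
  have cE: "continuous_on {0..} (E w)" if "continuous_on UNIV w" for w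
    unfolding E_def using T
    by (intro continuous_on_delay_integral continuous_intros continuous_on_subset[OF that]) auto
  have iE: "(\<lambda>s. exp (b * s) * w s) integrable_on {p..q}" if "continuous_on UNIV w" for w p q
    by (intro integrable_continuous_real continuous_intros continuous_on_subset[OF that]) auto
  have bE: "\<bar>E w t\<bar> \<le> M * (exp (b * t) / b)"
    if w: "continuous_on UNIV w" and M: "\<And>s. \<bar>w s\<bar> \<le> M" and t: "t \<ge> 0" for w M t
  proof -
    have M0: "M \<ge> 0" using M[of 0] by linarith
    have "norm (E w t) \<le> integral {max 0 (t - T)..t} (\<lambda>s. M * exp (b * s))"
      unfolding E_def
    proof (rule integral_norm_bound_integral)
      show "norm (exp (b * s) * w s) \<le> M * exp (b * s)" for s
        using M[of s] by (simp add: abs_mult mult.commute)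
    qed (auto intro!: integrable_continuous_real continuous_intros continuous_on_subset[OF w])
    also have "\<dots> \<le> M * (exp (b * t) / b)"
      using mult_left_mono[OF integral_exp_le[OF b0] M0] by simp
    finally show ?thesis by simp
  qed
  define G where "G w t = exp (- b * max 0 t) * (h (max 0 t) + A * E w (max 0 t))" for w t
  define P where "P w = Bcontfun (G (apply_bcontfun w))" for w
  have G: "G (apply_bcontfun w) \<in> bcontfun" for w :: "real \<Rightarrow>\<^sub>C real"
  proof (rule bcontfun_normI)
    have w: "continuous_on UNIV (apply_bcontfun w)" by simp
    show "continuous_on UNIV (G (apply_bcontfun w))"
      unfolding G_def
      by (intro continuous_intros continuous_on_compose2[OF h] continuous_on_compose2[OF cE[OF w]]) auto
    fix t :: real
    define t' where "t' = max 0 t"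
    have t': "t' \<ge> 0" by (simp add: t'_def)
    have "\<bar>h t' + A * E w t'\<bar> \<le> C * exp (b * t') + A * (norm w * (exp (b * t') / b))"
    proof -
      have "\<bar>A * E w t'\<bar> \<le> A * (norm w * (exp (b * t') / b))"
        using mult_left_mono[OF bE[OF w _ t', of "norm w"], of A] A norm_bounded[of w]
        by (simp only: abs_mult abs_of_pos real_norm_def less_imp_le)
      then show ?thesis using hb[OF t'] by linarith
    qed
    then have "exp (- b * t') * \<bar>h t' + A * E w t'\<bar> \<le> exp (- b * t') * (C * exp (b * t') + A * (norm w * (exp (b * t') / b)))"
      by (intro mult_left_mono) auto
    also have "\<dots> = C + A * norm w / b" using b0 by (simp add: exp_minus field_simps)
    finally show "norm (G (apply_bcontfun w) t) \<le> C + A * norm w / b"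
      by (simp add: G_def t'_def abs_mult)
  qed
  then have PG: "apply_bcontfun (P w) t = G (apply_bcontfun w) t" for w t
    by (simp add: P_def Bcontfun_inverse)
  have "\<exists>!w. P w = w"
  proof (rule banach_fix_type[of "1/2"])
    \<comment> \<open>The factor is A / b, at most 1/2 as b \<ge> 2 A. The same weight also absorbs
      the growth of \<open>h\<close>, so that the operator preserves boundedness.\<close>
    show "\<forall>v w. dist (P v) (P w) \<le> 1/2 * dist v w"
    proof (intro allI dist_bound)
      fix v w :: "real \<Rightarrow>\<^sub>C real" and t :: real
      define t' where "t' = max 0 t"
      have t': "t' \<ge> 0" by (simp add: t'_def)
      have c: "continuous_on UNIV (apply_bcontfun v)" "continuous_on UNIV (apply_bcontfun w)" by simp_all
      have "E v t' - E w t' = E (\<lambda>s. v s - w s) t'"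
        unfolding E_def by (subst integral_diff[symmetric, OF iE iE]) (simp_all add: algebra_simps)
      moreover have "\<bar>E (\<lambda>s. v s - w s) t'\<bar> \<le> dist v w * (exp (b * t') / b)"
        using dist_fun_lt_imp_dist_val_lt dist_bounded[of v _ w]
        by (intro bE[OF _ _ t']) (auto intro!: continuous_intros simp: dist_real_def)
      ultimately have "exp (- b * t') * (A * \<bar>E v t' - E w t'\<bar>) \<le> exp (- b * t') * (A * (dist v w * (exp (b * t') / b)))"
        using A by (intro mult_left_mono) auto
      also have "\<dots> = A / b * dist v w" using b0 by (simp add: exp_minus field_simps)
      also have "\<dots> \<le> 1/2 * dist v w" using b b0 by (intro mult_right_mono) (auto simp: field_simps)
      finally have "exp (- b * t') * (A * \<bar>E v t' - E w t'\<bar>) \<le> 1/2 * dist v w" .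
      moreover have "G v t - G w t = exp (- b * t') * (A * (E v t' - E w t'))"
        by (simp add: G_def t'_def algebra_simps)
      ultimately show "dist (apply_bcontfun (P v) t) (apply_bcontfun (P w) t) \<le> 1/2 * dist v w"
        using A by (simp add: PG dist_real_def abs_mult)
    qed
  qed auto
  then obtain w where w: "P w = w" by blast
  define u where "u t = exp (b * t) * w t" for t
  show ?thesis
  proof (rule that[of u])
    show "continuous_on {0..} u" unfolding u_def by (intro continuous_intros continuous_on_apply_bcontfun)
    fix t :: real assume t: "t \<ge> 0"
    have "w t = exp (- b * t) * (h t + A * E w t)"
      using PG[of w t] t w by (simp add: G_def)
    then show "u t = h t + A * integral {max 0 (t - T)..t} u"
      by (simp add: u_def[abs_def] E_def exp_minus field_simps)
  qed
qed

section \<open>The functional \<open>\<Gamma>\<^sub>0\<close> along trajectories\<close>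

text \<open>The value 0 before -T makes the joined history square integrable on every bounded
  interval, as the results on \<open>hist\<close> assume.\<close>

definition ext :: "real \<Rightarrow> (real \<Rightarrow> real) \<Rightarrow> (real \<Rightarrow> real) \<Rightarrow> real \<Rightarrow> real" where
  "ext T \<iota> u s = (if s < - T then 0 else glue \<iota> u s)"

lemma ext_square_integrable:
  assumes T: "T > 0" and \<iota>: "square_integrable_on \<iota> {-T..0}"
    and u: "\<And>\<tau>. \<tau> > 0 \<Longrightarrow> square_integrable_on u {0..\<tau>}"
  shows "square_integrable_on (ext T \<iota> u) {a..b}"
proof -
  define m where "m = max 1 (max \<bar>a\<bar> \<bar>b\<bar>) + T"
  have m: "m > T" "m > 0" "-m \<le> a" "b \<le> m" using T by (auto simp: m_def)
  have 1: "square_integrable_on (ext T \<iota> u) {-m..-T}"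
    by (rule L2_spike[of "\<lambda>_. 0" _ _ "{-T}"])
      (auto simp: ext_def intro: L2_continuous)
  have 2: "square_integrable_on (ext T \<iota> u) {-T..0}"
    by (rule L2_spike[OF \<iota>, of "{0}"]) (auto simp: ext_def glue_def)
  have 3: "square_integrable_on (ext T \<iota> u) {0..m}"
    by (rule L2_spike[OF u[OF m(2)], of "{}"]) (use T in \<open>auto simp: ext_def glue_def\<close>)
  have "square_integrable_on (ext T \<iota> u) {-m..0}"
    by (rule L2_combine[OF 1 2]) (use m T in auto)
  then have "square_integrable_on (ext T \<iota> u) {-m..m}"
    by (rule L2_combine[OF _ 3]) (use m T in auto)
  then show ?thesis by (rule L2_subinterval) (use m in auto)
qed

lemma initial_capital_eq:
  assumes "square_integrable_on \<iota> {-T..0}"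
  shows "initial_capital T \<iota> = integral {-T..0} \<iota>"
  unfolding initial_capital_def
  by (intro LINT_lebesgue_on_eq_integral L2_integrable(1) assms)

lemma integral_ext_history: "integral {-T..0} (ext T \<iota> u) = integral {-T..0} \<iota>"
  by (rule integral_spike[of "{0}"]) (auto simp: ext_def glue_def)

text \<open>The integrals telescope: those over \<open>{-T..0}\<close> and \<open>{0..t}\<close>
  minus that over \<open>{-T..t-T}\<close> leave the window \<open>{t-T..t}\<close>.\<close>

lemma capital_eq_hist:
  assumes T: "T > 0" and \<iota>: "square_integrable_on \<iota> {-T..0}"
    and u: "\<And>\<tau>. \<tau> > 0 \<Longrightarrow> square_integrable_on u {0..\<tau>}" and t: "t \<ge> 0"
  shows "capital T \<iota> u t = fst (hist T (ext T \<iota> u) t)"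
proof -
  let ?I = "ext T \<iota> u"
  note I = ext_square_integrable[OF T \<iota> u]
  have Ish: "square_integrable_on (\<lambda>s. ?I (s + - T)) {0..t}"
    unfolding L2_shift by (rule I)
  have "(LINT s|lebesgue_on {0..t}. glue \<iota> u s - glue \<iota> u (s - T)) = (LINT s|lebesgue_on {0..t}. ?I s - ?I (s + - T))"
    using T by (intro Bochner_Integration.integral_cong) (auto simp: ext_def)
  also have "\<dots> = integral {0..t} (\<lambda>s. ?I s - ?I (s + - T))"
    by (intro LINT_lebesgue_on_eq_integral L2_integrable(1) L2_diff I Ish)
  also have "\<dots> = integral {0..t} ?I - integral {0..t} (\<lambda>s. ?I (s + - T))"
    by (intro integral_diff L2_integrable(2)[OF I] L2_integrable(2)[OF Ish])
  also have "integral {0..t} (\<lambda>s. ?I (s + - T)) = integral {-T..t-T} ?I"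
    using integral_shift_real_ivl[of "-T" "-T" "t-T" ?I] by simp
  finally have "capital T \<iota> u t = integral {-T..0} ?I + integral {0..t} ?I - integral {-T..t-T} ?I"
    by (simp add: capital_def initial_capital_eq[OF \<iota>] integral_ext_history)
  then show ?thesis
    using t T by (simp add: hist_def integral_eq_primitive[OF T I])
qed

section \<open>The exponential test function\<close>

lemma exp_spaceX: "(c, \<lambda>s. b * exp (xi A T * s)) \<in> spaceX T"
  unfolding spaceX_def by (auto intro!: L2_continuous continuous_intros)

lemma exp_domA: "(1, \<lambda>s. exp (xi A T * s)) \<in> domA T"
  and exp_derivative: "has_L2_derivative T (\<lambda>s. exp (xi A T * s)) (\<lambda>s. xi A T * exp (xi A T * s))"
proof -
  show d: "has_L2_derivative T (\<lambda>s. exp (xi A T * s)) (\<lambda>s. xi A T * exp (xi A T * s))"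
  proof (rule has_L2_derivativeI)
    show "square_integrable_on (\<lambda>s. xi A T * exp (xi A T * s)) {-T..0}"
      using exp_spaceX[of 0 "xi A T"] by (simp add: spaceX_def)
    fix s assume s: "s \<in> {-T..0}"
    have "((\<lambda>s. xi A T * exp (xi A T * s)) has_integral exp (xi A T * s) - exp (xi A T * (-T))) {-T..s}"
      by (rule has_integral_exp) (use s in auto)
    then show "exp (xi A T * s) = exp (xi A T * (-T)) + integral {-T..s} (\<lambda>s. xi A T * exp (xi A T * s))"
      by (subst integral_unique, assumption) simp
  qed
  then show "(1, \<lambda>s. exp (xi A T * s)) \<in> domA T" by (auto simp: domA_def W12_def)
qed

lemma Gamma0_eq_innerX: "Gamma0 A T x = innerX T x (1, \<lambda>s. exp (xi A T * s))"
  by (simp add: Gamma0_def innerX_def mult.commute)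

context
  fixes A T :: real and I :: "real \<Rightarrow> real"
  assumes A: "A > 0" and T: "T > 0" and AT: "A * T > 1"
    and I: "\<And>a b. square_integrable_on I {a..b}"
begin

lemma Gamma0_hist_continuous_on: "continuous_on {0..} (\<lambda>t. Gamma0 A T (hist T I t))"
  unfolding Gamma0_eq_innerX
  by (intro continuous_on_atLeastI continuous_on_innerX hist_continuousX T I domA_spaceX exp_domA)

lemma Gamma0_hist_integral_equation:
  assumes t: "t \<ge> 0"
  shows "Gamma0 A T (hist T I t) = Gamma0 A T (hist T I 0) + integral {0..t}
    (\<lambda>s. xi A T * Gamma0 A T (hist T I s) - xi A T / A * (A * fst (hist T I s) - I s))"
proof -
  have B: "opB T (1, \<lambda>s. exp (xi A T * s)) = xi A T / A"
    using xi_root[OF A T AT] A by (simp add: opB_def field_simps)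
  have "rhs T (hist T I s) (I s) (1, \<lambda>s. exp (xi A T * s))
      = xi A T * Gamma0 A T (hist T I s) - xi A T / A * (A * fst (hist T I s) - I s)" for s
  proof -
    have "adjA T (hist T I s) (1, \<lambda>s. exp (xi A T * s)) = innerX T (hist T I s) (0, \<lambda>s. xi A T * exp (xi A T * s))"
      by (intro adjA_eq hist_spaceX T I exp_domA) (simp add: exp_derivative)
    also have "(0, \<lambda>s. xi A T * exp (xi A T * s)) = scaleX (xi A T) (addX (1, \<lambda>s. exp (xi A T * s)) (scaleX (-1) (1, \<lambda>_. 0)))"
      by (simp add: scaleX_def addX_def)
    also have "innerX T (hist T I s) \<dots> = xi A T * (Gamma0 A T (hist T I s) - innerX T (hist T I s) (1, \<lambda>_. 0))"
      unfolding Gamma0_eq_innerX using hist_spaceX[OF T I] domA_spaceX[OF exp_domA] exp_spaceX[of 1 0]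
      by (simp add: innerX_scale_right innerX_add_right addX_spaceX scaleX_spaceX)
    also have "innerX T (hist T I s) (1, \<lambda>_. 0) = fst (hist T I s)" by (simp add: innerX_def)
    finally have "adjA T (hist T I s) (1, \<lambda>s. exp (xi A T * s)) = xi A T * (Gamma0 A T (hist T I s) - fst (hist T I s))" .
    then show ?thesis unfolding rhs_def adjB_def B using A by (simp add: right_diff_distrib)
  qed
  then show ?thesis
    using hist_weak_solution[OF T I exp_domA t] by (simp add: Gamma0_eq_innerX)
qed

lemma Gamma0_hist_discounted:
  assumes t: "t \<ge> 0"
  shows "exp (- xi A T * t) * Gamma0 A T (hist T I t) = Gamma0 A T (hist T I 0)
    - integral {0..t} (\<lambda>s. exp (- xi A T * s) * (xi A T / A * (A * fst (hist T I s) - I s)))"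
proof (rule integrating_factor[OF _ _ t Gamma0_hist_integral_equation])
  show "continuous_on {0..t} (\<lambda>t. Gamma0 A T (hist T I t))"
    by (rule continuous_on_subset[OF Gamma0_hist_continuous_on]) auto
  show "(\<lambda>s. xi A T / A * (A * fst (hist T I s) - I s)) absolutely_integrable_on {0..t}"
    by (intro L2_integrable(1) L2_scale L2_diff I
        L2_continuous continuous_on_subset[OF hist_fst_continuous_on[OF T I]]) auto
qed auto

text \<open>Capital is itself the integral of the reflected history, so both parts of
  \<open>Gamma0\<close> combine into one integral, whose weight has a sign.\<close>

lemma Gamma0_hist_eq:
  "Gamma0 A T (hist T I t) = integral {-T..0} (\<lambda>s. (1 - exp (xi A T * s)) * I (t - T - s))"
proof -
  have e: "square_integrable_on (\<lambda>s. exp (xi A T * s)) {-T..0}"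
    by (auto intro!: L2_continuous continuous_intros)
  have i: "square_integrable_on (\<lambda>s. I (t - T - s)) {-T..0}" by (simp add: L2_reverse I)
  have "Gamma0 A T (hist T I t) = fst (hist T I t) + integral {-T..0} (\<lambda>s. - I (t - T - s) * exp (xi A T * s))"
    unfolding Gamma0_eq_innerX using innerX_eq[OF hist_spaceX[OF T I] domA_spaceX[OF exp_domA]]
    by (simp add: snd_hist)
  also have "fst (hist T I t) = integral {-T..0} (\<lambda>s. I (t - T - s))"
    using integral_reverse[of "-T" 0 I "t - T"] by (simp add: hist_def)
  also have "integral {-T..0} (\<lambda>s. I (t - T - s)) + integral {-T..0} (\<lambda>s. - I (t - T - s) * exp (xi A T * s))
     = integral {-T..0} (\<lambda>s. I (t - T - s) + - I (t - T - s) * exp (xi A T * s))"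
    by (intro integral_add[symmetric] L2_integrable(2)[OF i]
        L2_mult_integrable L2_minus i e)
  finally show ?thesis by (simp add: algebra_simps)
qed

text \<open>The weight \<open>1 - exp (\<xi> s)\<close> lies between \<open>0\<close> and \<open>1 - exp (- \<xi> T) = \<xi> / A\<close>.\<close>

lemma Gamma0_hist_bounds:
  assumes N: "negligible N" and nonneg: "\<And>r. r \<in> {t-T..t} - N \<Longrightarrow> I r \<ge> 0"
  shows "0 \<le> Gamma0 A T (hist T I t)" "Gamma0 A T (hist T I t) \<le> xi A T / A * fst (hist T I t)"
proof -
  have i: "square_integrable_on (\<lambda>s. I (t - T - s)) {-T..0}" by (simp add: L2_reverse I)
  have wi: "(\<lambda>s. (1 - exp (xi A T * s)) * I (t - T - s)) integrable_on {-T..0}"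
    by (intro L2_mult_integrable i L2_continuous continuous_intros)
  note N' = negligible_reverse[OF N, of "t - T"]
  \<comment> \<open>Setting the history to 0 on the null set makes the sign hold pointwise, as the
    integral comparisons require.\<close>
  define f where "f s = (if t - T - s \<in> N then 0 else I (t - T - s))" for s
  have f: "0 \<le> f s" if "s \<in> {-T..0}" for s using nonneg[of "t - T - s"] that by (auto simp: f_def)
  have w: "0 \<le> 1 - exp (xi A T * s)" "1 - exp (xi A T * s) \<le> xi A T / A" if "s \<in> {-T..0}" for s
  proof -
    have "exp (xi A T * (-T)) \<le> exp (xi A T * s)"
      using mult_left_mono[of "-T" s "xi A T"] that xi_root(1)[OF A T AT] by simp
    moreover have "exp (xi A T * s) \<le> 1"
      using that xi_root(1)[OF A T AT] by (simp add: mult_nonneg_nonpos)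
    moreover have "1 - exp (xi A T * (-T)) = xi A T / A"
      using xi_root[OF A T AT] A by (simp add: field_simps)
    ultimately show "0 \<le> 1 - exp (xi A T * s)" "1 - exp (xi A T * s) \<le> xi A T / A" by linarith+
  qed
  have wf: "(\<lambda>s. (1 - exp (xi A T * s)) * f s) integrable_on {-T..0}"
    by (rule integrable_spike[OF wi N']) (auto simp: f_def)
  have fi: "f integrable_on {-T..0}"
    by (rule integrable_spike[OF L2_integrable(2)[OF i] N']) (auto simp: f_def)
  have e: "Gamma0 A T (hist T I t) = integral {-T..0} (\<lambda>s. (1 - exp (xi A T * s)) * f s)"
    unfolding Gamma0_hist_eq by (rule integral_spike[OF N']) (auto simp: f_def)
  show "0 \<le> Gamma0 A T (hist T I t)"
    unfolding e by (intro integral_nonneg wf mult_nonneg_nonneg w f)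
  have "Gamma0 A T (hist T I t) \<le> integral {-T..0} (\<lambda>s. xi A T / A * f s)"
    unfolding e by (intro integral_le wf integrable_on_mult_right fi mult_right_mono w f)
  also have "\<dots> = xi A T / A * integral {-T..0} f" by simp
  also have "integral {-T..0} f = integral {-T..0} (\<lambda>s. I (t - T - s))"
    by (rule integral_spike[OF N']) (auto simp: f_def)
  also have "\<dots> = fst (hist T I t)"
    using integral_reverse[of "-T" 0 I "t - T"] by (simp add: hist_def)
  finally show "Gamma0 A T (hist T I t) \<le> xi A T / A * fst (hist T I t)" .
qed

text \<open>The weight 1 - exp (\<xi> s) vanishes only at s = 0. If the integral of the nonnegative
  product were zero, the history would be null and capital would be zero.\<close>

lemma Gamma0_hist_pos:
  assumes N: "negligible N" and nonneg: "\<And>r. r \<in> {t-T..t} - N \<Longrightarrow> I r \<ge> 0" and k: "fst (hist T I t) > 0"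
  shows "0 < Gamma0 A T (hist T I t)"
proof (rule ccontr)
  assume "\<not> 0 < Gamma0 A T (hist T I t)"
  then have 0: "integral {-T..0} (\<lambda>s. (1 - exp (xi A T * s)) * I (t - T - s)) = 0"
    using Gamma0_hist_bounds(1)[OF N, of t] nonneg by (simp add: Gamma0_hist_eq)
  note N' = negligible_reverse[OF N, of "t - T"]
  have i: "square_integrable_on (\<lambda>s. I (t - T - s)) {-T..0}" by (simp add: L2_reverse I)
  have wi: "(\<lambda>s. (1 - exp (xi A T * s)) * I (t - T - s)) integrable_on {-T..0}"
    by (intro L2_mult_integrable i L2_continuous continuous_intros)
  define f where "f s = (if t - T - s \<in> N then 0 else (1 - exp (xi A T * s)) * I (t - T - s))" for s
  have f: "0 \<le> f s" if "s \<in> {-T..0}" for s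
    using nonneg[of "t - T - s"] that xi_root(1)[OF A T AT]
    by (auto simp: f_def mult_nonneg_nonpos intro!: mult_nonneg_nonneg)
  have fi: "f integrable_on {-T..0}" by (rule integrable_spike[OF wi N']) (auto simp: f_def)
  have "integral {-T..0} f = integral {-T..0} (\<lambda>s. (1 - exp (xi A T * s)) * I (t - T - s))"
    by (rule integral_spike[OF N']) (auto simp: f_def)
  then have "integral {-T..0} f = 0" using 0 by simp
  then have "negligible {s \<in> {-T..0}. f s \<noteq> 0}"
  proof (intro integral_eq_0_imp_negligible fi)
    fix x assume e: "integral {-T..0} f = 0" and x: "x \<in> {-T..0}"
    have fx: "f integrable_on {-T..x}" using x by (intro integrable_on_subinterval[OF fi]) auto
    have "integral {-T..x} f \<le> integral {-T..0} f"
      by (rule integral_subset_le) (use x f fi fx in auto)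
    moreover have "0 \<le> integral {-T..x} f" by (rule integral_nonneg[OF fx]) (use x f in auto)
    ultimately show "integral {-T..x} f = 0" using e by simp
  qed
  \<comment> \<open>The point 0 is included because the weight vanishes there and says nothing about
    \<open>I\<close>.\<close>
  then have M: "negligible ({s \<in> {-T..0}. f s \<noteq> 0} \<union> {s. t - T - s \<in> N} \<union> {0})"
    using N' by (intro negligible_Un) auto
  have "integral {-T..0} (\<lambda>s. I (t - T - s)) = integral {-T..0} (\<lambda>s. 0)"
    by (rule integral_spike[OF M]) (use xi_root(1)[OF A T AT] in \<open>auto simp: f_def\<close>)
  then show False
    using k integral_reverse[of "-T" 0 I "t - T"] by (simp add: hist_def)
qed

end

section \<open>The closed loop\<close>

lemma exp_minus_mult_eqD:
  fixes x y z :: real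
  shows "exp (- x) * y = z \<Longrightarrow> y = z * exp x"
  by (auto simp: exp_minus field_simps)

locale delay_growth =
  fixes A T \<rho> \<sigma> :: real and \<iota> :: "real \<Rightarrow> real"
  assumes A: "A > 0" and T: "T > 0" and \<sigma>: "\<sigma> > 0" "\<sigma> \<noteq> 1" and AT: "A * T > 1"
    and \<rho>: "\<rho> > xi A T * (1 - \<sigma>)" and rate_less: "(\<rho> - xi A T * (1 - \<sigma>)) / \<sigma> < A"
    and \<iota>: "square_integrable_on \<iota> {-T..0}"
    and \<iota>_nonneg: "AE s in lebesgue_on {-T..<0}. \<iota> s \<ge> 0"
    and k0: "initial_capital T \<iota> > 0"
begin

abbreviation \<xi> :: real where "\<xi> \<equiv> xi A T"

text \<open>Relative to exp (\<xi> t), the functional \<open>Gamma0\<close> decays at this rate in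
  the closed loop. The optimal discounted utility decays at it too, which puts 1 / rate into the
  value.\<close>

definition rate :: real where "rate = (\<rho> - \<xi> * (1 - \<sigma>)) / \<sigma>"

definition G0 :: real where "G0 = Gamma0 A T (initial_capital T \<iota>, F T \<iota>)"

abbreviation traj :: "(real \<Rightarrow> real) \<Rightarrow> real \<Rightarrow> state" where "traj u \<equiv> hist T (ext T \<iota> u)"

lemma xi_pos: "\<xi> > 0" by (rule xi_root(1)[OF A T AT])

lemma rate_pos: "rate > 0" using \<rho> \<sigma> by (simp add: rate_def)

text \<open>Raising \<nu> to the power - 1 / \<sigma> returns \<open>rate\<close> and a power of A /
  \<xi> with exponent - (1 - \<sigma>) / \<sigma>; the extra factor brings that exponent to
  1.\<close>

lemma feedback_eq: "feedback A T \<rho> \<sigma> x = A * fst x - rate * (A / \<xi>) * Gamma0 A T x"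
proof -
  have b: "A / \<xi> > 0" using A xi_pos by simp
  have "nu A T \<rho> \<sigma> powr (- 1 / \<sigma>) * (A / \<xi>) powr (1 / \<sigma>)
      = rate powr (- \<sigma> * (- 1 / \<sigma>)) * (A / \<xi>) powr ((1 - \<sigma>) * (- 1 / \<sigma>) + 1 / \<sigma>)"
    unfolding nu_def rate_def[symmetric]
    by (simp only: powr_mult powr_powr powr_add powr_ge_zero mult.assoc)
  also have "- \<sigma> * (- 1 / \<sigma>) = 1" using \<sigma> by simp
  also have "(1 - \<sigma>) * (- 1 / \<sigma>) + 1 / \<sigma> = 1" using \<sigma> by (simp add: field_simps)
  finally have "nu A T \<rho> \<sigma> powr (- 1 / \<sigma>) * (A / \<xi>) powr (1 / \<sigma>) = rate * (A / \<xi>)"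
    using b rate_pos by (simp only: powr_one less_imp_le)
  then show ?thesis by (simp only: feedback_def)
qed

text \<open>The two states differ at most at s = -T, where the reflected history takes the value of
  the control at time 0 instead of that of the datum.\<close>

lemma traj_0: "eqX T (traj u 0) (initial_capital T \<iota>, F T \<iota>)"
proof -
  have "negligible {s \<in> {-T..0}. snd (traj u 0) s \<noteq> F T \<iota> s}"
    by (rule negligible_subset[of "{-T}"]) (auto simp: snd_hist F_def ext_def glue_def)
  then show ?thesis
    by (simp add: eqX_def AE_lebesgue_on_iff_negligible hist_def integral_ext_history initial_capital_eq[OF \<iota>])
qed

section \<open>Trajectories of an arbitrary square-integrable control\<close>

context
  fixes u :: "real \<Rightarrow> real"
  assumes u: "\<And>\<tau>. \<tau> > 0 \<Longrightarrow> square_integrable_on u {0..\<tau>}"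
begin

lemmas ext_sq = ext_square_integrable[OF T \<iota> u]

lemma Gamma0_traj_0: "Gamma0 A T (traj u 0) = G0"
  unfolding G0_def Gamma0_eq_innerX
proof (rule innerX_cong[OF traj_0 hist_spaceX[OF T ext_sq]])
  have "square_integrable_on (\<lambda>s. - \<iota> (-T-s)) {-T..0}"
    using \<iota> by (intro L2_minus) (simp add: L2_reverse)
  then show "(initial_capital T \<iota>, F T \<iota>) \<in> spaceX T" by (simp add: spaceX_def F_def)
  show "(1, \<lambda>s. exp (\<xi> * s)) \<in> spaceX T" by (rule domA_spaceX[OF exp_domA])
qed simp

text \<open>Only times before \<open>t\<close> are constrained, the instant \<open>t\<close> being
  null. This is what permits its use at the first time at which a sign might fail.\<close>

lemma traj_nonneg:
  assumes "AE s in lebesgue_on {0..}. s < t \<longrightarrow> u s \<ge> 0" "t \<ge> 0"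
  shows "0 \<le> Gamma0 A T (traj u t)" "Gamma0 A T (traj u t) \<le> \<xi> / A * fst (traj u t)"
proof -
  have "negligible {s \<in> {-T..<0}. \<not> \<iota> s \<ge> 0}"
    using \<iota>_nonneg by (subst (asm) AE_lebesgue_on_iff_negligible) auto
  moreover have "negligible {s \<in> {0..}. \<not> (s < t \<longrightarrow> u s \<ge> 0)}"
    using assms(1) by (subst (asm) AE_lebesgue_on_iff_negligible) auto
  ultimately have N: "negligible ({s \<in> {-T..<0}. \<not> \<iota> s \<ge> 0} \<union> {s \<in> {0..}. \<not> (s < t \<longrightarrow> u s \<ge> 0)} \<union> {t})"
    by (intro negligible_Un) auto
  have *: "ext T \<iota> u r \<ge> 0" if "r \<in> {t-T..t} - ({s \<in> {-T..<0}. \<not> \<iota> s \<ge> 0} \<union> {s \<in> {0..}. \<not> (s < t \<longrightarrow> u s \<ge> 0)} \<union> {t})" for r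
    using that assms(2) by (auto simp: ext_def glue_def)
  show "0 \<le> Gamma0 A T (traj u t)" "Gamma0 A T (traj u t) \<le> \<xi> / A * fst (traj u t)"
    using Gamma0_hist_bounds[OF A T AT ext_sq N *] by blast+
qed

text \<open>The window is split at time 0 into a part known from the datum and a part involving the
  control; \<open>min\<close> and \<open>max\<close> treat t \<le> T and t > T uniformly.\<close>

lemma fst_traj:
  assumes "t \<ge> 0"
  shows "fst (traj u t) = integral {min 0 (t - T)..0} \<iota> + integral {max 0 (t - T)..t} u"
proof -
  let ?I = "ext T \<iota> u"
  have I: "?I integrable_on {p..q}" for p q by (rule L2_integrable(2)[OF ext_sq])
  have 1: "integral {max 0 (t - T)..t} ?I = integral {max 0 (t - T)..t} u"
    by (rule integral_cong) (use T in \<open>auto simp: ext_def glue_def\<close>)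
  have 2: "integral {min 0 (t - T)..0} ?I = integral {min 0 (t - T)..0} \<iota>"
    by (rule integral_spike[of "{0}"]) (use assms in \<open>auto simp: ext_def glue_def min_def split: if_splits\<close>)
  show ?thesis
  proof (cases "t \<le> T")
    case True
    have "integral {t-T..0} ?I + integral {0..t} ?I = integral {t-T..t} ?I"
      using True assms by (intro Henstock_Kurzweil_Integration.integral_combine I) auto
    then show ?thesis using 1 2 True by (simp add: hist_def)
  next
    case False
    then show ?thesis using 1 by (simp add: hist_def)
  qed
qed

text \<open>The closed loop, a delay equation for the feedback control, is equivalent to a Volterra
  equation because \<open>\<Gamma>\<^sub>0\<close> grows exponentially at the rate \<open>\<xi> - rate\<close> along it.\<close>

lemma closed_loop_Gamma0:
  assumes cl: "\<And>t. t \<ge> 0 \<Longrightarrow> u t = feedback A T \<rho> \<sigma> (traj u t)" and t: "t \<ge> 0"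
  shows "Gamma0 A T (traj u t) = G0 * exp ((\<xi> - rate) * t)"
proof -
  have "exp (- (\<xi> - rate) * t) * Gamma0 A T (traj u t) = G0 - integral {0..t} (\<lambda>s. exp (- (\<xi> - rate) * s) * 0)"
  proof (rule integrating_factor[OF _ _ t])
    show "continuous_on {0..t} (\<lambda>t. Gamma0 A T (traj u t))"
      by (rule continuous_on_subset[OF Gamma0_hist_continuous_on[OF A T AT ext_sq]]) auto
    fix s assume s: "s \<in> {0..t}"
    have "Gamma0 A T (traj u s) = G0 + integral {0..s} (\<lambda>r. \<xi> * Gamma0 A T (traj u r) - \<xi> / A * (A * fst (traj u r) - ext T \<iota> u r))"
      using Gamma0_hist_integral_equation[OF A T AT ext_sq, of s] s by (simp add: Gamma0_traj_0)
    also have "integral {0..s} (\<lambda>r. \<xi> * Gamma0 A T (traj u r) - \<xi> / A * (A * fst (traj u r) - ext T \<iota> u r))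
      = integral {0..s} (\<lambda>r. (\<xi> - rate) * Gamma0 A T (traj u r) - 0)"
    proof (rule integral_cong)
      fix r assume r: "r \<in> {0..s}"
      then have "ext T \<iota> u r = A * fst (traj u r) - rate * (A / \<xi>) * Gamma0 A T (traj u r)"
        using cl[of r] T by (simp add: ext_def glue_def feedback_eq)
      then show "\<xi> * Gamma0 A T (traj u r) - \<xi> / A * (A * fst (traj u r) - ext T \<iota> u r)
        = (\<xi> - rate) * Gamma0 A T (traj u r) - 0"
        using A xi_pos by (simp add: field_simps)
    qed
    finally show "Gamma0 A T (traj u s) = G0 + integral {0..s} (\<lambda>r. (\<xi> - rate) * Gamma0 A T (traj u r) - 0)" .
  qed simp
  then have "exp (- ((\<xi> - rate) * t)) * Gamma0 A T (traj u t) = G0"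
    by (simp only: mult_minus_left mult_zero_right integral_0 diff_zero)
  then show ?thesis by (rule exp_minus_mult_eqD)
qed

text \<open>The converse of \<open>closed_loop_Gamma0\<close>: prescribing the exponential in place
  of \<open>Gamma0\<close> makes consumption explicit, and integrating the discounted scalar law
  returns exactly that exponential. So a solution of the Volterra equation is indeed the feedback
  control.\<close>

lemma Volterra_Gamma0:
  assumes u_eq: "\<And>t. t \<ge> 0 \<Longrightarrow> u t = A * fst (traj u t) - rate * (A / \<xi>) * (G0 * exp ((\<xi> - rate) * t))"
    and t: "t \<ge> 0"
  shows "Gamma0 A T (traj u t) = G0 * exp ((\<xi> - rate) * t)"
proof -
  have "integral {0..t} (\<lambda>s. - rate * exp (- rate * s)) = exp (- rate * t) - 1"
    using integral_unique[OF has_integral_exp[OF t, of "- rate"]] by simp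
  from arg_cong[OF this, of "\<lambda>x. - G0 * x"]
  have 1: "integral {0..t} (\<lambda>s. rate * G0 * exp (- rate * s)) = G0 - G0 * exp (- rate * t)"
    by (simp add: algebra_simps flip: integral_mult_right)
  have "exp (- \<xi> * t) * Gamma0 A T (traj u t) = G0 - integral {0..t} (\<lambda>s. exp (- \<xi> * s) * (\<xi> / A * (A * fst (traj u s) - ext T \<iota> u s)))"
    using Gamma0_hist_discounted[OF A T AT ext_sq t] by (simp add: Gamma0_traj_0)
  also have "integral {0..t} (\<lambda>s. exp (- \<xi> * s) * (\<xi> / A * (A * fst (traj u s) - ext T \<iota> u s)))
      = integral {0..t} (\<lambda>s. rate * G0 * exp (- rate * s))"
  proof (rule integral_cong)
    fix s assume s: "s \<in> {0..t}"
    then have "ext T \<iota> u s = u s" using T by (simp add: ext_def glue_def)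
    then have "\<xi> / A * (A * fst (traj u s) - ext T \<iota> u s) = rate * G0 * exp ((\<xi> - rate) * s)"
      using u_eq[of s] s A xi_pos by simp
    then have "exp (- \<xi> * s) * (\<xi> / A * (A * fst (traj u s) - ext T \<iota> u s)) = rate * G0 * (exp (- \<xi> * s) * exp ((\<xi> - rate) * s))"
      by simp
    also have "exp (- \<xi> * s) * exp ((\<xi> - rate) * s) = exp (- rate * s)"
      by (simp add: algebra_simps flip: exp_add)
    finally show "exp (- \<xi> * s) * (\<xi> / A * (A * fst (traj u s) - ext T \<iota> u s)) = rate * G0 * exp (- rate * s)" .
  qed
  finally have "exp (- (\<xi> * t)) * Gamma0 A T (traj u t) = G0 * exp (- rate * t)"
    using 1 by simp
  then have "Gamma0 A T (traj u t) = G0 * exp (- rate * t) * exp (\<xi> * t)" by (rule exp_minus_mult_eqD)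
  also have "\<dots> = G0 * exp (- rate * t + \<xi> * t)" by (simp only: exp_add mult.assoc)
  also have "- rate * t + \<xi> * t = (\<xi> - rate) * t" by (simp add: algebra_simps)
  finally show ?thesis .
qed

end

section \<open>The feedback control: existence, uniqueness and sign\<close>

lemma continuous_square_integrable:
  "continuous_on {0..} u \<Longrightarrow> square_integrable_on u {0..\<tau>}"
  by (intro L2_continuous) (auto intro: continuous_on_subset)

text \<open>\<open>G0\<close> is the value at time 0 of \<open>Gamma0\<close> along the trajectory
  of any control; the zero control is taken.\<close>

lemma G0_pos: "G0 > 0"
proof -
  have z: "square_integrable_on (\<lambda>_. 0) {0..\<tau>}" for \<tau> by (simp add: L2_continuous)
  have N: "negligible ({s \<in> {-T..<0}. \<not> \<iota> s \<ge> 0} \<union> {0})"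
    using \<iota>_nonneg by (subst (asm) AE_lebesgue_on_iff_negligible) auto
  have "0 < Gamma0 A T (traj (\<lambda>_. 0) 0)"
  proof (rule Gamma0_hist_pos[OF A T AT ext_square_integrable[OF T \<iota> z] N])
    show "fst (traj (\<lambda>_. 0) 0) > 0"
      using k0 by (simp add: hist_def integral_ext_history initial_capital_eq[OF \<iota>])
  qed (auto simp: ext_def glue_def)
  then show ?thesis by (simp add: Gamma0_traj_0 z)
qed

lemma Volterra_control_exists:
  obtains u where "continuous_on {0..} u"
    "\<And>t. t \<ge> 0 \<Longrightarrow> u t = A * fst (traj u t) - rate * (A / \<xi>) * (G0 * exp ((\<xi> - rate) * t))"
proof -
  define q where "q p = integral {p..0} \<iota>" for p
  have \<iota>i: "\<iota> integrable_on {-T..0}" by (rule L2_integrable(2)[OF \<iota>])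
  have q: "continuous_on {-T..0} q"
    unfolding q_def by (rule indefinite_integral_continuous_1'[OF \<iota>i])
  have "bounded (q ` {-T..0})"
    by (intro compact_imp_bounded compact_continuous_image q compact_Icc)
  then obtain M where "\<forall>x\<in>q ` {-T..0}. norm x \<le> M" unfolding bounded_iff by blast
  then have M: "\<bar>q p\<bar> \<le> M" if "p \<in> {-T..0}" for p using that by simp
  define h where "h t = A * q (min 0 (t - T)) - rate * (A / \<xi>) * (G0 * exp ((\<xi> - rate) * t))" for t
  have h: "continuous_on {0..} h"
    unfolding h_def using T by (intro continuous_intros continuous_on_compose2[OF q]) auto
  \<comment> \<open>\<open>2 * A\<close> is for the contraction, \<bar>\<xi> - rate\<bar> for the
    exponential inside \<open>h\<close>.\<close>
  define b where "b = 2 * A + \<bar>\<xi> - rate\<bar>"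
  define C where "C = A * M + \<bar>rate * (A / \<xi>) * G0\<bar>"
  obtain u where u: "continuous_on {0..} u"
    and ue: "\<And>t. t \<ge> 0 \<Longrightarrow> u t = h t + A * integral {max 0 (t - T)..t} u"
  proof (rule delay_Volterra_exists[OF A T h, of b C])
    show "2 * A \<le> b" by (simp add: b_def)
    fix t :: real assume t: "t \<ge> 0"
    have p: "min 0 (t - T) \<in> {-T..0}" using t T by auto
    have M0: "M \<ge> 0" using M[OF p] by linarith
    have e: "exp ((\<xi> - rate) * t) \<le> exp (b * t)" "1 \<le> exp (b * t)"
      using t A by (auto simp: b_def intro!: mult_right_mono)
    have "\<bar>A * q (min 0 (t - T))\<bar> \<le> A * M * exp (b * t)"
    proof -
      have "\<bar>A * q (min 0 (t - T))\<bar> \<le> A * M * 1" using M[OF p] A by (simp add: abs_mult)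
      also have "\<dots> \<le> A * M * exp (b * t)" using e A M0 by (intro mult_left_mono) auto
      finally show ?thesis .
    qed
    moreover have "\<bar>rate * (A / \<xi>) * (G0 * exp ((\<xi> - rate) * t))\<bar> \<le> \<bar>rate * (A / \<xi>) * G0\<bar> * exp (b * t)"
    proof -
      have "\<bar>rate * (A / \<xi>) * (G0 * exp ((\<xi> - rate) * t))\<bar> = \<bar>rate * (A / \<xi>) * G0\<bar> * exp ((\<xi> - rate) * t)"
        by (simp add: abs_mult)
      also have "\<dots> \<le> \<bar>rate * (A / \<xi>) * G0\<bar> * exp (b * t)" using e by (intro mult_left_mono) auto
      finally show ?thesis .
    qed
    ultimately show "\<bar>h t\<bar> \<le> C * exp (b * t)" unfolding h_def C_def distrib_right by linarith
  qed blast
  show ?thesis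
  proof (rule that[OF u])
    fix t :: real assume t: "t \<ge> 0"
    show "u t = A * fst (traj u t) - rate * (A / \<xi>) * (G0 * exp ((\<xi> - rate) * t))"
      using ue[OF t] by (simp add: fst_traj[OF continuous_square_integrable[OF u] t] h_def q_def algebra_simps)
  qed
qed

lemma Volterra_control_unique:
  assumes u: "continuous_on {0..} u" and w: "continuous_on {0..} w"
    and ue: "\<And>t. t \<ge> 0 \<Longrightarrow> u t = A * fst (traj u t) - rate * (A / \<xi>) * (G0 * exp ((\<xi> - rate) * t))"
    and we: "\<And>t. t \<ge> 0 \<Longrightarrow> w t = A * fst (traj w t) - rate * (A / \<xi>) * (G0 * exp ((\<xi> - rate) * t))"
    and t: "t \<ge> 0"
  shows "u t = w t"
proof (rule delay_Volterra_unique[OF A u w _ _ t])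
  let ?h = "\<lambda>t. A * integral {min 0 (t - T)..0} \<iota> - rate * (A / \<xi>) * (G0 * exp ((\<xi> - rate) * t))"
  fix t :: real assume t: "t \<ge> 0"
  show "u t = ?h t + A * integral {max 0 (t - T)..t} u" "w t = ?h t + A * integral {max 0 (t - T)..t} w"
    using ue[OF t] we[OF t]
    by (simp_all add: fst_traj[OF continuous_square_integrable[OF u] t] fst_traj[OF continuous_square_integrable[OF w] t]
        algebra_simps)
qed

text \<open>At a first zero of the control the history is nonnegative, so \<open>A * k \<ge> (A\<^sup>2 / \<xi>) * \<Gamma>\<^sub>0\<close>, and
  \<open>rate < A\<close> makes the feedback positive there.\<close>

lemma Volterra_control_pos:
  assumes u: "continuous_on {0..} u"
    and ue: "\<And>t. t \<ge> 0 \<Longrightarrow> u t = A * fst (traj u t) - rate * (A / \<xi>) * (G0 * exp ((\<xi> - rate) * t))"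
    and t: "t \<ge> 0"
  shows "u t > 0" "fst (traj u t) > 0"
proof -
  note sq = continuous_square_integrable[OF u]
  \<comment> \<open>Nonnegativity strictly before \<open>s\<close> already forces positivity at
    \<open>s\<close>. Used at the infimum of the times with u \<le> 0 this is a contradiction; used
    at every time afterwards it gives positive capital.\<close>
  have *: "u s > 0 \<and> fst (traj u s) > 0" if s: "s \<ge> 0" and nn: "\<And>r. 0 \<le> r \<Longrightarrow> r < s \<Longrightarrow> u r \<ge> 0" for s
  proof -
    have G: "Gamma0 A T (traj u s) = G0 * exp ((\<xi> - rate) * s)" by (rule Volterra_Gamma0[OF sq ue s])
    then have Gp: "Gamma0 A T (traj u s) > 0" using G0_pos by simp
    have le: "Gamma0 A T (traj u s) \<le> \<xi> / A * fst (traj u s)"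
      by (rule traj_nonneg(2)[OF sq _ s]) (use nn in \<open>auto intro!: AE_I2\<close>)
    then have k: "A / \<xi> * Gamma0 A T (traj u s) \<le> fst (traj u s)"
      using A xi_pos by (simp add: field_simps)
    have "0 < (A - rate) * (A / \<xi> * Gamma0 A T (traj u s))"
      using rate_less Gp A xi_pos by (simp add: rate_def)
    also have "\<dots> = A * (A / \<xi> * Gamma0 A T (traj u s)) - rate * (A / \<xi>) * Gamma0 A T (traj u s)"
      by (simp only: left_diff_distrib mult.assoc)
    also have "\<dots> \<le> A * fst (traj u s) - rate * (A / \<xi>) * Gamma0 A T (traj u s)"
      using mult_left_mono[OF k, of A] A by simp
    also have "\<dots> = u s" using ue[OF s] G by simp
    finally have "0 < u s" .
    moreover have "0 < A / \<xi> * Gamma0 A T (traj u s)" using A xi_pos Gp by simp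
    ultimately show ?thesis using k by linarith
  qed
  have pos: "u s > 0" if "s \<ge> 0" for s
  proof (rule ccontr)
    assume neg: "\<not> u s > 0"
    define Z where "Z = {0..s} \<inter> u -` {..0}"
    have "closed Z"
      unfolding Z_def using u by (intro continuous_closed_preimage) (auto intro: continuous_on_subset)
    moreover have ne: "Z \<noteq> {}" and bd: "bdd_below Z" using neg that by (auto simp: Z_def)
    ultimately have Zi: "Inf Z \<in> Z" by (intro closed_contains_Inf)
    have "u r \<ge> 0" if "0 \<le> r" "r < Inf Z" for r
    proof (rule ccontr)
      assume "\<not> u r \<ge> 0"
      then have "r \<in> Z" using that Zi by (auto simp: Z_def)
      then show False using cInf_lower[OF _ bd] that by force
    qed
    then have "u (Inf Z) > 0" using *[of "Inf Z"] Zi by (auto simp: Z_def)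
    then show False using Zi by (simp add: Z_def)
  qed
  then show "u t > 0" using t by blast
  show "fst (traj u t) > 0" using *[OF t] pos by (simp add: less_imp_le)
qed

lemma traj_state_solution:
  assumes u: "continuous_on {0..} u"
  shows "state_solution T u (initial_capital T \<iota>, F T \<iota>) (traj u)"
  unfolding state_solution_iff[OF T u]
proof (intro conjI allI impI ballI)
  note sq = ext_square_integrable[OF T \<iota> continuous_square_integrable[OF u]]
  show "continuousX T \<tau> (traj u)" for \<tau> by (rule hist_continuousX[OF T sq])
  fix t \<psi> assume t: "0 \<le> (t::real)" and \<psi>: "\<psi> \<in> domA T"
  have "integral {0..t} (\<lambda>s. rhs T (traj u s) (ext T \<iota> u s) \<psi>) = integral {0..t} (\<lambda>s. rhs T (traj u s) (u s) \<psi>)"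
    using T by (intro integral_cong) (auto simp: ext_def glue_def)
  then show "innerX T (traj u t) \<psi> = innerX T (traj u 0) \<psi> + integral {0..t} (\<lambda>s. rhs T (traj u s) (u s) \<psi>)"
    using hist_weak_solution[OF T sq \<psi> t] by simp
qed (rule traj_0)

text \<open>The feedback \<open>w\<close> along \<open>y\<close> is continuous, so open-loop
  uniqueness identifies \<open>y\<close> with the trajectory of \<open>w\<close>. Then
  \<open>w\<close> is the feedback of its own trajectory, hence solves the same Volterra equation as
  \<open>u\<close>.\<close>

lemma closed_loop_unique:
  assumes u: "continuous_on {0..} u"
    and ue: "\<And>t. t \<ge> 0 \<Longrightarrow> u t = A * fst (traj u t) - rate * (A / \<xi>) * (G0 * exp ((\<xi> - rate) * t))"
    and y: "closed_loop_solution T (feedback A T \<rho> \<sigma>) (initial_capital T \<iota>, F T \<iota>) y"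
    and t: "t \<ge> 0"
  shows "eqX T (y t) (traj u t)"
proof -
  define w where "w t = feedback A T \<rho> \<sigma> (y t)" for t
  note sol = y[unfolded closed_loop_solution_def, folded w_def]
  have yc: "continuousX T \<tau> y" if "\<tau> > 0" for \<tau> using sol that by (simp add: state_solution_def)
  note ex = exp_domA[of A T] Gamma0_eq_innerX[of A T]
  have one: "(1, \<lambda>_. 0) \<in> spaceX T" by (simp add: spaceX_def L2_continuous)
  have fst_eq: "fst x' = innerX T x' (1, \<lambda>_. 0)" for x' by (simp add: innerX_def)
  have fb: "feedback A T \<rho> \<sigma> x' = A * innerX T x' (1, \<lambda>_. 0) - rate * (A / \<xi>) * innerX T x' (1, \<lambda>s. exp (\<xi> * s))" for x'
    by (simp add: feedback_eq ex(2) flip: fst_eq)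
  have w: "continuous_on {0..} w"
  proof (rule continuous_on_atLeastI)
    fix b :: real
    \<comment> \<open>\<open>max 1 b\<close> because continuity of \<open>y\<close> is known on
      \<open>{0..\<tau>}\<close> for positive \<tau>.\<close>
    have "continuous_on {0..max 1 b} w"
      unfolding w_def fb by (intro continuous_intros continuous_on_innerX yc one domA_spaceX ex) auto
    then show "continuous_on {0..b} w" by (rule continuous_on_subset) auto
  qed
  have eq: "eqX T (y s) (traj w s)" if "s \<ge> 0" for s
    using state_solution_unique[OF T w sol traj_state_solution[OF w] that] .
  have "w s = feedback A T \<rho> \<sigma> (traj w s)" if "s \<ge> 0" for s
  proof -
    have "y s \<in> spaceX T" "traj w s \<in> spaceX T"
      using continuousX_spaceX[OF yc[of "s + 1"], of s] that
        hist_spaceX[OF T ext_square_integrable[OF T \<iota> continuous_square_integrable[OF w]]] by auto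
    then have "feedback A T \<rho> \<sigma> (y s) = feedback A T \<rho> \<sigma> (traj w s)"
      unfolding fb using innerX_cong[OF eq[OF that]] one domA_spaceX[OF ex(1)] by simp
    then show ?thesis unfolding w_def[of s] .
  qed
  then have "w s = A * fst (traj w s) - rate * (A / \<xi>) * (G0 * exp ((\<xi> - rate) * s))" if "s \<ge> 0" for s
    using closed_loop_Gamma0[OF continuous_square_integrable[OF w], of s] that by (simp add: feedback_eq)
  then have "u s = w s" if "s \<ge> 0" for s
    using Volterra_control_unique[OF u w ue] that by blast
  then have "ext T \<iota> u = ext T \<iota> w" by (auto simp: ext_def glue_def)
  then show ?thesis using eq[OF t] by simp
qed

end

section \<open>Optimality\<close>

text \<open>The concave function lies below its tangent at 1, by the mean value theorem with
  derivative z powr (- \<sigma>). For \<sigma> > 1 the point 0 must be excluded: \<open>powr\<close>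
  yields 0 there, while the right-hand side is negative.\<close>

lemma powr_tangent_bound:
  fixes x \<sigma> :: real
  assumes x: "x \<ge> 0" and \<sigma>: "\<sigma> > 0" "\<sigma> \<noteq> 1" and x0: "x = 0 \<Longrightarrow> \<sigma> < 1"
  shows "x powr (1 - \<sigma>) / (1 - \<sigma>) \<le> 1 / (1 - \<sigma>) + (x - 1)"
proof (cases "x = 0")
  case True
  then show ?thesis using x0 \<sigma> by (simp add: field_simps)
next
  case False
  then have x: "x > 0" using x by simp
  define f where "f z = z powr (1 - \<sigma>) / (1 - \<sigma>)" for z
  have f': "(f has_real_derivative z powr (- \<sigma>)) (at z)" if "z > 0" for z
  proof -
    have "((\<lambda>z. z powr (1 - \<sigma>)) has_real_derivative (1 - \<sigma>) * z powr (1 - \<sigma> - 1)) (at z)"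
      by (rule has_real_derivative_powr[OF that])
    from DERIV_cdivide[OF this, of "1 - \<sigma>"] show ?thesis using \<sigma> by (simp add: f_def[abs_def])
  qed
  consider "x = 1" | "x > 1" | "x < 1" by linarith
  then have "f x - f 1 \<le> x - 1"
  proof cases
    case 2
    obtain z where z: "1 < z" "z < x" "f x - f 1 = (x - 1) * z powr (- \<sigma>)"
      using MVT2[of 1 x f "\<lambda>z. z powr (- \<sigma>)"] f' 2 by auto
    have "z powr (- \<sigma>) \<le> 1" using z \<sigma> powr_mono[of "- \<sigma>" 0 z] by simp
    then have "(x - 1) * z powr (- \<sigma>) \<le> (x - 1) * 1" using 2 by (intro mult_left_mono) auto
    then show ?thesis by (simp only: z(3) mult_1_right)
  next
    case 3
    obtain z where z: "x < z" "z < 1" "f 1 - f x = (1 - x) * z powr (- \<sigma>)"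
      using MVT2[of x 1 f "\<lambda>z. z powr (- \<sigma>)"] f' 3 x by auto
    have "1 \<le> z powr (- \<sigma>)" using z x \<sigma> powr_mono2'[of "- \<sigma>" z 1] by simp
    then have "(1 - x) * 1 \<le> (1 - x) * z powr (- \<sigma>)" using 3 by (intro mult_left_mono) auto
    then have "1 - x \<le> f 1 - f x" by (simp only: z(3) mult_1_right)
    then show ?thesis by linarith
  qed simp
  then show ?thesis by (simp add: f_def)
qed

text \<open>Homogeneity of degree 1 - \<sigma> reduces the tangent at \<open>d\<close> to the
  tangent at 1, evaluated at c / d.\<close>

lemma powr_tangent_bound_at:
  fixes c d \<sigma> :: real
  assumes c: "c \<ge> 0" and d: "d > 0" and \<sigma>: "\<sigma> > 0" "\<sigma> \<noteq> 1" and c0: "c = 0 \<Longrightarrow> \<sigma> < 1"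
  shows "c powr (1 - \<sigma>) / (1 - \<sigma>) + d powr (- \<sigma>) * d \<le> d powr (1 - \<sigma>) / (1 - \<sigma>) + d powr (- \<sigma>) * c"
proof -
  have p: "d powr (1 - \<sigma>) = d powr (- \<sigma>) * d" using d powr_add[of d "- \<sigma>" 1] by simp
  have "(c / d) powr (1 - \<sigma>) / (1 - \<sigma>) \<le> 1 / (1 - \<sigma>) + (c / d - 1)"
    using c d c0 by (intro powr_tangent_bound \<sigma>) auto
  then have "d powr (1 - \<sigma>) * ((c / d) powr (1 - \<sigma>) / (1 - \<sigma>)) \<le> d powr (1 - \<sigma>) * (1 / (1 - \<sigma>) + (c / d - 1))"
    by (rule mult_left_mono) simp
  moreover have "d powr (1 - \<sigma>) * ((c / d) powr (1 - \<sigma>) / (1 - \<sigma>)) = c powr (1 - \<sigma>) / (1 - \<sigma>)"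
    using c d by (simp add: powr_divide)
  moreover have "d powr (1 - \<sigma>) * (1 / (1 - \<sigma>) + (c / d - 1)) = d powr (1 - \<sigma>) / (1 - \<sigma>) + d powr (- \<sigma>) * c - d powr (- \<sigma>) * d"
    using d by (simp add: p field_simps)
  ultimately show ?thesis by linarith
qed

section \<open>Integrals over the half-line and the objective in the extended reals\<close>

lemma nn_integral_exp_decay:
  assumes "a > 0" "C \<ge> 0"
  shows "(\<integral>\<^sup>+ t. ennreal (C * exp (- a * t)) \<partial>lebesgue_on {0..}) = ennreal (C / a)"
proof -
  have "((\<lambda>t. - (C / a) * exp (- a * t)) \<longlongrightarrow> - (C / a) * 0) at_top"
    using assms by (intro tendsto_intros filterlim_compose[OF exp_at_bot]
        filterlim_tendsto_neg_mult_at_bot[OF tendsto_const] filterlim_ident) auto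
  then have "(\<integral>\<^sup>+ t. ennreal (C * exp (- a * t)) * indicator {0..} t \<partial>lborel) = ennreal (0 - (- (C / a) * exp (- a * 0)))"
    using assms by (intro nn_integral_FTC_atLeast) (auto intro!: derivative_eq_intros)
  then show ?thesis
    by (simp add: nn_integral_restrict_space nn_integral_completion)
qed

text \<open>Monotone convergence along the intervals \<open>{0..real (Suc n)}\<close>; the successor
  keeps their right endpoints positive.\<close>

lemma nn_integral_atLeast_le:
  fixes f :: "real \<Rightarrow> real"
  assumes f: "\<And>\<tau>. \<tau> > 0 \<Longrightarrow> f absolutely_integrable_on {0..\<tau>}"
    and nonneg: "AE t in lebesgue_on {0..}. f t \<ge> 0"
    and le: "\<And>\<tau>. \<tau> > 0 \<Longrightarrow> integral {0..\<tau>} f \<le> B"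
  shows "(\<integral>\<^sup>+ t. ennreal (f t) \<partial>lebesgue_on {0..}) \<le> ennreal B"
proof -
  let ?S = "\<lambda>n. {0..real (Suc n)}"
  have ae: "AE t in lebesgue. t \<in> {0..} \<longrightarrow> f t \<ge> 0"
    using nonneg by (subst (asm) AE_restrict_space_iff) auto
  have m: "(\<lambda>t. ennreal (f t) * indicator (?S n) t) \<in> borel_measurable lebesgue" for n
  proof -
    have "(\<lambda>t. indicator (?S n) t *\<^sub>R f t) \<in> borel_measurable lebesgue"
      using f[of "real (Suc n)"] by (simp add: set_integrable_def borel_measurable_integrable)
    then have "(\<lambda>t. ennreal (indicator (?S n) t *\<^sub>R f t)) \<in> borel_measurable lebesgue" by measurable
    moreover have "(\<lambda>t. ennreal (indicator (?S n) t *\<^sub>R f t)) = (\<lambda>t. ennreal (f t) * indicator (?S n) t)"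
      by (auto split: split_indicator)
    ultimately show ?thesis by simp
  qed
  have fin: "(\<integral>\<^sup>+ t. ennreal (f t) * indicator (?S n) t \<partial>lebesgue) \<le> ennreal B" for n
  proof -
    have "(\<integral>\<^sup>+ t. ennreal (f t) * indicator (?S n) t \<partial>lebesgue) = (\<integral>\<^sup>+ t. ennreal (f t) \<partial>lebesgue_on (?S n))"
      by (simp add: nn_integral_restrict_space)
    also have "\<dots> = ennreal (LINT t|lebesgue_on (?S n). f t)"
    proof (rule nn_integral_eq_integral)
      show "integrable (lebesgue_on (?S n)) f" by (intro absolutely_integrable_imp_integrable f) auto
      show "AE t in lebesgue_on (?S n). 0 \<le> f t"
        using ae by (subst AE_restrict_space_iff) auto
    qed
    also have "(LINT t|lebesgue_on (?S n). f t) = integral (?S n) f"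
      by (intro LINT_lebesgue_on_eq_integral f) auto
    finally show ?thesis using le[of "real (Suc n)"] by (simp add: ennreal_leI)
  qed
  have "(\<integral>\<^sup>+ t. ennreal (f t) \<partial>lebesgue_on {0..}) = (\<integral>\<^sup>+ t. ennreal (f t) * indicator {0..} t \<partial>lebesgue)"
    by (simp add: nn_integral_restrict_space)
  also have "\<dots> = (\<integral>\<^sup>+ t. (SUP n. ennreal (f t) * indicator (?S n) t) \<partial>lebesgue)"
  proof (rule nn_integral_cong)
    fix t :: real
    show "ennreal (f t) * indicator {0..} t = (SUP n. ennreal (f t) * indicator (?S n) t)"
    proof (cases "t \<ge> 0")
      case True
      obtain n where "t \<le> real n" using real_arch_simple by blast
      then have "ennreal (f t) \<le> ennreal (f t) * indicator (?S n) t" using True by simp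
      then show ?thesis using True
        by (intro antisym) (auto intro!: SUP_upper2[of n] SUP_least split: split_indicator)
    qed simp
  qed
  also have "\<dots> = (SUP n. \<integral>\<^sup>+ t. ennreal (f t) * indicator (?S n) t \<partial>lebesgue)"
    by (intro nn_integral_monotone_convergence_SUP m)
      (auto simp: incseq_def le_fun_def split: split_indicator)
  also have "\<dots> \<le> ennreal B" by (intro SUP_least fin)
  finally show ?thesis .
qed

lemma ereal_integral_nonneg:
  assumes "\<And>t. t \<in> space M \<Longrightarrow> f t \<ge> 0"
  shows "ereal_integral M f = enn2ereal (\<integral>\<^sup>+ t. e2ennreal (f t) \<partial>M)"
proof -
  have "(\<integral>\<^sup>+ t. e2ennreal (- f t) \<partial>M) = (\<integral>\<^sup>+ t. 0 \<partial>M)"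
    using assms by (intro nn_integral_cong e2ennreal_neg) (simp add: ereal_uminus_le_reorder)
  then show ?thesis by (simp add: ereal_integral_def zero_ennreal.rep_eq)
qed

lemma ereal_integral_nonpos:
  assumes "\<And>t. t \<in> space M \<Longrightarrow> f t \<le> 0"
  shows "ereal_integral M f = - enn2ereal (\<integral>\<^sup>+ t. e2ennreal (- f t) \<partial>M)"
proof -
  have "(\<integral>\<^sup>+ t. e2ennreal (f t) \<partial>M) = (\<integral>\<^sup>+ t. 0 \<partial>M)"
    using assms by (intro nn_integral_cong e2ennreal_neg)
  then show ?thesis by (simp add: ereal_integral_def zero_ennreal.rep_eq)
qed

text \<open>For \<open>\<sigma> > 1\<close> the nonnegative integrand is the negative of the utility, with value \<open>\<infinity>\<close> at zero
  consumption; in both cases \<open>weight\<close> is the absolute value of the discounted utility.\<close>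

definition weight :: "real \<Rightarrow> real \<Rightarrow> real \<Rightarrow> real \<Rightarrow> ennreal" where
  "weight \<rho> \<sigma> t c = (if c = 0 \<and> \<sigma> > 1 then top else ennreal (exp (- \<rho> * t) * (c powr (1 - \<sigma>) / \<bar>1 - \<sigma>\<bar>)))"

text \<open>The sign of the utility is determined by \<sigma>, so one of the two parts in
  \<open>ereal_integral\<close> vanishes and both cases become statements about a single nonnegative
  integral.\<close>

lemma objective_eq_weight:
  assumes "\<sigma> \<noteq> 1"
  shows "objective A T \<rho> \<sigma> \<iota> i = (if \<sigma> < 1 then 1 else - 1) *
    enn2ereal (\<integral>\<^sup>+ t. weight \<rho> \<sigma> t (consumption A T \<iota> i t) \<partial>lebesgue_on {0..})"
proof (cases "\<sigma> < 1")
  case True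
  have "e2ennreal (ereal (exp (- \<rho> * t)) * utility \<sigma> c) = weight \<rho> \<sigma> t c" for t c
    using True by (simp add: utility_def weight_def)
  then show ?thesis unfolding objective_def using True
    by (subst ereal_integral_nonneg) (auto simp: utility_def)
next
  case False
  then have \<sigma>: "\<sigma> > 1" using assms by simp
  have "e2ennreal (- (ereal (exp (- \<rho> * t)) * utility \<sigma> c)) = weight \<rho> \<sigma> t c" for t c
  proof (cases "c = 0")
    case True
    then show ?thesis using \<sigma> by (simp add: utility_def weight_def)
  next
    case False
    have "- (exp (- \<rho> * t) * (c powr (1 - \<sigma>) / (1 - \<sigma>))) = exp (- \<rho> * t) * (c powr (1 - \<sigma>) / \<bar>1 - \<sigma>\<bar>)"
      using \<sigma> by (simp add: field_simps)
    then show ?thesis using False \<sigma> by (simp add: utility_def weight_def)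
  qed
  moreover have "ereal (exp (- \<rho> * t)) * utility \<sigma> c \<le> 0" for t c
    using \<sigma> by (auto simp: utility_def divide_le_0_iff mult_nonneg_nonpos)
  ultimately show ?thesis unfolding objective_def using \<sigma>
    by (subst ereal_integral_nonpos) auto
qed

section \<open>Comparison of admissible controls with the feedback control\<close>

context delay_growth
begin

definition consumption_scale :: real where "consumption_scale = rate * (A / \<xi>) * G0"

abbreviation opt_consumption :: "real \<Rightarrow> real" where
  "opt_consumption t \<equiv> consumption_scale * exp ((\<xi> - rate) * t)"

lemma consumption_scale_pos: "consumption_scale > 0"
  using rate_pos A xi_pos G0_pos by (simp add: consumption_scale_def)

text \<open>\<open>rate\<close> is exactly the solution of \<rho> + \<sigma> (\<xi> - rate) = \<xi>:
  the Euler condition that makes discounted marginal utility proportional to exp (- \<xi>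
  t).\<close>

lemma discount_opt_consumption:
  "exp (- \<rho> * t) * opt_consumption t powr (- \<sigma>) = consumption_scale powr (- \<sigma>) * exp (- \<xi> * t)"
proof -
  have "exp (- \<rho> * t) * opt_consumption t powr (- \<sigma>) = consumption_scale powr (- \<sigma>) * (exp (- \<rho> * t) * exp ((\<xi> - rate) * t * (- \<sigma>)))"
    using consumption_scale_pos by (simp add: powr_mult exp_powr_real)
  also have "exp (- \<rho> * t) * exp ((\<xi> - rate) * t * (- \<sigma>)) = exp (- \<rho> * t - \<sigma> * (\<xi> - rate) * t)"
    by (simp add: algebra_simps flip: exp_add)
  also have "- \<rho> * t - \<sigma> * (\<xi> - rate) * t = - \<xi> * t"
    using \<sigma> by (simp add: rate_def field_simps)
  finally show ?thesis .
qed

lemma weight_opt_consumption: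
  "weight \<rho> \<sigma> t (opt_consumption t) = ennreal (consumption_scale powr (1 - \<sigma>) / \<bar>1 - \<sigma>\<bar> * exp (- rate * t))"
proof -
  have c: "opt_consumption t > 0" using consumption_scale_pos by simp
  have "exp (- \<rho> * t) * opt_consumption t powr (1 - \<sigma>) = exp (- \<rho> * t) * opt_consumption t powr (- \<sigma>) * opt_consumption t"
    using c powr_add[of "opt_consumption t" "- \<sigma>" 1] by simp
  also have "\<dots> = consumption_scale powr (- \<sigma>) * consumption_scale * (exp (- \<xi> * t) * exp ((\<xi> - rate) * t))"
    unfolding discount_opt_consumption by simp
  also have "exp (- \<xi> * t) * exp ((\<xi> - rate) * t) = exp (- rate * t)"
    by (simp add: algebra_simps flip: exp_add)
  also have "consumption_scale powr (- \<sigma>) * consumption_scale = consumption_scale powr (1 - \<sigma>)"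
    using consumption_scale_pos powr_add[of consumption_scale "- \<sigma>" 1] by simp
  finally have e: "exp (- \<rho> * t) * (opt_consumption t powr (1 - \<sigma>) / \<bar>1 - \<sigma>\<bar>) = consumption_scale powr (1 - \<sigma>) / \<bar>1 - \<sigma>\<bar> * exp (- rate * t)"
    by simp
  have "opt_consumption t \<noteq> 0" using c by linarith
  then show ?thesis unfolding weight_def e by simp
qed

lemma integral_weight_opt:
  "(\<integral>\<^sup>+ t. weight \<rho> \<sigma> t (opt_consumption t) \<partial>lebesgue_on {0..}) = ennreal (consumption_scale powr (1 - \<sigma>) / \<bar>1 - \<sigma>\<bar> / rate)"
  unfolding weight_opt_consumption using rate_pos by (intro nn_integral_exp_decay) auto

text \<open>The factor 1 / rate lowers the exponent of \<open>rate\<close> from 1 - \<sigma> to -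
  \<sigma>, which is the first factor of \<open>nu\<close>.\<close>

lemma value_formula:
  "consumption_scale powr (1 - \<sigma>) / (1 - \<sigma>) / rate = nu A T \<rho> \<sigma> * (G0 powr (1 - \<sigma>) / (1 - \<sigma>))"
proof -
  have "rate powr (1 - \<sigma>) = rate * rate powr (- \<sigma>)"
    using rate_pos powr_add[of rate 1 "- \<sigma>"] by simp
  moreover have "consumption_scale powr (1 - \<sigma>) = rate powr (1 - \<sigma>) * (A / \<xi>) powr (1 - \<sigma>) * G0 powr (1 - \<sigma>)"
    by (simp only: consumption_scale_def powr_mult)
  ultimately show ?thesis
    using rate_pos unfolding nu_def rate_def[symmetric] by simp
qed

lemma admissible_consumption_integral:
  assumes j: "j \<in> admissible A T \<iota>"
  shows "(\<integral>\<^sup>+ t. ennreal (exp (- \<xi> * t) * consumption A T \<iota> j t) \<partial>lebesgue_on {0..}) \<le> ennreal (A / \<xi> * G0)"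
proof (rule nn_integral_atLeast_le)
  have sq: "\<And>\<tau>. \<tau> > 0 \<Longrightarrow> square_integrable_on j {0..\<tau>}" using j by (simp add: admissible_def)
  note esq = ext_square_integrable[OF T \<iota> sq]
  have adm: "AE t in lebesgue_on {0..}. 0 \<le> j t \<and> j t \<le> A * capital T \<iota> j t"
    using j by (simp add: admissible_def)
  then show "AE t in lebesgue_on {0..}. 0 \<le> exp (- \<xi> * t) * consumption A T \<iota> j t"
    by eventually_elim (simp add: consumption_def)
  fix \<tau> :: real assume \<tau>: "\<tau> > 0"
  have ce: "consumption A T \<iota> j s = A * fst (traj j s) - ext T \<iota> j s" if "s \<in> {0..\<tau>}" for s
    using capital_eq_hist[OF T \<iota> sq, of s] that T by (simp add: consumption_def ext_def glue_def)
  have "square_integrable_on (\<lambda>s. A * fst (traj j s) - ext T \<iota> j s) {0..\<tau>}"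
    by (intro L2_diff esq L2_continuous continuous_intros
        continuous_on_subset[OF hist_fst_continuous_on[OF T esq]]) auto
  moreover have "square_integrable_on (\<lambda>s. exp (- \<xi> * s)) {0..\<tau>}"
    by (intro L2_continuous continuous_intros)
  ultimately have "(\<lambda>s. exp (- \<xi> * s) * (A * fst (traj j s) - ext T \<iota> j s)) absolutely_integrable_on {0..\<tau>}"
    using L2_mult by blast
  then show "(\<lambda>s. exp (- \<xi> * s) * consumption A T \<iota> j s) absolutely_integrable_on {0..\<tau>}"
    by (rule absolutely_integrable_spike[of _ _ "{}"]) (auto simp: ce)
  have "0 \<le> Gamma0 A T (traj j \<tau>)"
    using adm \<tau> by (intro traj_nonneg(1)[OF sq]) (auto elim: eventually_mono)
  then have "0 \<le> exp (- \<xi> * \<tau>) * Gamma0 A T (traj j \<tau>)" by simp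
  also have "\<dots> = G0 - integral {0..\<tau>} (\<lambda>s. exp (- \<xi> * s) * (\<xi> / A * (A * fst (traj j s) - ext T \<iota> j s)))"
    using Gamma0_hist_discounted[OF A T AT esq, of \<tau>] \<tau> by (simp add: Gamma0_traj_0[OF sq])
  also have "integral {0..\<tau>} (\<lambda>s. exp (- \<xi> * s) * (\<xi> / A * (A * fst (traj j s) - ext T \<iota> j s)))
      = integral {0..\<tau>} (\<lambda>s. \<xi> / A * (exp (- \<xi> * s) * consumption A T \<iota> j s))"
    by (rule integral_cong) (simp add: ce)
  finally have "\<xi> / A * integral {0..\<tau>} (\<lambda>s. exp (- \<xi> * s) * consumption A T \<iota> j s) \<le> G0" by simp
  then show "integral {0..\<tau>} (\<lambda>s. exp (- \<xi> * s) * consumption A T \<iota> j s) \<le> A / \<xi> * G0"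
    using A xi_pos by (simp add: field_simps)
qed

lemma consumption_measurable:
  assumes sq: "\<And>\<tau>. \<tau> > 0 \<Longrightarrow> square_integrable_on j {0..\<tau>}"
  shows "consumption A T \<iota> j \<in> borel_measurable (lebesgue_on {0..})"
proof -
  note esq = ext_square_integrable[OF T \<iota> sq]
  have "(\<lambda>s. A * fst (traj j s)) \<in> borel_measurable (lebesgue_on {0..})"
    by (intro continuous_imp_measurable_on_sets_lebesgue continuous_intros hist_fst_continuous_on[OF T esq]) auto
  moreover have "ext T \<iota> j \<in> borel_measurable (lebesgue_on {0..})"
  proof -
    have "ext T \<iota> j integrable_on cbox a b" for a b
      using L2_integrable(2)[OF esq] by simp
    then have "ext T \<iota> j measurable_on UNIV" by (rule integrable_subintervals_imp_measurable)
    then have "ext T \<iota> j \<in> borel_measurable lebesgue" by (rule measurable_on_imp_borel_measurable_lebesgue_UNIV)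
    then show ?thesis by (rule measurable_restrict_space1)
  qed
  ultimately have "(\<lambda>s. A * fst (traj j s) - ext T \<iota> j s) \<in> borel_measurable (lebesgue_on {0..})"
    by (rule borel_measurable_diff)
  then show ?thesis
    by (rule measurable_cong[THEN iffD1, rotated])
      (use T in \<open>auto simp: consumption_def ext_def glue_def capital_eq_hist[OF T \<iota> sq]\<close>)
qed

text \<open>Concavity of the utility: its tangent at the optimal consumption has, after discounting, the slope
  \<open>consumption_scale powr (- \<sigma>) * exp (- \<xi> t)\<close>, a multiple of the price in the budget constraint above.\<close>

lemma objective_le_opt:
  assumes j: "j \<in> admissible A T \<iota>"
  shows "objective A T \<rho> \<sigma> \<iota> j \<le> ereal (nu A T \<rho> \<sigma> * (G0 powr (1 - \<sigma>) / (1 - \<sigma>)))"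
proof -
  let ?M = "lebesgue_on {0..} :: real measure"
  let ?c = "consumption A T \<iota> j"
  let ?w = "\<lambda>t. weight \<rho> \<sigma> t (?c t)" and ?w' = "\<lambda>t. weight \<rho> \<sigma> t (opt_consumption t)"
  define K where "K = consumption_scale powr (- \<sigma>)"
  \<comment> \<open>Both consumption paths valued at the shadow price K exp (- \<xi> t).\<close>
  let ?p = "\<lambda>t. ennreal (K * (exp (- \<xi> * t) * ?c t))" and ?p' = "\<lambda>t. ennreal (K * (exp (- \<xi> * t) * opt_consumption t))"
  have K: "K > 0" using consumption_scale_pos by (simp add: K_def)
  have c: "?c \<in> borel_measurable ?M" using j by (intro consumption_measurable) (simp add: admissible_def)
  have [measurable]: "(\<lambda>t. exp (b * t)) \<in> borel_measurable ?M" for b :: real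
    by (intro continuous_imp_measurable_on_sets_lebesgue continuous_intros) auto
  note [measurable] = c
  have wm: "?w \<in> borel_measurable ?M" unfolding weight_def by measurable
  have wm': "?w' \<in> borel_measurable ?M" unfolding weight_opt_consumption by measurable
  have pm: "?p \<in> borel_measurable ?M" "?p' \<in> borel_measurable ?M" by measurable
  have c0: "AE t in ?M. ?c t \<ge> 0"
  proof -
    have "AE t in ?M. 0 \<le> j t \<and> j t \<le> A * capital T \<iota> j t" using j unfolding admissible_def by blast
    then show ?thesis by eventually_elim (simp add: consumption_def)
  qed
  have tangent: "exp (- \<rho> * t) * (?c t powr (1 - \<sigma>) / (1 - \<sigma>)) + K * (exp (- \<xi> * t) * opt_consumption t)
      \<le> exp (- \<rho> * t) * (opt_consumption t powr (1 - \<sigma>) / (1 - \<sigma>)) + K * (exp (- \<xi> * t) * ?c t)"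
    if "?c t \<ge> 0" "?c t = 0 \<Longrightarrow> \<sigma> < 1" for t
  proof -
    let ?d = "opt_consumption t"
    have "exp (- \<rho> * t) * (?c t powr (1 - \<sigma>) / (1 - \<sigma>) + ?d powr (- \<sigma>) * ?d)
       \<le> exp (- \<rho> * t) * (?d powr (1 - \<sigma>) / (1 - \<sigma>) + ?d powr (- \<sigma>) * ?c t)"
      using consumption_scale_pos that \<sigma> by (intro mult_left_mono powr_tangent_bound_at) auto
    moreover have "exp (- \<rho> * t) * (?d powr (- \<sigma>) * y) = K * (exp (- \<xi> * t) * y)" for y
      using arg_cong[OF discount_opt_consumption[of t], of "\<lambda>x. x * y"] by (simp add: K_def mult.assoc)
    ultimately show ?thesis by (simp only: distrib_left)
  qed
  have P: "(\<integral>\<^sup>+ t. ?p t \<partial>?M) \<le> ennreal (K * (A / \<xi> * G0))"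
  proof -
    have "(\<integral>\<^sup>+ t. ?p t \<partial>?M) = (\<integral>\<^sup>+ t. ennreal K * ennreal (exp (- \<xi> * t) * ?c t) \<partial>?M)"
      using K by (simp add: ennreal_mult')
    also have "\<dots> = ennreal K * (\<integral>\<^sup>+ t. ennreal (exp (- \<xi> * t) * ?c t) \<partial>?M)"
      by (rule nn_integral_cmult) measurable
    also have "\<dots> \<le> ennreal K * ennreal (A / \<xi> * G0)"
      by (intro mult_left_mono admissible_consumption_integral j) auto
    finally show ?thesis by (simp only: ennreal_mult'[OF less_imp_le[OF K]])
  qed
  have P': "(\<integral>\<^sup>+ t. ?p' t \<partial>?M) = ennreal (K * (A / \<xi> * G0))"
  proof -
    have "?p' t = ennreal (K * consumption_scale * exp (- rate * t))" for t
    proof -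
      have "exp (- \<xi> * t) * exp ((\<xi> - rate) * t) = exp (- rate * t)"
        by (simp add: algebra_simps flip: exp_add)
      then show ?thesis by (simp only: mult.assoc mult.left_commute[of _ consumption_scale])
    qed
    then have "(\<integral>\<^sup>+ t. ?p' t \<partial>?M) = (\<integral>\<^sup>+ t. ennreal (K * consumption_scale * exp (- rate * t)) \<partial>?M)"
      by (rule nn_integral_cong)
    also have "\<dots> = ennreal (K * consumption_scale / rate)"
      using K consumption_scale_pos by (intro nn_integral_exp_decay rate_pos) auto
    finally have "(\<integral>\<^sup>+ t. ?p' t \<partial>?M) = ennreal (K * consumption_scale / rate)" .
    \<comment> \<open>The factor \<open>rate\<close> inside \<open>consumption_scale\<close>
      cancels: the candidate exhausts the budget.\<close>
    then show ?thesis using rate_pos by (simp add: consumption_scale_def)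
  qed
  let ?V = "ennreal (consumption_scale powr (1 - \<sigma>) / \<bar>1 - \<sigma>\<bar> / rate)"
  have V: "(\<integral>\<^sup>+ t. ?w' t \<partial>?M) = ?V" by (rule integral_weight_opt)
  have opt_pos: "opt_consumption t > 0" for t using consumption_scale_pos by simp
  show ?thesis
  proof (cases "\<sigma> < 1")
    case True
    have "AE t in ?M. ?w t + ?p' t \<le> ?w' t + ?p t"
      using c0
    proof eventually_elim
      case (elim t)
      then show ?case
        using tangent[of t] True K opt_pos[of t]
        by (simp add: weight_def less_imp_le flip: ennreal_plus)
    qed
    then have "(\<integral>\<^sup>+ t. ?w t + ?p' t \<partial>?M) \<le> (\<integral>\<^sup>+ t. ?w' t + ?p t \<partial>?M)" by (rule nn_integral_mono_AE)
    then have "(\<integral>\<^sup>+ t. ?w t \<partial>?M) + ennreal (K * (A / \<xi> * G0)) \<le> ?V + (\<integral>\<^sup>+ t. ?p t \<partial>?M)"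
      by (simp only: nn_integral_add[OF wm pm(2)] nn_integral_add[OF wm pm(1)]
          nn_integral_add[OF wm' pm(1)] nn_integral_add[OF wm' pm(2)] P' V)
    also have "\<dots> \<le> ?V + ennreal (K * (A / \<xi> * G0))" by (intro add_left_mono P)
    \<comment> \<open>The budget term is finite and may be cancelled. Until here everything was kept
      in sums, away from the truncated subtraction of \<open>ennreal\<close>.\<close>
    finally have "(\<integral>\<^sup>+ t. ?w t \<partial>?M) \<le> ?V"
      unfolding add.commute[of _ "ennreal (K * (A / \<xi> * G0))"] ennreal_add_left_cancel_le by simp
    then have "enn2ereal (\<integral>\<^sup>+ t. ?w t \<partial>?M) \<le> enn2ereal ?V" by (simp add: less_eq_ennreal.rep_eq)
    then show ?thesis
      unfolding value_formula[symmetric] using True rate_pos by (simp add: objective_eq_weight[OF \<sigma>(2)])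
  next
    case False
    have "AE t in ?M. ?w' t + ?p' t \<le> ?w t + ?p t"
      using c0
    proof eventually_elim
      case (elim t)
      show ?case
      proof (cases "?c t = 0")
        case True
        \<comment> \<open>At zero consumption with \<sigma> > 1 the weight is \<open>top\<close>, so
          the tangent bound is not consulted.\<close>
        then show ?thesis using False \<sigma> by (simp add: weight_def)
      next
        case c: False
        then have "exp (- \<rho> * t) * (opt_consumption t powr (1 - \<sigma>) / \<bar>1 - \<sigma>\<bar>) + K * (exp (- \<xi> * t) * opt_consumption t)
           \<le> exp (- \<rho> * t) * (?c t powr (1 - \<sigma>) / \<bar>1 - \<sigma>\<bar>) + K * (exp (- \<xi> * t) * ?c t)"
        proof -
          have "\<bar>1 - \<sigma>\<bar> = - (1 - \<sigma>)" using False by simp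
          then have neg: "y * (x / \<bar>1 - \<sigma>\<bar>) = - (y * (x / (1 - \<sigma>)))" for x y
            by (simp only: divide_minus_right mult_minus_right)
          show ?thesis using tangent[OF elim] c unfolding neg by linarith
        qed
        moreover have "weight \<rho> \<sigma> t y = ennreal (exp (- \<rho> * t) * (y powr (1 - \<sigma>) / \<bar>1 - \<sigma>\<bar>))" if "y \<noteq> 0" for y
          using that by (simp add: weight_def)
        moreover have "opt_consumption t \<noteq> 0" using opt_pos[of t] by linarith
        moreover have "0 \<le> K * (exp (- \<xi> * t) * opt_consumption t)" "0 \<le> K * (exp (- \<xi> * t) * ?c t)"
          using K elim opt_pos[of t] by (auto intro!: mult_nonneg_nonneg)
        ultimately show ?thesis
          using c by (simp only: ennreal_plus[symmetric] ennreal_leI not_False_eq_True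
              mult_nonneg_nonneg exp_ge_zero powr_ge_zero divide_nonneg_nonneg abs_ge_zero)
      qed
    qed
    then have "(\<integral>\<^sup>+ t. ?w' t + ?p' t \<partial>?M) \<le> (\<integral>\<^sup>+ t. ?w t + ?p t \<partial>?M)" by (rule nn_integral_mono_AE)
    then have "?V + ennreal (K * (A / \<xi> * G0)) \<le> (\<integral>\<^sup>+ t. ?w t \<partial>?M) + (\<integral>\<^sup>+ t. ?p t \<partial>?M)"
      by (simp only: nn_integral_add[OF wm pm(2)] nn_integral_add[OF wm pm(1)]
          nn_integral_add[OF wm' pm(1)] nn_integral_add[OF wm' pm(2)] P' V)
    also have "\<dots> \<le> (\<integral>\<^sup>+ t. ?w t \<partial>?M) + ennreal (K * (A / \<xi> * G0))" by (intro add_left_mono P)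
    finally have "?V \<le> (\<integral>\<^sup>+ t. ?w t \<partial>?M)"
      unfolding add.commute[of _ "ennreal (K * (A / \<xi> * G0))"] ennreal_add_left_cancel_le by simp
    then have "enn2ereal ?V \<le> enn2ereal (\<integral>\<^sup>+ t. ?w t \<partial>?M)" by (simp add: less_eq_ennreal.rep_eq)
    then have "- enn2ereal (\<integral>\<^sup>+ t. ?w t \<partial>?M) \<le> - enn2ereal ?V"
      by (simp only: ereal_minus_le_minus)
    moreover have "- enn2ereal ?V = ereal (consumption_scale powr (1 - \<sigma>) / (1 - \<sigma>) / rate)"
    proof -
      have "\<bar>1 - \<sigma>\<bar> = - (1 - \<sigma>)" using False by simp
      then have "consumption_scale powr (1 - \<sigma>) / \<bar>1 - \<sigma>\<bar> / rate = - (consumption_scale powr (1 - \<sigma>) / (1 - \<sigma>) / rate)"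
        by (simp only: divide_minus_right divide_minus_left)
      moreover have "0 \<le> consumption_scale powr (1 - \<sigma>) / \<bar>1 - \<sigma>\<bar> / rate" using rate_pos by simp
      ultimately show ?thesis by (simp only: enn2ereal_ennreal uminus_ereal.simps minus_minus)
    qed
    moreover have "objective A T \<rho> \<sigma> \<iota> j = - enn2ereal (\<integral>\<^sup>+ t. ?w t \<partial>?M)"
      using False by (simp add: objective_eq_weight[OF \<sigma>(2)])
    ultimately show ?thesis unfolding value_formula[symmetric] by (simp only:)
  qed
qed

lemma objective_opt:
  assumes "\<And>t. t \<ge> 0 \<Longrightarrow> consumption A T \<iota> i t = opt_consumption t"
  shows "objective A T \<rho> \<sigma> \<iota> i = ereal (nu A T \<rho> \<sigma> * (G0 powr (1 - \<sigma>) / (1 - \<sigma>)))"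
proof -
  have "(\<integral>\<^sup>+ t. weight \<rho> \<sigma> t (consumption A T \<iota> i t) \<partial>lebesgue_on {0..})
      = (\<integral>\<^sup>+ t. weight \<rho> \<sigma> t (opt_consumption t) \<partial>lebesgue_on {0..})"
    by (intro nn_integral_cong) (simp add: assms)
  moreover have "consumption_scale powr (1 - \<sigma>) / \<bar>1 - \<sigma>\<bar> / rate
      = (if \<sigma> < 1 then 1 else - 1) * (consumption_scale powr (1 - \<sigma>) / (1 - \<sigma>) / rate)"
  proof (cases "\<sigma> < 1")
    case False
    then have "\<bar>1 - \<sigma>\<bar> = - (1 - \<sigma>)" by simp
    then show ?thesis
      by (simp only: False if_False divide_minus_right divide_minus_left mult_minus1)
  qed simp
  moreover have "0 \<le> consumption_scale powr (1 - \<sigma>) / \<bar>1 - \<sigma>\<bar> / rate" using rate_pos by simp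
  ultimately show ?thesis
    unfolding value_formula[symmetric] objective_eq_weight[OF \<sigma>(2)] integral_weight_opt
    by (simp add: enn2ereal_ennreal)
qed

lemma verification:
  "\<exists>y. closed_loop_solution T (feedback A T \<rho> \<sigma>) (initial_capital T \<iota>, F T \<iota>) y
     \<and> (\<forall>y'. closed_loop_solution T (feedback A T \<rho> \<sigma>) (initial_capital T \<iota>, F T \<iota>) y' \<longrightarrow> (\<forall>t\<ge>0. eqX T (y' t) (y t)))
     \<and> (\<forall>t\<ge>0. y t \<in> region A T \<rho> \<sigma> \<and> fst (y t) > 0 \<and> feedback A T \<rho> \<sigma> (y t) > 0)
     \<and> optimal A T \<rho> \<sigma> \<iota> (\<lambda>t. feedback A T \<rho> \<sigma> (y t))
     \<and> value_function A T \<rho> \<sigma> \<iota> = ereal (v A T \<rho> \<sigma> (initial_capital T \<iota>, F T \<iota>))"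
proof -
  obtain u where u: "continuous_on {0..} u"
    and ue: "\<And>t. t \<ge> 0 \<Longrightarrow> u t = A * fst (traj u t) - rate * (A / \<xi>) * (G0 * exp ((\<xi> - rate) * t))"
    using Volterra_control_exists by blast
  note sq = continuous_square_integrable[OF u]
  let ?i = "\<lambda>t. feedback A T \<rho> \<sigma> (traj u t)"
  have G: "Gamma0 A T (traj u t) = G0 * exp ((\<xi> - rate) * t)" if "t \<ge> 0" for t
    by (rule Volterra_Gamma0[OF sq ue that])
  have i: "?i t = u t" if "t \<ge> 0" for t using ue[OF that] G[OF that] by (simp add: feedback_eq)
  have i_cont: "continuous_on {0..} ?i" using u by (rule continuous_on_eq) (simp add: i)
  have sq_i: "square_integrable_on ?i {0..\<tau>}" for \<tau> by (rule continuous_square_integrable[OF i_cont])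
  \<comment> \<open>\<open>?i\<close> and \<open>u\<close> are known to agree for t \<ge> 0 only;
    \<open>ext\<close> reads the control at those times only, so both have the same
    trajectory.\<close>
  have ext_i: "ext T \<iota> ?i = ext T \<iota> u" by (auto simp: ext_def glue_def i)
  have sol: "closed_loop_solution T (feedback A T \<rho> \<sigma>) (initial_capital T \<iota>, F T \<iota>) (traj u)"
    unfolding closed_loop_solution_def using traj_state_solution[OF i_cont] by (simp add: ext_i)
  have pos: "u t > 0" "fst (traj u t) > 0" if "t \<ge> 0" for t
    using Volterra_control_pos[OF u ue that] by blast+
  have region: "traj u t \<in> region A T \<rho> \<sigma>" if "t \<ge> 0" for t
    using i[OF that] pos[OF that] G[OF that] G0_pos hist_spaceX[OF T ext_square_integrable[OF T \<iota> sq]]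
    by (simp add: region_def feedback_def)
  have capital: "capital T \<iota> ?i t = fst (traj u t)" if "t \<ge> 0" for t
    using capital_eq_hist[OF T \<iota> sq_i that] by (simp add: ext_i)
  have cons: "consumption A T \<iota> ?i t = opt_consumption t" if "t \<ge> 0" for t
    using ue[OF that] i[OF that] capital[OF that] by (simp add: consumption_def consumption_scale_def)
  have adm: "?i \<in> admissible A T \<iota>"
    unfolding admissible_def
  proof (intro CollectI conjI allI impI sq_i AE_I2)
    fix t :: real assume "t \<in> space (lebesgue_on {0..})"
    then have t: "t \<ge> 0" by simp
    show "0 \<le> ?i t" using i[OF t] pos[OF t] by simp
    have "opt_consumption t > 0" using consumption_scale_pos by simp
    then show "?i t \<le> A * capital T \<iota> ?i t" using cons[OF t] by (simp add: consumption_def)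
  qed
  have obj: "objective A T \<rho> \<sigma> \<iota> ?i = ereal (v A T \<rho> \<sigma> (initial_capital T \<iota>, F T \<iota>))"
    using objective_opt[OF cons] by (simp add: v_def G0_def)
  have le: "objective A T \<rho> \<sigma> \<iota> j \<le> objective A T \<rho> \<sigma> \<iota> ?i" if "j \<in> admissible A T \<iota>" for j
    using objective_le_opt[OF that] obj by (simp add: v_def G0_def)
  have opt: "optimal A T \<rho> \<sigma> \<iota> ?i" using adm le by (simp add: optimal_def)
  have val: "value_function A T \<rho> \<sigma> \<iota> = objective A T \<rho> \<sigma> \<iota> ?i"
    unfolding value_function_def by (intro antisym SUP_least le SUP_upper adm)
  show ?thesis
  proof (intro exI[of _ "traj u"] conjI allI impI sol region opt)
    show "eqX T (y' t) (traj u t)"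
      if "closed_loop_solution T (feedback A T \<rho> \<sigma>) (initial_capital T \<iota>, F T \<iota>) y'" "0 \<le> t" for y' t
      by (rule closed_loop_unique[OF u ue that])
  qed (use pos i val obj in auto)
qed

end

theorem theorem5p13:
  fixes A T \<rho> \<sigma> k\<^sub>0 :: real and \<iota> :: "real \<Rightarrow> real" and x :: state
  assumes "A > 0" "T > 0" "\<rho> > 0" "\<sigma> > 0" "\<sigma> \<noteq> 1"
    and "A * T > 1"
    and "\<rho> > xi A T * (1 - \<sigma>)"
    and "(\<rho> - xi A T * (1 - \<sigma>)) / \<sigma> < A"
    and "square_integrable_on \<iota> {-T..0}"
    and "AE s in lebesgue_on {-T..<0}. \<iota> s \<ge> 0"
    and "k\<^sub>0 = (LINT s|lebesgue_on {-T..0}. \<iota> s)" and "k\<^sub>0 > 0"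
    and "x = (k\<^sub>0, F T \<iota>)"
  shows "\<exists>y. closed_loop_solution T (feedback A T \<rho> \<sigma>) x y
     \<and> (\<forall>y'. closed_loop_solution T (feedback A T \<rho> \<sigma>) x y' \<longrightarrow> (\<forall>t\<ge>0. eqX T (y' t) (y t)))
     \<and> (\<forall>t\<ge>0. y t \<in> region A T \<rho> \<sigma> \<and> fst (y t) > 0 \<and> feedback A T \<rho> \<sigma> (y t) > 0)
     \<and> optimal A T \<rho> \<sigma> \<iota> (\<lambda>t. feedback A T \<rho> \<sigma> (y t))
     \<and> value_function A T \<rho> \<sigma> \<iota> = ereal (v A T \<rho> \<sigma> x)"
proof -
  have k: "k\<^sub>0 = initial_capital T \<iota>" using assms by (simp add: initial_capital_def)
  interpret delay_growth A T \<rho> \<sigma> \<iota>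
    by unfold_locales (use assms k in auto)
  show ?thesis using verification unfolding \<open>x = _\<close> k .
qed

end
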